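(* Let $d,m,n\ge1$ be integers and let $A$ be a linear differential (or pseudo-differential) operator with constant coefficients, with symbol matrix $M(\xi)\in\mathbb{C}^{n\times m}$, $\xi\in\mathbb{R}^d$. Suppose that $M(\xi)$ admits a pseudo-inverse $M(\xi)^\dagger$ such that $M(\xi)M(\xi)^\dagger=\mathrm{Id}$ for all $\xi\neq(0,\dots,0)$. Suppose also that there exists $\rho<1$ such that for all $j\in\mathbb{Z}$ and all $\varepsilon\in\{0,1\}^d\setminus\{(0,\dots,0)\}$ there exists a matrix $M_{\omega_{j,\varepsilon}}\in\mathbb{R}^{n\times m}$ with $$\|\mathrm{Id}-M(\xi)M_{\omega_{j,\varepsilon}}^\dagger\|\le\rho\qquad\text{for all }\xi\in\prod_{i=1}^d\pm[\varepsilon_i2^j\pi,(\varepsilon_i+1)2^j\pi].$$ Then the preconditioned Richardson iteration on wavelet coefficients $$\underline{\mathbf u}_0=0,\qquad \underline{\mathbf u}_p=\underline{\mathbf u}_{p-1}+\underline{D}^{-1}\big(\underline{\mathbf v}-\underline{A}\,\underline{\mathbf u}_{p-1}\big)\quad(p\ge1)$$ for the equation $A\mathbf u=\mathbf v$, using the multiresolution (MRA) decomposition with Shannon wavelets and with $\underline{D}^{-1}$ the preconditioner that applies $M_{\omega_{j,\varepsilon}}^\dagger$ to the coefficients of level $(j,\varepsilon)$, converges.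
   Context: Symbol: $\widehat{A\mathbf u}(\xi)=M(\xi)\widehat{\mathbf u}(\xi)$. The operator $A$ is assumed continuous from $(H^{t/2}(\mathbb{R}^d))^m$ to $(H^{-t/2}(\mathbb{R}^d))^n$, where $H^s$ is the Sobolev space of distributions $f$ with $(1+|\xi|^2)^{s/2}\widehat f\in L^2$. $N^\dagger$ denotes the pseudo-inverse of a matrix $N$. $\|\cdot\|$ is the operator norm on matrices. $\pm[a,b]$ means $[-b,-a]\cup[a,b]$. Shannon wavelets: $\widehat\varphi=\chi_{[-\pi,\pi]}$, $\widehat\psi(\xi)=e^{-i\xi/2}\chi_{[-2\pi,-\pi]\cup[\pi,2\pi]}(\xi)$, $\varphi_{jk}(x)=2^{j/2}\varphi(2^jx-k)$, $\psi_{jk}(x)=2^{j/2}\psi(2^jx-k)$. The $d$-dimensional MRA wavelets of level $(j,\varepsilon)$, with $j\in\mathbb{Z}$ and $\varepsilon\in\{0,1\}^d\setminus\{(0,\dots,0)\}$, are the products over $i=1,\dots,d$ of $\varphi_{jk_i}(x_i)$ if $\varepsilon_i=0$ and $\psi_{jk_i}(x_i)$ if $\varepsilon_i=1$, with $\mathbf k\in\mathbb{Z}^d$. Their Fourier transforms are supported in $\prod_i\pm[\varepsilon_i2^j\pi,(\varepsilon_i+1)2^j\pi]$. Vector functions are decomposed componentwise in this basis. $\underline{\mathbf v}$ and $\underline{\mathbf u}_p$ are the vectors of wavelet coefficients of $\mathbf v$ and of the $p$-th iterate. $\underline{A}$ is the matrix of $A$ in the wavelet basis (entries are the pairings of $A$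 applied to a wavelet with a dual wavelet). For each level $(j,\varepsilon)$ and each $\mathbf k$, $\underline{D}^{-1}$ multiplies the vector of the $n$ component coefficients by the constant matrix $M_{\omega_{j,\varepsilon}}^\dagger$. Meaning of "converges": there is a constant $r<1$ such that, for all $p\ge1$, $\|\underline{\mathbf v}-\underline{A}\,\underline{\mathbf u}_p\|_{\ell^2_{-t/2}}\le r\,\|\underline{\mathbf v}-\underline{A}\,\underline{\mathbf u}_{p-1}\|_{\ell^2_{-t/2}}$. Here $\|\cdot\|_{\ell^2_s}^2$ is the sum of the squared moduli of the coefficients, those of level $(j,\varepsilon)$ being weighted by $2^{2sj}$. *)

theory Defs
  imports "HOL-Analysis.Analysis"
begin

section \<open>Schwartz functions and tempered distributions\<close>

text \<open>Iterated directional derivatives. With \<open>bs\<close> ranging over lists of basis vectors these are the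
  iterated partial derivatives (each multi-index occurring once for every ordering).\<close>

primrec dpart :: "'a list \<Rightarrow> ('a::euclidean_space \<Rightarrow> complex) \<Rightarrow> 'a \<Rightarrow> complex" where
  "dpart [] f = f"
| "dpart (b # bs) f = (\<lambda>x. frechet_derivative (dpart bs f) (at x) b)"

definition schwartz :: "('a::euclidean_space \<Rightarrow> complex) \<Rightarrow> bool" where
  "schwartz f \<longleftrightarrow> (\<forall>bs \<in> lists Basis.
      (\<forall>x. dpart bs f differentiable (at x)) \<and>
      (\<forall>N::nat. bounded (range (\<lambda>x. (1 + norm x) ^ N *\<^sub>R dpart bs f x))))"

definition schwartz_seminorm :: "nat \<Rightarrow> ('a::euclidean_space \<Rightarrow> complex) \<Rightarrow> real" where
  "schwartz_seminorm N f =
     (SUP (bs, x) \<in> {bs \<in> lists Basis. length bs \<le> N} \<times> UNIV. (1 + norm x) ^ N * cmod (dpart bs f x))"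

text \<open>A distribution is a functional on test functions. Only its values on Schwartz functions are
  meaningful; nothing below depends on the others.\<close>

type_synonym 'a distr = "('a \<Rightarrow> complex) \<Rightarrow> complex"

definition tempered :: "'a::euclidean_space distr \<Rightarrow> bool" where
  "tempered T \<longleftrightarrow>
     (\<forall>f g a. schwartz f \<longrightarrow> schwartz g \<longrightarrow> T (\<lambda>x. a * f x + g x) = a * T f + T g) \<and>
     (\<exists>C N. \<forall>f. schwartz f \<longrightarrow> cmod (T f) \<le> C * schwartz_seminorm N f)"

definition distr_of_fun :: "('a::euclidean_space \<Rightarrow> complex) \<Rightarrow> 'a distr" where
  "distr_of_fun f = (\<lambda>\<theta>. LINT x|lborel. f x * \<theta> x)"


section \<open>Fourier transform and Sobolev spaces\<close>

definition fourier :: "('a::euclidean_space \<Rightarrow> complex) \<Rightarrow> 'a \<Rightarrow> complex" where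
  "fourier f \<xi> = (LINT x|lborel. f x * cis (- (x \<bullet> \<xi>)))"

definition inv_fourier :: "('a::euclidean_space \<Rightarrow> complex) \<Rightarrow> 'a \<Rightarrow> complex" where
  "inv_fourier g x = complex_of_real (1 / (2 * pi) ^ DIM('a)) * (LINT \<xi>|lborel. g \<xi> * cis (x \<bullet> \<xi>))"

text \<open>The Fourier transform of \<open>T\<close>, i.e. the distribution \<open>\<theta> \<mapsto> T (fourier \<theta>)\<close>, is the function \<open>g\<close>.\<close>

definition has_fourier :: "'a::euclidean_space distr \<Rightarrow> ('a \<Rightarrow> complex) \<Rightarrow> bool" where
  "has_fourier T g \<longleftrightarrow> g \<in> borel_measurable lborel \<and>
     (\<forall>\<theta>. schwartz \<theta> \<longrightarrow> integrable lborel (\<lambda>\<xi>. g \<xi> * \<theta> \<xi>) \<and>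
                       T (fourier \<theta>) = (LINT \<xi>|lborel. g \<xi> * \<theta> \<xi>))"

text \<open>The function \<open>g\<close> above is unique up to null sets; \<open>ft T\<close> is a fixed representative.\<close>

definition ft :: "'a::euclidean_space distr \<Rightarrow> 'a \<Rightarrow> complex" where
  "ft T = (SOME g. has_fourier T g)"

definition sobolev :: "real \<Rightarrow> 'a::euclidean_space distr set" where
  "sobolev s = {T. tempered T \<and> (\<exists>g. has_fourier T g) \<and>
     integrable lborel (\<lambda>\<xi>. ((1 + (norm \<xi>)\<^sup>2) powr (s / 2) * cmod (ft T \<xi>))\<^sup>2)}"

definition sobolev_norm :: "real \<Rightarrow> 'a::euclidean_space distr \<Rightarrow> real" where
  "sobolev_norm s T = sqrt (LINT \<xi>|lborel. ((1 + (norm \<xi>)\<^sup>2) powr (s / 2) * cmod (ft T \<xi>))\<^sup>2)"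

text \<open>The duality pairing of \<open>sobolev (-s)\<close> with \<open>sobolev s\<close> extending the inner product
  \<open>\<integral> f(x) cnj (g(x)) dx\<close> of square-integrable functions, written out via Parseval's formula because
  the wavelets below are not Schwartz functions.\<close>

definition sobolev_pairing :: "'a::euclidean_space distr \<Rightarrow> 'a distr \<Rightarrow> complex" where
  "sobolev_pairing f g =
     complex_of_real (1 / (2 * pi) ^ DIM('a)) * (LINT \<xi>|lborel. ft f \<xi> * cnj (ft g \<xi>))"


section \<open>Operators with constant coefficients\<close>

text \<open>Vector-valued distributions are families of components.  Continuity of a linear map is expressed by
  boundedness.\<close>

definition continuous_operator ::
  "real \<Rightarrow> (('m::finite \<Rightarrow> 'a::euclidean_space distr) \<Rightarrow> ('n::finite \<Rightarrow> 'a distr)) \<Rightarrow> bool" where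
  "continuous_operator t A \<longleftrightarrow>
     (\<forall>u. (\<forall>l. u l \<in> sobolev (t / 2)) \<longrightarrow> (\<forall>i. A u i \<in> sobolev (- t / 2))) \<and>
     (\<forall>u w a. (\<forall>l. u l \<in> sobolev (t / 2)) \<longrightarrow> (\<forall>l. w l \<in> sobolev (t / 2)) \<longrightarrow>
        (\<forall>i \<theta>. schwartz \<theta> \<longrightarrow> A (\<lambda>l \<eta>. a * u l \<eta> + w l \<eta>) i \<theta> = a * A u i \<theta> + A w i \<theta>)) \<and>
     (\<exists>C. \<forall>u. (\<forall>l. u l \<in> sobolev (t / 2)) \<longrightarrow>
        L2_set (\<lambda>i. sobolev_norm (- t / 2) (A u i)) UNIV \<le> C * L2_set (\<lambda>l. sobolev_norm (t / 2) (u l)) UNIV)"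

definition has_symbol ::
  "real \<Rightarrow> (('m::finite \<Rightarrow> 'a::euclidean_space distr) \<Rightarrow> ('n::finite \<Rightarrow> 'a distr)) \<Rightarrow>
   ('a \<Rightarrow> complex^'m^'n) \<Rightarrow> bool" where
  "has_symbol t A M \<longleftrightarrow>
     (\<forall>u. (\<forall>l. u l \<in> sobolev (t / 2)) \<longrightarrow>
        (\<forall>i. AE \<xi> in lborel. ft (A u i) \<xi> = (M \<xi> *v (\<chi> l. ft (u l) \<xi>)) $ i))"


section \<open>Pseudo-inverse (Moore--Penrose) of a matrix\<close>

definition conj_transpose :: "complex^'m^'n \<Rightarrow> complex^'n^'m" where
  "conj_transpose N = (\<chi> i j. cnj (N $ j $ i))"

definition is_pinv :: "complex^'m::finite^'n::finite \<Rightarrow> complex^'n^'m \<Rightarrow> bool" where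
  "is_pinv N P \<longleftrightarrow> N ** P ** N = N \<and> P ** N ** P = P \<and>
     conj_transpose (N ** P) = N ** P \<and> conj_transpose (P ** N) = P ** N"

text \<open>Every matrix has exactly one Moore--Penrose inverse.\<close>

definition pinv :: "complex^'m::finite^'n::finite \<Rightarrow> complex^'n^'m" where
  "pinv N = (THE P. is_pinv N P)"

text \<open>The pseudo-inverse of a real matrix is real, so it commutes with this embedding.\<close>

definition cmat :: "real^'m^'n \<Rightarrow> complex^'m^'n" where
  "cmat N = (\<chi> i j. complex_of_real (N $ i $ j))"


section \<open>Shannon wavelets\<close>

definition shannon_phi_hat :: "real \<Rightarrow> complex" where
  "shannon_phi_hat \<xi> = indicator {-pi..pi} \<xi>"

definition shannon_psi_hat :: "real \<Rightarrow> complex" where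
  "shannon_psi_hat \<xi> = cis (- \<xi> / 2) * indicator ({-2*pi..-pi} \<union> {pi..2*pi}) \<xi>"

definition shannon_phi :: "real \<Rightarrow> complex" where
  "shannon_phi = inv_fourier shannon_phi_hat"

definition shannon_psi :: "real \<Rightarrow> complex" where
  "shannon_psi = inv_fourier shannon_psi_hat"

definition phi_jk :: "int \<Rightarrow> int \<Rightarrow> real \<Rightarrow> complex" where
  "phi_jk j k x = complex_of_real (2 powr (real_of_int j / 2)) * shannon_phi (2 powi j * x - real_of_int k)"

definition psi_jk :: "int \<Rightarrow> int \<Rightarrow> real \<Rightarrow> complex" where
  "psi_jk j k x = complex_of_real (2 powr (real_of_int j / 2)) * shannon_psi (2 powi j * x - real_of_int k)"

definition wavelet_types :: "(nat^'d::finite) set" where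
  "wavelet_types = {\<epsilon>. \<forall>i. \<epsilon> $ i \<in> {0, 1}} - {0}"

text \<open>A wavelet index is \<open>(j, \<epsilon>, k)\<close>.\<close>

type_synonym 'd windex = "int \<times> (nat^'d) \<times> (int^'d)"

definition windices :: "'d::finite windex set" where
  "windices = UNIV \<times> wavelet_types \<times> UNIV"

fun wavelet :: "'d::finite windex \<Rightarrow> real^'d \<Rightarrow> complex" where
  "wavelet (j, \<epsilon>, k) x =
     (\<Prod>i\<in>UNIV. if \<epsilon> $ i = 0 then phi_jk j (k $ i) (x $ i) else psi_jk j (k $ i) (x $ i))"

definition pm_interval :: "real \<Rightarrow> real \<Rightarrow> real set" where
  "pm_interval a b = {-b..-a} \<union> {a..b}"

definition frequency_box :: "int \<Rightarrow> nat^'d \<Rightarrow> (real^'d) set" where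
  "frequency_box j \<epsilon> =
     {\<xi>. \<forall>i. \<xi> $ i \<in> pm_interval (real (\<epsilon> $ i) * 2 powi j * pi) ((real (\<epsilon> $ i) + 1) * 2 powi j * pi)}"


section \<open>Wavelet coefficients and the preconditioned Richardson iteration\<close>

text \<open>The Shannon wavelets are orthonormal, so each wavelet is its own dual wavelet.\<close>

definition wcoeff :: "('n::finite \<Rightarrow> (real^'d::finite) distr) \<Rightarrow> 'd windex \<Rightarrow> complex^'n" where
  "wcoeff v \<mu> = (\<chi> i. sobolev_pairing (v i) (distr_of_fun (wavelet \<mu>)))"

definition vec_wavelet :: "'d::finite windex \<Rightarrow> 'm \<Rightarrow> 'm \<Rightarrow> (real^'d) distr" where
  "vec_wavelet \<nu> l = (\<lambda>l'. if l' = l then distr_of_fun (wavelet \<nu>) else (\<lambda>_. 0))"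

definition wmatrix ::
  "(('m::finite \<Rightarrow> (real^'d::finite) distr) \<Rightarrow> ('n::finite \<Rightarrow> (real^'d) distr)) \<Rightarrow>
   'd windex \<times> 'n \<Rightarrow> 'd windex \<times> 'm \<Rightarrow> complex" where
  "wmatrix A = (\<lambda>(\<mu>, i) (\<nu>, l). wcoeff (A (vec_wavelet \<nu> l)) \<mu> $ i)"

definition wmatrix_apply ::
  "(('m::finite \<Rightarrow> (real^'d::finite) distr) \<Rightarrow> ('n::finite \<Rightarrow> (real^'d) distr)) \<Rightarrow>
   ('d windex \<Rightarrow> complex^'m) \<Rightarrow> 'd windex \<Rightarrow> complex^'n" where
  "wmatrix_apply A c \<mu> =
     (\<chi> i. \<Sum>\<^sub>\<infinity>(\<nu>, l)\<in>windices \<times> UNIV. wmatrix A (\<mu>, i) (\<nu>, l) * c \<nu> $ l)"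

fun preconditioner ::
  "(int \<Rightarrow> nat^'d::finite \<Rightarrow> real^'m::finite^'n::finite) \<Rightarrow> ('d windex \<Rightarrow> complex^'n) \<Rightarrow> 'd windex \<Rightarrow> complex^'m" where
  "preconditioner M\<omega> c (j, \<epsilon>, k) = pinv (cmat (M\<omega> j \<epsilon>)) *v c (j, \<epsilon>, k)"

primrec richardson ::
  "(('m::finite \<Rightarrow> (real^'d::finite) distr) \<Rightarrow> ('n::finite \<Rightarrow> (real^'d) distr)) \<Rightarrow>
   (int \<Rightarrow> nat^'d \<Rightarrow> real^'m^'n) \<Rightarrow> ('n \<Rightarrow> (real^'d) distr) \<Rightarrow> nat \<Rightarrow> 'd windex \<Rightarrow> complex^'m" where
  "richardson A M\<omega> v 0 = (\<lambda>_. 0)"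
| "richardson A M\<omega> v (Suc p) = (\<lambda>\<nu>. richardson A M\<omega> v p \<nu> +
     preconditioner M\<omega> (\<lambda>\<mu>. wcoeff v \<mu> - wmatrix_apply A (richardson A M\<omega> v p) \<mu>) \<nu>)"

text \<open>The weighted norm takes values in \<open>[0, \<infinity>]\<close>: the weights are those of the homogeneous scale, so the
  coefficients of an element of the inhomogeneous space \<open>sobolev s\<close> may have infinite norm.\<close>

definition wnorm_sq :: "real \<Rightarrow> ('d::finite windex \<Rightarrow> complex^'n::finite) \<Rightarrow> ennreal" where
  "wnorm_sq s c = (\<Sum>\<^sub>\<infinity>(j, \<epsilon>, k)\<in>windices.
     ennreal (2 powr (2 * s * real_of_int j) * (\<Sum>i\<in>UNIV. (cmod (c (j, \<epsilon>, k) $ i))\<^sup>2)))"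

definition wnorm :: "real \<Rightarrow> ('d::finite windex \<Rightarrow> complex^'n::finite) \<Rightarrow> ennreal" where
  "wnorm s c = (if wnorm_sq s c = \<infinity> then \<infinity> else ennreal (sqrt (enn2real (wnorm_sq s c))))"

end

theory Submission
  imports Defs "HOL-Probability.Characteristic_Functions" "HOL-Probability.Sinc_Integral"
begin

text \<open>The Fourier transforms of the wavelets of one level \<open>(j, \<epsilon>)\<close> form an orthonormal basis, up to the factor
  \<open>(2\<pi>)^(d/2)\<close>, of the square-integrable functions on the frequency box of that level, and the boxes of different
  levels overlap only in null sets.  Hence the matrix of \<open>A\<close> is block diagonal, and on one level it acts as
  multiplication by \<open>M\<close> on functions on the box, while the preconditioner acts as multiplication by the constant
  matrix \<open>P\<close>, the pseudo-inverse of \<open>M\<omega> j \<epsilon>\<close>.  The \<open>p\<close>-th residual is therefore the coefficient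
  sequence of a function \<open>R\<^sub>p\<close> with \<open>R\<^sub>p = (1 - M P) R\<^sub>p\<^sub>-\<^sub>1\<close>, so it is contracted pointwise by \<open>\<rho>\<close>.  Parseval's
  identity turns this into a contraction of the coefficients of the level, and the weights are constant on a level.\<close>

section \<open>Integrals of products of one-variable functions\<close>

text \<open>Since \<open>ft\<close> is a Hilbert choice, the transform of a concrete wavelet is
  known only through two facts: Fourier inversion on Schwartz functions, which exhibits one
  representative, and uniqueness of representatives up to null sets. Identities between transforms
  are therefore almost-everywhere statements. Completeness of a level has a geometric source. Its
  wavelets are, on the Fourier side, one function of constant modulus on the box times the
  characters of a torus of period 2 * pi * 2^j, and up to null sets the box embeds injectively into
  that torus; Stone-Weierstrass on the torus then gives density. The obstacle in the operator part
  is that the symbol entries are only shown to be square integrable on a box, so their product with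
  a square-integrable function is not known to be square integrable. Matrix sums are therefore
  evaluated by moving the symbol onto the bounded test wavelet, and square integrability of each
  \<open>R\<^sub>p\<close> is drawn from the contraction itself instead of from a bound on
  \<open>M\<close>.\<close>

lemma lborel_prod_integral:
  fixes f :: "'a::euclidean_space \<Rightarrow> real \<Rightarrow> 'c::{real_normed_field,banach,second_countable_topology}"
  assumes "\<And>b. b \<in> Basis \<Longrightarrow> integrable lborel (f b)"
  shows lborel_prod_integrable: "integrable lborel (\<lambda>x. \<Prod>b\<in>Basis. f b (x \<bullet> b))"
    and "(LINT x|lborel. (\<Prod>b\<in>Basis. f b (x \<bullet> b))) = (\<Prod>b\<in>Basis. LINT x|lborel. f b x)"
proof -
  interpret product_sigma_finite "\<lambda>b::'a. lborel :: real measure" ..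
  have [measurable]: "f b \<in> borel_measurable borel" if "b \<in> Basis" for b
    using assms[OF that] by auto
  have T: "(\<lambda>f. \<Sum>b\<in>Basis. f b *\<^sub>R b) \<in> (\<Pi>\<^sub>M b\<in>(Basis::'a set). lborel) \<rightarrow>\<^sub>M borel"
    by measurable
  have g: "(\<lambda>x::'a. \<Prod>b\<in>Basis. f b (x \<bullet> b)) \<in> borel_measurable borel"
    by measurable
  have eq: "(\<Prod>b\<in>Basis. f b ((\<Sum>b\<in>Basis. x b *\<^sub>R b) \<bullet> b)) = (\<Prod>b\<in>Basis. f b (x b))" for x :: "'a \<Rightarrow> real"
    by (intro prod.cong refl) simp
  show "integrable lborel (\<lambda>x. \<Prod>b\<in>Basis. f b (x \<bullet> b))"
    by (subst lborel_eq, subst integrable_distr_eq[OF T g])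
      (unfold eq, rule product_integrable_prod, auto intro: assms)
  show "(LINT x|lborel. (\<Prod>b\<in>Basis. f b (x \<bullet> b))) = (\<Prod>b\<in>Basis. LINT x|lborel. f b x)"
    by (subst lborel_eq, subst integral_distr[OF T g])
      (unfold eq, rule product_integral_prod, auto intro: assms)
qed

lemma prod_Basis_vec:
  fixes f :: "real^'d::finite \<Rightarrow> 'c::comm_monoid_mult"
  shows "(\<Prod>b\<in>Basis. f b) = (\<Prod>i\<in>UNIV. f (axis i 1))"
proof -
  have B: "(Basis :: (real^'d) set) = (\<lambda>i. axis i 1) ` UNIV"
    by (auto simp: Basis_vec_def)
  have "inj (\<lambda>i::'d. axis i (1::real))"
    by (auto simp: inj_on_def axis_eq_axis)
  then show ?thesis unfolding B by (subst prod.reindex) auto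
qed

lemma lborel_prod_integral_vec:
  fixes f :: "'d::finite \<Rightarrow> real \<Rightarrow> 'c::{real_normed_field,banach,second_countable_topology}"
  assumes "\<And>i. integrable lborel (f i)"
  shows "integrable lborel (\<lambda>x. \<Prod>i\<in>UNIV. f i (x $ i))"
    and "(LINT x|lborel. (\<Prod>i\<in>UNIV. f i (x $ i))) = (\<Prod>i\<in>UNIV. LINT x|lborel. f i x)"
proof -
  \<comment> \<open>Converts a family indexed by coordinates into one indexed by basis vectors; the
    choice is unambiguous because \<open>axis i 1\<close> determines \<open>i\<close>.\<close>
  define F where "F b = f (SOME i. b = axis i (1::real))" for b
  have [simp]: "F (axis i 1) = f i" for i
    unfolding F_def by (simp add: axis_eq_axis)
  have F: "integrable lborel (F b)" for b
    unfolding F_def by (rule assms)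
  note A = lborel_prod_integral[of F, OF F, unfolded prod_Basis_vec, simplified inner_axis, simplified]
  show "integrable lborel (\<lambda>x. \<Prod>i\<in>UNIV. f i (x $ i))" by (rule A(1))
  show "(LINT x|lborel. (\<Prod>i\<in>UNIV. f i (x $ i))) = (\<Prod>i\<in>UNIV. LINT x|lborel. f i x)" by (rule A(2))
qed

text \<open>The exponent is twice the dimension because each factor 1 + (x . b)^2 is at most (1 +
  |x|)^2, so the function lies below a product of one-variable Cauchy densities.\<close>

lemma integrable_inverse_1_plus_norm_power:
  "integrable lborel (\<lambda>x::'a::euclidean_space. 1 / (1 + norm x) ^ (2 * DIM('a)))"
proof (rule Bochner_Integration.integrable_bound)
  have "integrable lborel (\<lambda>x. inverse (1 + x\<^sup>2) :: real)"
    using integrable_inverse_1_plus_square by (simp add: einterval_eq set_integrable_def)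
  then show "integrable lborel (\<lambda>x::'a. \<Prod>b\<in>Basis. inverse (1 + (x \<bullet> b)\<^sup>2))"
    by (intro lborel_prod_integrable)
  have "1 / (1 + norm x) ^ (2 * DIM('a)) \<le> (\<Prod>b\<in>Basis. inverse (1 + (x \<bullet> b)\<^sup>2))" for x :: 'a
  proof -
    have "1 + (x \<bullet> b)\<^sup>2 \<le> (1 + norm x)\<^sup>2" if "b \<in> Basis" for b
    proof -
      have "\<bar>x \<bullet> b\<bar> \<le> norm x" using Basis_le_norm[OF that] .
      then have "(x \<bullet> b)\<^sup>2 \<le> (norm x)\<^sup>2" by (metis abs_le_square_iff abs_norm_cancel)
      then show ?thesis by (simp add: power2_sum add_increasing2)
    qed
    then have "(\<Prod>b\<in>(Basis::'a set). inverse ((1 + norm x)\<^sup>2)) \<le> (\<Prod>b\<in>Basis. inverse (1 + (x \<bullet> b)\<^sup>2))"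
      by (intro prod_mono) (auto intro!: le_imp_inverse_le simp: add_pos_nonneg)
    then show ?thesis by (simp add: power_mult divide_inverse power_inverse)
  qed
  then show "AE x in lborel. norm (1 / (1 + norm x) ^ (2 * DIM('a)))
      \<le> norm (\<Prod>b\<in>Basis. inverse (1 + ((x::'a) \<bullet> b)\<^sup>2))"
    by (intro AE_I2) (auto intro: order_trans[OF _ abs_ge_self])
qed auto

lemma
  fixes f :: "'a::euclidean_space \<Rightarrow> 'c::{banach,second_countable_topology}"
  assumes "f \<in> borel_measurable borel" "c \<noteq> 0"
  shows lborel_integrable_affine_iff: "integrable lborel (\<lambda>x. f (t + c *\<^sub>R x)) \<longleftrightarrow> integrable lborel f"
    and lborel_integral_affine: "(LINT x|lborel. f x) = \<bar>c\<bar> ^ DIM('a) *\<^sub>R (LINT x|lborel. f (t + c *\<^sub>R x))"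
proof -
  note [measurable] = assms(1)
  have L: "lborel = density (distr lborel borel (\<lambda>x. t + c *\<^sub>R x)) (\<lambda>_. \<bar>c\<bar>^DIM('a))"
    using lborel_affine[OF assms(2)] .
  have "integrable M (\<lambda>x. a *\<^sub>R g x) \<longleftrightarrow> integrable M g" if "a \<noteq> 0" for a M and g :: "'a \<Rightarrow> 'c"
    using that integrable_scaleR_right[of "inverse a" M "\<lambda>x. a *\<^sub>R g x"] by auto
  then show "integrable lborel (\<lambda>x. f (t + c *\<^sub>R x)) \<longleftrightarrow> integrable lborel f"
    using assms(2) by (subst (2) L) (simp add: integrable_density integrable_distr_eq)
  show "(LINT x|lborel. f x) = \<bar>c\<bar> ^ DIM('a) *\<^sub>R (LINT x|lborel. f (t + c *\<^sub>R x))"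
    by (subst L) (simp add: integral_density integral_distr)
qed

lemma
  fixes f :: "'a::euclidean_space \<Rightarrow> 'c::{banach,second_countable_topology}"
  assumes "f \<in> borel_measurable borel"
  shows lborel_integrable_translate_iff: "integrable lborel (\<lambda>x. f (t + x)) \<longleftrightarrow> integrable lborel f"
    and lborel_integral_translate: "(LINT x|lborel. f (t + x)) = (LINT x|lborel. f x)"
  using lborel_integrable_affine_iff[OF assms, of 1 t] lborel_integral_affine[OF assms, of 1 t] by simp_all

section \<open>Fourier transforms of Schwartz functions\<close>

lemma schwartz_differentiable: "schwartz f \<Longrightarrow> f differentiable (at x)"
  unfolding schwartz_def by (drule bspec[of _ _ "[]"]) auto

lemma schwartz_continuous: "schwartz f \<Longrightarrow> continuous_on A f"
  by (meson continuous_at_imp_continuous_on differentiable_imp_continuous_within schwartz_differentiable)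

lemma schwartz_measurable: "schwartz f \<Longrightarrow> f \<in> borel_measurable borel"
  using schwartz_continuous by (auto intro: borel_measurable_continuous_onI)

lemma schwartz_dpart_decay:
  assumes "schwartz f" "bs \<in> lists Basis"
  obtains C where "C > 0" "\<And>x. cmod (dpart bs f x) \<le> C / (1 + norm x) ^ N"
proof -
  have "bounded (range (\<lambda>x. (1 + norm x) ^ N *\<^sub>R dpart bs f x))"
    using assms by (auto simp: schwartz_def)
  then obtain C where C: "C > 0" "\<And>x. norm ((1 + norm x) ^ N *\<^sub>R dpart bs f x) \<le> C"
    unfolding bounded_pos by auto
  have "cmod (dpart bs f x) \<le> C / (1 + norm x) ^ N" for x
  proof -
    have "0 < (1 + norm x) ^ N" by (simp add: add_pos_nonneg)
    then show ?thesis using C(2)[of x] by (simp add: field_simps)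
  qed
  then show ?thesis using that C(1) by blast
qed

lemma schwartz_decay:
  assumes "schwartz f"
  obtains C where "C > 0" "\<And>x. cmod (f x) \<le> C / (1 + norm x) ^ N"
  using schwartz_dpart_decay[OF assms, of "[]" N] by auto

lemma schwartz_bounded:
  assumes "schwartz f"
  obtains C where "C > 0" "\<And>x. cmod (f x) \<le> C"
  using schwartz_decay[OF assms, of 0] by auto

lemma dpart_append: "dpart (bs @ cs) f = dpart bs (dpart cs f)"
  by (induction bs) auto

lemma schwartz_dpart:
  assumes "schwartz f" "bs \<in> lists Basis"
  shows "schwartz (dpart bs f)"
  using assms by (auto simp: schwartz_def simp flip: dpart_append)

lemma integrable_of_decay:
  fixes f :: "'a::euclidean_space \<Rightarrow> 'b::{banach,second_countable_topology}"
  assumes "f \<in> borel_measurable borel" "\<And>x. norm (f x) \<le> C / (1 + norm x) ^ (2 * DIM('a))"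
  shows "integrable lborel f"
proof (rule Bochner_Integration.integrable_bound)
  show "integrable lborel (\<lambda>x::'a. C * (1 / (1 + norm x) ^ (2 * DIM('a))))"
    by (intro integrable_mult_right integrable_inverse_1_plus_norm_power)
  show "AE x in lborel. norm (f x) \<le> norm (C * (1 / (1 + norm x) ^ (2 * DIM('a))))"
    using assms(2) by (intro AE_I2) (auto intro!: order_trans[OF assms(2)] divide_right_mono)
qed (use assms in auto)

lemma schwartz_integrable:
  assumes "schwartz f"
  shows "integrable lborel f"
proof -
  obtain C where "\<And>x. cmod (f x) \<le> C / (1 + norm x) ^ (2 * DIM('a))"
    using schwartz_decay[OF assms] by metis
  then show ?thesis using schwartz_measurable[OF assms] by (rule integrable_of_decay[rotated])
qed

lemma borel_measurable_cis [measurable]: "cis \<in> borel_measurable borel"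
  by (intro borel_measurable_continuous_onI continuous_intros)

lemma norm_fourier_le:
  assumes "integrable lborel f"
  shows "cmod (fourier f \<xi>) \<le> (LINT x|lborel. cmod (f x))"
proof -
  have "cmod (fourier f \<xi>) \<le> (LINT x|lborel. cmod (f x * cis (- (x \<bullet> \<xi>))))"
    unfolding fourier_def by (rule integral_norm_bound)
  then show ?thesis by (simp add: norm_mult)
qed

lemma integrable_times_cis:
  fixes f :: "'a::euclidean_space \<Rightarrow> complex"
  assumes "integrable lborel f" and [measurable]: "p \<in> borel_measurable borel"
  shows "integrable lborel (\<lambda>x. f x * cis (p x))"
proof (rule Bochner_Integration.integrable_bound[OF assms(1)])
  have [measurable]: "f \<in> borel_measurable borel" using assms(1) by auto
  show "(\<lambda>x. f x * cis (p x)) \<in> borel_measurable lborel" by measurable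
qed (auto simp: norm_mult)

lemma fourier_measurable [measurable]:
  assumes [measurable]: "f \<in> borel_measurable borel"
  shows "fourier f \<in> borel_measurable borel"
  unfolding fourier_def by measurable

lemma fourier_translate:
  assumes [measurable]: "f \<in> borel_measurable borel"
  shows "fourier (\<lambda>x. f (t + x)) \<xi> = cis (t \<bullet> \<xi>) * fourier f \<xi>"
proof -
  have "fourier f \<xi> = (LINT x|lborel. f (t + x) * cis (- ((t + x) \<bullet> \<xi>)))"
    unfolding fourier_def by (rule lborel_integral_translate[symmetric]) measurable
  also have "\<dots> = (LINT x|lborel. cis (- (t \<bullet> \<xi>)) * (f (t + x) * cis (- (x \<bullet> \<xi>))))"
    by (intro Bochner_Integration.integral_cong) (simp_all add: inner_add_left mult_ac cis_mult algebra_simps)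
  also have "\<dots> = cis (- (t \<bullet> \<xi>)) * fourier (\<lambda>x. f (t + x)) \<xi>"
    by (simp add: fourier_def)
  finally show ?thesis by (simp add: cis_mult flip: mult.assoc)
qed

section \<open>Derivatives of Schwartz functions and decay of their Fourier transforms\<close>

lemma schwartz_has_derivative_line:
  assumes "schwartz f"
  shows "((\<lambda>s. f (x + s *\<^sub>R b)) has_vector_derivative dpart [b] f (x + s *\<^sub>R b)) (at s within S)"
proof -
  have "(f has_derivative frechet_derivative f (at (x + s *\<^sub>R b))) (at (x + s *\<^sub>R b))"
    using schwartz_differentiable[OF assms] by (simp add: frechet_derivative_works)
  moreover have "((\<lambda>s. x + s *\<^sub>R b) has_derivative (\<lambda>h. h *\<^sub>R b)) (at s within S)"
    by (auto intro!: derivative_eq_intros)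
  ultimately have "((\<lambda>s. f (x + s *\<^sub>R b)) has_derivative
      (\<lambda>h. frechet_derivative f (at (x + s *\<^sub>R b)) (h *\<^sub>R b))) (at s within S)"
    by (rule has_derivative_compose[rotated])
  moreover have "linear (frechet_derivative f (at (x + s *\<^sub>R b)))"
    using schwartz_differentiable[OF assms] linear_frechet_derivative by blast
  ultimately show ?thesis
    by (simp add: has_vector_derivative_def linear_cmul)
qed

lemma has_vector_derivative_quotient:
  assumes "(f has_vector_derivative D) (at (0::real))"
  shows "((\<lambda>s. (f s - f 0) /\<^sub>R s) \<longlongrightarrow> D) (at 0)"
proof -
  have "((\<lambda>s. norm (f s - f 0 - s *\<^sub>R D) / norm s) \<longlongrightarrow> 0) (at 0)"
    using assms by (simp add: has_vector_derivative_def has_derivative_at)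
  moreover have "\<forall>\<^sub>F s in at 0. norm (f s - f 0 - s *\<^sub>R D) / norm s = norm ((f s - f 0) /\<^sub>R s - D)"
    unfolding eventually_at_filter
  proof (intro always_eventually allI impI)
    fix s :: real assume s: "s \<noteq> 0"
    then have "(f s - f 0) /\<^sub>R s - D = (f s - f 0 - s *\<^sub>R D) /\<^sub>R s"
      by (simp add: algebra_simps)
    then show "norm (f s - f 0 - s *\<^sub>R D) / norm s = norm ((f s - f 0) /\<^sub>R s - D)"
      by (simp add: divide_inverse mult.commute)
  qed
  ultimately have "((\<lambda>s. norm ((f s - f 0) /\<^sub>R s - D)) \<longlongrightarrow> 0) (at 0)"
    by (rule Lim_transform_eventually)
  then show ?thesis
    using Lim_null tendsto_norm_zero_iff by blast
qed

text \<open>The difference quotients of \<open>f\<close> converge dominatedly, which replaces an integration by parts.\<close>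

lemma fourier_dpart:
  assumes f: "schwartz f" and b: "b \<in> Basis"
  shows "fourier (dpart [b] f) \<xi> = \<i> * complex_of_real (b \<bullet> \<xi>) * fourier f \<xi>"
proof -
  let ?N = "2 * DIM('a)"
  have fm[measurable]: "f \<in> borel_measurable borel" using schwartz_measurable[OF f] .
  have fi: "integrable lborel f" using schwartz_integrable[OF f] .
  have g: "schwartz (dpart [b] f)" using schwartz_dpart[OF f, of "[b]"] b by simp
  have gm[measurable]: "dpart [b] f \<in> borel_measurable borel" using schwartz_measurable[OF g] .
  obtain C where C: "C > 0" "\<And>x. cmod (dpart [b] f x) \<le> C / (1 + norm x) ^ ?N"
    using schwartz_decay[OF g] by metis
  define h where "h n = 1 / real (Suc n)" for n
  have h: "h n > 0" "h n \<le> 1" for n by (auto simp: h_def)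
  have h0: "h \<longlonglongrightarrow> 0" unfolding h_def by (rule LIMSEQ_inverse_real_of_nat[unfolded inverse_eq_divide])
  define Q where "Q n x = (f (h n *\<^sub>R b + x) - f x) / h n" for n x
  have bound: "cmod (Q n x) \<le> C * 2 ^ ?N / (1 + norm x) ^ ?N" for n x
  proof -
    \<comment> \<open>Mean value inequality along the segment, on which 1 + |x| <= 2 * (1 + |x + s
      b|) because |s b| <= 1; this is the origin of the factor \<open>2 ^ ?N\<close>.\<close>
    have "norm (f (x + h n *\<^sub>R b) - f (x + 0 *\<^sub>R b)) \<le> C * 2 ^ ?N / (1 + norm x) ^ ?N * norm (h n - 0)"
    proof (rule differentiable_bound[where S = "{0..h n}" and f = "\<lambda>s. f (x + s *\<^sub>R b)"
          and f' = "\<lambda>s t. t *\<^sub>R dpart [b] f (x + s *\<^sub>R b)"])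
      show "((\<lambda>s. f (x + s *\<^sub>R b)) has_derivative (\<lambda>t. t *\<^sub>R dpart [b] f (x +
          s *\<^sub>R b))) (at s within {0..h n})" for s
        using schwartz_has_derivative_line[OF f] by (simp add: has_vector_derivative_def)
      show "onorm (\<lambda>t. t *\<^sub>R dpart [b] f (x + s *\<^sub>R b)) \<le> C * 2 ^ ?N / (1 + norm x) ^ ?N"
        if "s \<in> {0..h n}" for s
      proof -
        have "norm x \<le> norm (x + s *\<^sub>R b) + norm (s *\<^sub>R b)"
          by (metis add_diff_cancel_right' norm_triangle_ineq4)
        moreover have "norm (s *\<^sub>R b) \<le> 1" using that h(2)[of n] b by simp
        ultimately have "1 + norm x \<le> 2 * (1 + norm (x + s *\<^sub>R b))"
          using norm_ge_zero[of "x + s *\<^sub>R b"] unfolding distrib_left by linarith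
        then have le: "(1 + norm x) ^ ?N \<le> 2 ^ ?N * (1 + norm (x + s *\<^sub>R b)) ^ ?N"
          unfolding power_mult_distrib[symmetric] by (intro power_mono) auto
        have pos: "0 < (1 + norm x) ^ ?N" "0 < (1 + norm (x + s *\<^sub>R b)) ^ ?N" by (simp_all add: add_pos_nonneg)
        have "onorm (\<lambda>t. t *\<^sub>R dpart [b] f (x + s *\<^sub>R b)) \<le> cmod (dpart [b] f (x + s *\<^sub>R b))"
          by (rule onorm_le) (simp add: mult.commute)
        also have "\<dots> \<le> C / (1 + norm (x + s *\<^sub>R b)) ^ ?N" by (rule C)
        also have "\<dots> \<le> C * 2 ^ ?N / (1 + norm x) ^ ?N"
          using le pos C(1) by (simp add: field_simps del: power_mult)
        finally show ?thesis .
      qed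
    qed (use h[of n] in auto)
    then show ?thesis using h(1)[of n]
      by (simp add: Q_def norm_divide add.commute divide_le_eq)
  qed
  have lim: "(\<lambda>n. Q n x) \<longlonglongrightarrow> dpart [b] f x" for x
  proof -
    have "((\<lambda>s. f (x + s *\<^sub>R b)) has_vector_derivative dpart [b] f (x + 0 *\<^sub>R b)) (at 0)"
      by (rule schwartz_has_derivative_line[OF f])
    then have "((\<lambda>s. (f (x + s *\<^sub>R b) - f x) /\<^sub>R s) \<longlongrightarrow> dpart [b] f x) (at 0)"
      using has_vector_derivative_quotient by fastforce
    moreover have "filterlim h (at 0) sequentially"
      using h0 h(1) by (auto simp: filterlim_at less_imp_neq[symmetric])
    ultimately have "(\<lambda>n. (f (x + h n *\<^sub>R b) - f x) /\<^sub>R h n) \<longlonglongrightarrow> dpart [b] f x"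
      by (rule filterlim_compose)
    then show ?thesis by (simp add: Q_def add.commute scaleR_conv_of_real divide_inverse mult.commute)
  qed
  have Fq: "fourier (Q n) \<xi> = (cis (h n * (b \<bullet> \<xi>)) - 1) / h n * fourier f \<xi>" for n
  proof -
    have i1: "integrable lborel (\<lambda>x. f (h n *\<^sub>R b + x) * cis (- (x \<bullet> \<xi>)))"
      by (intro integrable_times_cis) (simp_all add: lborel_integrable_translate_iff fi)
    have i2: "integrable lborel (\<lambda>x. f x * cis (- (x \<bullet> \<xi>)))"
      by (intro integrable_times_cis fi) simp
    have "fourier (Q n) \<xi> = (LINT x|lborel. (f (h n *\<^sub>R b + x) * cis (- (x \<bullet> \<xi>)) - f x * cis (- (x \<bullet> \<xi>))) / h n)"
      unfolding fourier_def Q_def by (simp add: algebra_simps diff_divide_distrib)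
    also have "\<dots> = (fourier (\<lambda>x. f (h n *\<^sub>R b + x)) \<xi> - fourier f \<xi>) / h n"
      using i1 i2 by (simp add: fourier_def)
    also have "\<dots> = (cis (h n * (b \<bullet> \<xi>)) - 1) / h n * fourier f \<xi>"
      unfolding fourier_translate[OF fm] by (simp add: left_diff_distrib)
    finally show ?thesis .
  qed
  have "(\<lambda>n. fourier (Q n) \<xi>) \<longlonglongrightarrow> fourier (dpart [b] f) \<xi>"
    unfolding fourier_def
  proof (rule integral_dominated_convergence[where w = "\<lambda>x. C * 2 ^ ?N * (1 / (1 + norm x) ^ ?N)"])
    show "integrable lborel (\<lambda>x::'a. C * 2 ^ ?N * (1 / (1 + norm x) ^ ?N))"
      by (intro integrable_mult_right integrable_inverse_1_plus_norm_power)
    show "AE x in lborel. (\<lambda>n. Q n x * cis (- (x \<bullet> \<xi>))) \<longlonglongrightarrow> dpart [b] f x * cis (- (x \<bullet> \<xi>))"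
      by (intro AE_I2 tendsto_mult lim tendsto_const)
    show "AE x in lborel. cmod (Q n x * cis (- (x \<bullet> \<xi>))) \<le> C * 2 ^ ?N * (1 / (1 + norm x) ^ ?N)" for n
      using bound by (intro AE_I2) (simp add: norm_mult)
  qed (unfold Q_def, measurable)
  \<comment> \<open>The same sequence read through \<open>Fq\<close>: translation has become a phase
    factor, whose difference quotient at 0 tends to i (b . \<xi>).\<close>
  moreover have "(\<lambda>n. fourier (Q n) \<xi>) \<longlonglongrightarrow> \<i> * complex_of_real (b \<bullet> \<xi>) * fourier f \<xi>"
  proof -
    have "((\<lambda>s. cis (s * (b \<bullet> \<xi>))) has_vector_derivative \<i> * complex_of_real (b \<bullet> \<xi>)) (at 0)"
      by (auto intro!: derivative_eq_intros simp: has_vector_derivative_def scaleR_conv_of_real mult_ac)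
    then have "((\<lambda>s. (cis (s * (b \<bullet> \<xi>)) - 1) /\<^sub>R s) \<longlongrightarrow> \<i> * complex_of_real (b \<bullet> \<xi>)) (at 0)"
      using has_vector_derivative_quotient by fastforce
    moreover have "filterlim h (at 0) sequentially"
      using h0 h(1) by (auto simp: filterlim_at less_imp_neq[symmetric])
    ultimately have "(\<lambda>n. (cis (h n * (b \<bullet> \<xi>)) - 1) /\<^sub>R h n) \<longlonglongrightarrow> \<i> * complex_of_real (b \<bullet> \<xi>)"
      by (rule filterlim_compose)
    then show ?thesis unfolding Fq
      by (intro tendsto_mult tendsto_const) (simp add: scaleR_conv_of_real divide_inverse mult.commute)
  qed
  ultimately show ?thesis by (rule LIMSEQ_unique)
qed

text \<open>Iterating \<open>fourier_dpart\<close> in one direction produces the power of the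
  coordinate, and a Fourier transform is bounded by the L1 norm.\<close>

lemma norm_power_fourier_le:
  assumes f: "schwartz (f :: 'a::euclidean_space \<Rightarrow> complex)" and b: "b \<in> Basis"
  shows "\<bar>b \<bullet> \<xi>\<bar> ^ N * cmod (fourier f \<xi>) \<le> (LINT x|lborel. cmod (dpart (replicate N b) f x))"
proof -
  have "fourier (dpart (replicate N b) f) \<xi> = (\<i> * complex_of_real (b \<bullet> \<xi>)) ^ N * fourier f \<xi>"
  proof (induction N)
    case (Suc N)
    have "schwartz (dpart (replicate N b) f)"
      using schwartz_dpart[OF f] b by (auto simp: in_lists_conv_set)
    from fourier_dpart[OF this b, of \<xi>] Suc show ?case by (simp add: mult_ac)
  qed simp
  moreover have "schwartz (dpart (replicate N b) f)"
    using schwartz_dpart[OF f] b by (auto simp: in_lists_conv_set)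
  then have "cmod (fourier (dpart (replicate N b) f) \<xi>) \<le> (LINT x|lborel. cmod (dpart (replicate N b) f x))"
    by (intro norm_fourier_le schwartz_integrable)
  ultimately show ?thesis by (simp add: norm_mult norm_power)
qed

text \<open>Compares |x| with its largest coordinate. Powers of single coordinates thus control the
  norm, and no mixed derivatives enter the decay estimate.\<close>

lemma one_plus_norm_power_le:
  "(1 + norm (x::'a::euclidean_space)) ^ N \<le> (1 + real DIM('a)) ^ N * (1 + (\<Sum>b\<in>Basis. \<bar>b \<bullet> x\<bar> ^ N))"
proof -
  define m where "m = Max ((\<lambda>b. \<bar>b \<bullet> x\<bar>) ` Basis)"
  have le: "\<bar>b \<bullet> x\<bar> \<le> m" if "b \<in> Basis" for b
    unfolding m_def using that by (intro Max_ge) auto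
  obtain c where c: "c \<in> Basis" "m = \<bar>c \<bullet> x\<bar>"
    unfolding m_def using Max_in[of "(\<lambda>b. \<bar>b \<bullet> x\<bar>) ` Basis"] by fastforce
  have "norm x \<le> (\<Sum>b\<in>Basis. \<bar>x \<bullet> b\<bar>)" by (rule norm_le_l1)
  also have "\<dots> \<le> (\<Sum>b\<in>(Basis::'a set). m)"
    by (rule sum_mono) (use le in \<open>simp add: inner_commute\<close>)
  finally have "norm x \<le> real DIM('a) * m" by simp
  also have "\<dots> \<le> real DIM('a) * max 1 m" by (intro mult_left_mono) auto
  finally have "1 + norm x \<le> (1 + real DIM('a)) * max 1 m" by (simp add: algebra_simps)
  then have "(1 + norm x) ^ N \<le> ((1 + real DIM('a)) * max 1 m) ^ N"
    by (intro power_mono) auto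
  also have "\<dots> = (1 + real DIM('a)) ^ N * max 1 m ^ N"
    by (simp add: power_mult_distrib)
  also have "max 1 m ^ N \<le> 1 + m ^ N"
    using c by (auto simp: max_def)
  also have "m ^ N \<le> (\<Sum>b\<in>Basis. \<bar>b \<bullet> x\<bar> ^ N)"
    unfolding c(2) using c(1) by (intro member_le_sum) auto
  finally show ?thesis by (simp add: mult_left_mono)
qed

text \<open>Decay of order twice the dimension suffices; inversion uses the transform only as an
  integrable function, so it need not be shown to be Schwartz.\<close>

lemma schwartz_fourier_integrable:
  assumes f: "schwartz (f :: 'a::euclidean_space \<Rightarrow> complex)"
  shows "integrable lborel (fourier f)"
proof (rule integrable_of_decay)
  let ?N = "2 * DIM('a)"
  let ?I = "\<lambda>b. LINT x|lborel. cmod (dpart (replicate ?N b) f x)"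
  let ?J = "LINT x|lborel. cmod (f x)"
  show "fourier f \<in> borel_measurable borel"
    using schwartz_measurable[OF f] by (rule fourier_measurable)
  show "cmod (fourier f \<xi>) \<le> (1 + real DIM('a)) ^ ?N * (?J + (\<Sum>b\<in>Basis. ?I b)) / (1 + norm \<xi>) ^ ?N" for \<xi>
  proof -
    have "(1 + norm \<xi>) ^ ?N * cmod (fourier f \<xi>) \<le>
      (1 + real DIM('a)) ^ ?N * (1 + (\<Sum>b\<in>Basis. \<bar>b \<bullet> \<xi>\<bar> ^ ?N)) * cmod (fourier f \<xi>)"
      by (intro mult_right_mono one_plus_norm_power_le) auto
    also have "\<dots> = (1 + real DIM('a)) ^ ?N * (cmod (fourier f \<xi>) + (\<Sum>b\<in>Basis. \<bar>b \<bullet> \<xi>\<bar> ^ ?N * cmod (fourier f \<xi>)))"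
      by (simp add: sum_distrib_right distrib_right mult.assoc del: power_mult)
    also have "\<dots> \<le> (1 + real DIM('a)) ^ ?N * (?J + (\<Sum>b\<in>Basis. ?I b))"
      by (intro mult_left_mono add_mono sum_mono norm_fourier_le schwartz_integrable norm_power_fourier_le f) auto
    finally show ?thesis
      by (simp add: pos_le_divide_eq add_pos_nonneg mult.commute)
  qed
qed

section \<open>Gaussian integrals and Fourier inversion\<close>

lemma integrable_gauss_real: "integrable lborel (\<lambda>x::real. exp (- x\<^sup>2 / 2))"
proof -
  have "integrable lborel (\<lambda>x. sqrt (2 * pi) * std_normal_density x)"
    by (intro integrable_mult_right integrable_normal_density) simp
  then show ?thesis by (simp add: std_normal_density_def)
qed

text \<open>This is the characteristic function of the standard normal distribution, freed of the
  density factor 1 / sqrt (2 * pi).\<close>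

lemma fourier_gauss_real:
  "(LINT x|lborel. complex_of_real (exp (- x\<^sup>2 / 2)) * cis (x * y)) =
      complex_of_real (sqrt (2 * pi) * exp (- y\<^sup>2 / 2))"
proof -
  have "(LINT x|lborel. std_normal_density x *\<^sub>R cis (y * x)) = complex_of_real (exp (- y\<^sup>2 / 2))"
    using fun_cong[OF char_std_normal_distribution, of y]
    by (simp add: char_def integral_density cis_conv_exp)
  also have "(LINT x|lborel. std_normal_density x *\<^sub>R cis (y * x)) =
      (LINT x|lborel. complex_of_real (exp (- x\<^sup>2 / 2)) * cis (x * y)) / complex_of_real (sqrt (2 * pi))"
    by (simp add: std_normal_density_def scaleR_conv_of_real mult_ac flip: Bochner_Integration.integral_divide)
  finally show ?thesis by (simp add: field_simps)
qed

lemma gauss_prod: "exp (- (norm (x::'a::euclidean_space))\<^sup>2 / 2) = (\<Prod>b\<in>Basis. exp (- (x \<bullet> b)\<^sup>2 / 2))"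
proof -
  have "(norm x)\<^sup>2 = (\<Sum>b\<in>Basis. (x \<bullet> b)\<^sup>2)"
    unfolding power2_norm_eq_inner by (subst euclidean_inner) (simp add: power2_eq_square)
  then show ?thesis by (simp add: sum_negf sum_divide_distrib flip: exp_sum)
qed

lemma integrable_gauss: "integrable lborel (\<lambda>x::'a::euclidean_space. exp (- (norm x)\<^sup>2 / 2))"
  unfolding gauss_prod by (intro lborel_prod_integrable integrable_gauss_real)

lemma cis_sum: "cis (\<Sum>i\<in>A. f i) = (\<Prod>i\<in>A. cis (f i))"
  by (induction A rule: infinite_finite_induct) (auto simp flip: cis_mult)

lemma fourier_gauss:
  "(LINT x|lborel. complex_of_real (exp (- (norm (x::'a::euclidean_space))\<^sup>2 / 2)) * cis (x \<bullet> y)) =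
     complex_of_real (sqrt (2 * pi) ^ DIM('a) * exp (- (norm y)\<^sup>2 / 2))"
proof -
  have "(LINT x|lborel. complex_of_real (exp (- (norm (x::'a::euclidean_space))\<^sup>2 / 2)) * cis (x \<bullet> y)) =
    (LINT x::'a|lborel. (\<Prod>b\<in>Basis. complex_of_real (exp (- (x \<bullet> b)\<^sup>2 / 2)) * cis ((x \<bullet> b) * (y \<bullet> b))))"
    unfolding gauss_prod by (subst euclidean_inner) (simp add: cis_sum prod.distrib)
  also have "\<dots> = (\<Prod>b\<in>(Basis::'a set). LINT x|lborel. complex_of_real (exp (- x\<^sup>2 / 2)) * cis (x * (y \<bullet> b)))"
    by (rule lborel_prod_integral(2)[where f = "\<lambda>b x. complex_of_real (exp (- x\<^sup>2 / 2)) * cis (x * (y \<bullet> b))"])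
      (intro integrable_times_cis integrable_of_real integrable_gauss_real, measurable)
  also have "\<dots> = complex_of_real (sqrt (2 * pi) ^ DIM('a) * exp (- (norm y)\<^sup>2 / 2))"
    unfolding gauss_prod fourier_gauss_real by (simp add: prod.distrib)
  finally show ?thesis .
qed

text \<open>Fubini, with absolute integrability immediate because the kernel has modulus 1. The
  phase \<open>p\<close> is left general to cover both signs of the Fourier kernel.\<close>

lemma integral_swap_cis:
  fixes f :: "'a::euclidean_space \<Rightarrow> complex" and g :: "'b::euclidean_space \<Rightarrow> complex"
  assumes f: "integrable lborel f" and g: "integrable lborel g"
    and p: "case_prod p \<in> borel_measurable (borel \<Otimes>\<^sub>M borel)"
  shows "(LINT x|lborel. g x * (LINT y|lborel. f y * cis (p x y))) =
      (LINT y|lborel. f y * (LINT x|lborel. g x * cis (p x y)))"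
proof -
  have [measurable]: "f \<in> borel_measurable borel" "g \<in> borel_measurable borel"
    using f g by auto
  note p[measurable]
  have px: "p x \<in> borel_measurable borel" for x
    using measurable_Pair2[OF p, of x] by simp
  have "integrable (lborel \<Otimes>\<^sub>M lborel) (\<lambda>(x, y). g x * (f y * cis (p x y)))"
  proof (rule lborel_pair.Fubini_integrable)
    show "(\<lambda>(x, y). g x * (f y * cis (p x y))) \<in> borel_measurable (lborel \<Otimes>\<^sub>M lborel)"
      by (subst measurable_cong_sets[OF sets_pair_measure_cong[OF sets_lborel sets_lborel] refl]) measurable
    show "integrable lborel (\<lambda>x. LINT y|lborel. norm (case (x, y) of (x, y) \<Rightarrow> g x * (f y * cis (p x y))))"
      using g by (simp add: norm_mult)
    show "AE x in lborel. integrable lborel (\<lambda>y. case (x, y) of (x, y) \<Rightarrow> g x * (f y * cis (p x y)))"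
      by (intro AE_I2) (simp add: integrable_times_cis[OF f px])
  qed
  from lborel_pair.Fubini_integral[OF this]
  have "(LINT x|lborel. (LINT y|lborel. g x * (f y * cis (p x y)))) =
      (LINT y|lborel. (LINT x|lborel. f y * (g x * cis (p x y))))"
    by (simp add: mult.left_commute)
  then show ?thesis by simp
qed

lemma fourier_gauss_scaled:
  fixes y :: "'a::euclidean_space"
  assumes h: "h > 0"
  shows "(LINT x|lborel. complex_of_real (exp (- (norm (h *\<^sub>R x))\<^sup>2 / 2)) * cis (x \<bullet> y)) =
     complex_of_real (sqrt (2 * pi) ^ DIM('a) * exp (- (norm (y /\<^sub>R h))\<^sup>2 / 2) / h ^ DIM('a))"
proof -
  let ?F = "\<lambda>x::'a. complex_of_real (exp (- (norm x)\<^sup>2 / 2)) * cis (x \<bullet> (y /\<^sub>R h))"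
  have "(h *\<^sub>R x) \<bullet> (y /\<^sub>R h) = x \<bullet> y" for x :: 'a
    using h by simp
  then have F: "?F (h *\<^sub>R x) = complex_of_real (exp (- (norm (h *\<^sub>R x))\<^sup>2 / 2)) * cis (x \<bullet> y)" for x
    by metis
  have "(LINT x|lborel. ?F x) = \<bar>h\<bar> ^ DIM('a) *\<^sub>R (LINT x|lborel. ?F (0 + h *\<^sub>R x))"
    by (rule lborel_integral_affine) (use h in auto)
  then show ?thesis
    unfolding add_0_left F fourier_gauss using h by (simp add: scaleR_conv_of_real field_simps)
qed

text \<open>Gaussian regularisation of the inversion integral.\<close>

theorem fourier_inversion:
  fixes f :: "'a::euclidean_space \<Rightarrow> complex"
  assumes f: "schwartz f"
  shows "inv_fourier (fourier f) \<xi> = f \<xi>"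
proof -
  have fm[measurable]: "f \<in> borel_measurable borel" using schwartz_measurable[OF f] .
  have fi: "integrable lborel f" using schwartz_integrable[OF f] .
  have Fi: "integrable lborel (fourier f)" using schwartz_fourier_integrable[OF f] .
  obtain C where C: "C > 0" "\<And>x. cmod (f x) \<le> C" using schwartz_bounded[OF f] by metis
  define h where "h n = 1 / real (Suc n)" for n
  have h: "h n > 0" for n by (auto simp: h_def)
  have h0: "h \<longlonglongrightarrow> 0" unfolding h_def by (rule LIMSEQ_inverse_real_of_nat[unfolded inverse_eq_divide])
  define G where "G n x = complex_of_real (exp (- (norm (h n *\<^sub>R x))\<^sup>2 / 2))" for n and x :: 'a
  define A where "A n = (LINT x|lborel. fourier f x * cis (x \<bullet> \<xi>) * G n x)" for n
  have [measurable]: "G n \<in> borel_measurable borel" for n unfolding G_def by measurable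
  have Gi: "integrable lborel (G n)" for n
  proof -
    have "integrable lborel (\<lambda>x::'a. exp (- (norm (0 + h n *\<^sub>R x))\<^sup>2 / 2))"
      using h[of n] by (subst lborel_integrable_affine_iff) (use integrable_gauss[where 'a = 'a] in auto)
    then show ?thesis unfolding G_def by (intro integrable_of_real) simp
  qed
  \<comment> \<open>First evaluation of the limit: the Gaussian factor tends to 1, and the modulus
    of \<open>fourier f\<close> dominates.\<close>
  have "A \<longlonglongrightarrow> (LINT x|lborel. fourier f x * cis (x \<bullet> \<xi>))"
    unfolding A_def
  proof (rule integral_dominated_convergence[where w = "\<lambda>x. cmod (fourier f x)"])
    show "AE x in lborel. (\<lambda>n. fourier f x * cis (x \<bullet> \<xi>) * G n x) \<longlonglongrightarrow> fourier f x * cis (x \<bullet> \<xi>)"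
    proof (intro AE_I2)
      fix x
      have "(\<lambda>n. G n x) \<longlonglongrightarrow> complex_of_real (exp (- (norm (0 *\<^sub>R x))\<^sup>2 / 2))"
        unfolding G_def by (intro tendsto_intros h0) auto
      then show "(\<lambda>n. fourier f x * cis (x \<bullet> \<xi>) * G n x) \<longlonglongrightarrow> fourier f x * cis (x \<bullet> \<xi>)"
        using tendsto_mult[OF tendsto_const] by force
    qed
    show "AE x in lborel. cmod (fourier f x * cis (x \<bullet> \<xi>) * G n x) \<le> cmod (fourier f x)" for n
      by (intro AE_I2) (auto simp: norm_mult G_def intro!: mult_left_le)
  qed (use Fi in auto)
  moreover have "A \<longlonglongrightarrow> complex_of_real ((2 * pi) ^ DIM('a)) * f \<xi>"
  proof -
    have "A n = complex_of_real (sqrt (2 * pi) ^ DIM('a)) * (LINT z|lborel. f (\<xi> + h n *\<^sub>R z) *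
        complex_of_real (exp (- (norm z)\<^sup>2 / 2)))" for n
    proof -
      have Gc: "integrable lborel (\<lambda>x. G n x * cis (x \<bullet> \<xi>))"
        by (intro integrable_times_cis Gi) measurable
      have "A n = (LINT x|lborel. (G n x * cis (x \<bullet> \<xi>)) * (LINT \<eta>|lborel. f \<eta> * cis (- (\<eta> \<bullet> x))))"
        unfolding A_def fourier_def by (simp add: mult_ac)
      also have "\<dots> = (LINT \<eta>|lborel. f \<eta> * (LINT x|lborel. (G n x * cis (x \<bullet> \<xi>)) * cis (- (\<eta> \<bullet> x))))"
        by (rule integral_swap_cis[OF fi Gc]) measurable
      also have "\<dots> = (LINT \<eta>|lborel. f \<eta> * (LINT x|lborel. G n x * cis (x \<bullet> (\<xi> - \<eta>))))"
        by (simp add: mult.assoc cis_mult inner_diff_right inner_commute)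
      also have "\<dots> = (LINT \<eta>|lborel. f \<eta> * complex_of_real (sqrt (2 * pi) ^ DIM('a) *
          exp (- (norm ((\<xi> - \<eta>) /\<^sub>R h n))\<^sup>2 / 2) / h n ^ DIM('a)))"
        unfolding G_def fourier_gauss_scaled[OF h] ..
      \<comment> \<open>Substitution \<eta> = \<xi> + h z: the Jacobian cancels the power of h in
        the transform of the scaled Gaussian and leaves a fixed Gaussian weight.\<close>
      also have "\<dots> = \<bar>h n\<bar> ^ DIM('a) *\<^sub>R (LINT z|lborel. f (\<xi> + h n *\<^sub>R z) * complex_of_real (sqrt (2 *
          pi) ^ DIM('a) * exp (- (norm ((\<xi> - (\<xi> + h n *\<^sub>R z)) /\<^sub>R h n))\<^sup>2 / 2) / h n ^ DIM('a)))"
        by (rule lborel_integral_affine) (use h[of n] in auto)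
      also have "\<dots> = (LINT z|lborel. complex_of_real (sqrt (2 * pi) ^ DIM('a)) * (f (\<xi> + h n *\<^sub>R z) *
          complex_of_real (exp (- (norm z)\<^sup>2 / 2))))"
        unfolding integral_scaleR_right[symmetric]
        using h[of n] by (intro Bochner_Integration.integral_cong) (simp_all add: scaleR_conv_of_real)
      finally show ?thesis by simp
    qed
    then have "A = (\<lambda>n. complex_of_real (sqrt (2 * pi) ^ DIM('a)) * (LINT z|lborel. f (\<xi> + h n *\<^sub>R z) *
        complex_of_real (exp (- (norm z)\<^sup>2 / 2))))"
      by (rule ext)
    moreover have "(\<lambda>n. LINT z|lborel. f (\<xi> + h n *\<^sub>R z) * complex_of_real (exp (- (norm z)\<^sup>2 / 2))) \<longlonglongrightarrow>
        (LINT z|lborel. f \<xi> * complex_of_real (exp (- (norm (z::'a))\<^sup>2 / 2)))"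
    proof (rule integral_dominated_convergence[where w = "\<lambda>z. C * exp (- (norm z)\<^sup>2 / 2)"])
      show "integrable lborel (\<lambda>z::'a. C * exp (- (norm z)\<^sup>2 / 2))"
        by (intro integrable_mult_right integrable_gauss)
      show "AE z in lborel. (\<lambda>n. f (\<xi> + h n *\<^sub>R z) * complex_of_real (exp (- (norm z)\<^sup>2 / 2))) \<longlonglongrightarrow>
          f \<xi> * complex_of_real (exp (- (norm z)\<^sup>2 / 2))"
      proof (intro AE_I2 tendsto_mult tendsto_const)
        fix z
        have "(\<lambda>n. \<xi> + h n *\<^sub>R z) \<longlonglongrightarrow> \<xi> + 0 *\<^sub>R z" by (intro tendsto_intros h0)
        moreover have "isCont f \<xi>"
          using schwartz_differentiable[OF f] differentiable_imp_continuous_within by blast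
        ultimately show "(\<lambda>n. f (\<xi> + h n *\<^sub>R z)) \<longlonglongrightarrow> f \<xi>"
          using isCont_tendsto_compose by fastforce
      qed
      show "AE z in lborel. cmod (f (\<xi> + h n *\<^sub>R z) * complex_of_real (exp (- (norm z)\<^sup>2 / 2))) \<le>
          C * exp (- (norm z)\<^sup>2 / 2)" for n
        using C by (intro AE_I2) (simp add: norm_mult)
    qed measurable
    moreover have "(LINT z|lborel. f \<xi> * complex_of_real (exp (- (norm (z::'a))\<^sup>2 / 2))) =
        complex_of_real (sqrt (2 * pi) ^ DIM('a)) * f \<xi>"
      using fourier_gauss[of "0::'a"] by simp
    \<comment> \<open>One factor \<open>sqrt (2 * pi) ^ DIM('a)\<close> comes from transforming the
      Gaussian, the other from its total mass; together they give the constant of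
      \<open>inv_fourier\<close>.\<close>
    ultimately have "A \<longlonglongrightarrow> complex_of_real (sqrt (2 * pi) ^ DIM('a)) * (complex_of_real (sqrt (2 *
        pi) ^ DIM('a)) * f \<xi>)"
      by (simp only: tendsto_mult_left)
    also have "complex_of_real (sqrt (2 * pi) ^ DIM('a)) * (complex_of_real (sqrt (2 * pi) ^ DIM('a)) * f \<xi>) =
        complex_of_real ((sqrt (2 * pi) * sqrt (2 * pi)) ^ DIM('a)) * f \<xi>"
      unfolding power_mult_distrib by simp
    finally show ?thesis by simp
  qed
  ultimately have "(LINT x|lborel. fourier f x * cis (x \<bullet> \<xi>)) = complex_of_real ((2 * pi) ^ DIM('a)) * f \<xi>"
    by (rule LIMSEQ_unique)
  then show ?thesis unfolding inv_fourier_def by (simp add: inner_commute)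
qed

section \<open>Distributions given by inverse Fourier integrals\<close>

lemma inv_fourier_measurable [measurable]:
  assumes [measurable]: "g \<in> borel_measurable borel"
  shows "inv_fourier g \<in> borel_measurable borel"
  unfolding inv_fourier_def by measurable

lemma norm_inv_fourier_le:
  "cmod (inv_fourier (g :: 'a::euclidean_space \<Rightarrow> complex) x) \<le>
      1 / (2 * pi) ^ DIM('a) * (LINT \<xi>|lborel. cmod (g \<xi>))"
proof -
  have "cmod (LINT \<xi>|lborel. g \<xi> * cis (x \<bullet> \<xi>)) \<le> (LINT \<xi>|lborel. cmod (g \<xi> * cis (x \<bullet> \<xi>)))"
    by (rule integral_norm_bound)
  then show ?thesis
    by (simp add: inv_fourier_def norm_mult norm_divide norm_power divide_right_mono)
qed

lemma integrable_bounded_mult: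
  fixes f w :: "'a::euclidean_space \<Rightarrow> complex"
  assumes "w \<in> borel_measurable borel" "\<And>x. cmod (w x) \<le> C" "integrable lborel f"
  shows "integrable lborel (\<lambda>x. w x * f x)"
proof (rule Bochner_Integration.integrable_bound)
  show "integrable lborel (\<lambda>x. C * cmod (f x))" using assms by auto
  have "C \<ge> 0" using assms(2)[of 0] norm_ge_zero order_trans by blast
  then show "AE x in lborel. norm (w x * f x) \<le> norm (C * cmod (f x))"
    using assms(2) by (intro AE_I2) (simp add: norm_mult mult_right_mono)
  have [measurable]: "f \<in> borel_measurable borel" "w \<in> borel_measurable borel" using assms by auto
  show "(\<lambda>x. w x * f x) \<in> borel_measurable lborel" by measurable
qed

text \<open>Exchanging the integrals in the pairing with \<open>fourier \<theta>\<close> leaves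
  \<open>inv_fourier (fourier \<theta>)\<close> as inner integral, which is \<theta> by inversion.
  Mere integrability of \<open>g\<close> suffices, so the discontinuous wavelet transforms are
  covered.\<close>

theorem has_fourier_inv_fourier:
  assumes g: "integrable lborel (g :: 'a::euclidean_space \<Rightarrow> complex)"
  shows "has_fourier (distr_of_fun (inv_fourier g)) g"
  unfolding has_fourier_def
proof (intro conjI allI impI)
  show "g \<in> borel_measurable lborel" using g by auto
  fix \<theta> :: "'a \<Rightarrow> complex" assume \<theta>: "schwartz \<theta>"
  obtain C where C: "\<And>x. cmod (\<theta> x) \<le> C" using schwartz_bounded[OF \<theta>] by metis
  show "integrable lborel (\<lambda>\<xi>. g \<xi> * \<theta> \<xi>)"
    using integrable_bounded_mult[OF schwartz_measurable[OF \<theta>] C g] by (simp add: mult.commute)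
  have "distr_of_fun (inv_fourier g) (fourier \<theta>) =
      complex_of_real (1 / (2 * pi) ^ DIM('a)) * (LINT x|lborel. fourier \<theta> x * (LINT \<xi>|lborel. g \<xi> * cis (x \<bullet> \<xi>)))"
    unfolding distr_of_fun_def inv_fourier_def
    by (subst integral_mult_right_zero[symmetric]) (simp add: mult_ac)
  also have "(LINT x|lborel. fourier \<theta> x * (LINT \<xi>|lborel. g \<xi> * cis (x \<bullet> \<xi>))) =
      (LINT \<xi>|lborel. g \<xi> * (LINT x|lborel. fourier \<theta> x * cis (x \<bullet> \<xi>)))"
    by (rule integral_swap_cis[OF g schwartz_fourier_integrable[OF \<theta>]]) measurable
  also have "complex_of_real (1 / (2 * pi) ^ DIM('a)) * \<dots> = (LINT \<xi>|lborel. g \<xi> * inv_fourier (fourier \<theta>) \<xi>)"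
    unfolding inv_fourier_def
    by (subst integral_mult_right_zero[symmetric]) (simp add: mult_ac inner_commute)
  finally show "distr_of_fun (inv_fourier g) (fourier \<theta>) = (LINT \<xi>|lborel. g \<xi> * \<theta> \<xi>)"
    by (simp add: fourier_inversion[OF \<theta>])
qed

text \<open>A real supremum is informative only for a set bounded above. Only finitely many lists of
  basis vectors have length at most N, so the sum of their individual bounds serves.\<close>

lemma schwartz_seminorm_upper:
  assumes f: "schwartz (f :: 'a::euclidean_space \<Rightarrow> complex)" and bs: "bs \<in> lists Basis" "length bs \<le> N"
  shows "(1 + norm x) ^ N * cmod (dpart bs f x) \<le> schwartz_seminorm N f"
proof -
  let ?A = "{bs \<in> lists (Basis::'a set). length bs \<le> N}"
  have fin: "finite ?A"
    using finite_lists_length_le[of "Basis::'a set" N] by (simp add: lists_eq_set)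
  have "\<exists>C\<ge>0. \<forall>x. (1 + norm x) ^ N * cmod (dpart bs f x) \<le> C" if "bs \<in> ?A" for bs
  proof -
    from that have "bs \<in> lists Basis" by simp
    then obtain C where C: "C > 0" "\<And>x. cmod (dpart bs f x) \<le> C / (1 + norm x) ^ N"
      using schwartz_dpart_decay[OF f] by metis
    then show ?thesis
      by (intro exI[of _ C]) (auto simp: pos_le_divide_eq add_pos_nonneg mult.commute less_imp_le)
  qed
  then obtain C where C: "\<And>bs. bs \<in> ?A \<Longrightarrow> C bs \<ge> 0 \<and> (\<forall>x. (1 + norm x) ^ N * cmod (dpart bs f x) \<le> C bs)"
    by metis
  have "bdd_above ((\<lambda>(bs, x). (1 + norm x) ^ N * cmod (dpart bs f x)) ` (?A \<times> UNIV))"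
  proof (rule bdd_aboveI2[where M = "\<Sum>bs\<in>?A. C bs"])
    fix q :: "'a list \<times> 'a" assume "q \<in> ?A \<times> UNIV"
    then obtain cs x where q: "q = (cs, x)" and cs: "cs \<in> lists Basis" "length cs \<le> N" by auto
    then have "(1 + norm x) ^ N * cmod (dpart cs f x) \<le> C cs" using C by auto
    also have "\<dots> \<le> (\<Sum>bs\<in>?A. C bs)" by (rule member_le_sum) (use cs C fin in auto)
    finally show "(case q of (bs, x) \<Rightarrow> (1 + norm x) ^ N * cmod (dpart bs f x)) \<le> (\<Sum>bs\<in>?A. C bs)"
      by (simp add: q)
  qed
  from cSUP_upper[OF _ this, of "(bs, x)"] show ?thesis
    using bs by (simp add: schwartz_seminorm_def)
qed

lemma tempered_distr_of_fun:
  fixes w :: "'a::euclidean_space \<Rightarrow> complex"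
  assumes w: "w \<in> borel_measurable borel" "\<And>x. cmod (w x) \<le> C"
  shows "tempered (distr_of_fun w)"
  unfolding tempered_def
proof (intro conjI allI impI exI)
  fix f g :: "'a \<Rightarrow> complex" and a assume fg: "schwartz f" "schwartz g"
  note i = integrable_bounded_mult[OF w schwartz_integrable]
  have "distr_of_fun w (\<lambda>x. a * f x + g x) = (LINT x|lborel. a * (w x * f x) + w x * g x)"
    unfolding distr_of_fun_def by (simp add: algebra_simps)
  also have "\<dots> = a * distr_of_fun w f + distr_of_fun w g"
    unfolding distr_of_fun_def using i[OF fg(1)] i[OF fg(2)] by simp
  finally show "distr_of_fun w (\<lambda>x. a * f x + g x) = a * distr_of_fun w f + distr_of_fun w g" .
next
  \<comment> \<open>Seminorm order chosen so that the inverse weight is integrable.\<close>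
  let ?N = "2 * DIM('a)"
  let ?I = "LINT x::'a|lborel. 1 / (1 + norm x) ^ ?N"
  fix f :: "'a \<Rightarrow> complex" assume f: "schwartz f"
  have C: "C \<ge> 0" using w(2)[of 0] norm_ge_zero order_trans by blast
  have "cmod (distr_of_fun w f) \<le> (LINT x|lborel. cmod (w x * f x))"
    unfolding distr_of_fun_def by (rule integral_norm_bound)
  also have "\<dots> \<le> (LINT x::'a|lborel. C * schwartz_seminorm ?N f * (1 / (1 + norm x) ^ ?N))"
  proof (rule integral_mono)
    show "integrable lborel (\<lambda>x. cmod (w x * f x))"
      using integrable_bounded_mult[OF w schwartz_integrable[OF f]] by (rule integrable_norm)
    show "integrable lborel (\<lambda>x::'a. C * schwartz_seminorm ?N f * (1 / (1 + norm x) ^ ?N))"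
      by (intro integrable_mult_right integrable_inverse_1_plus_norm_power)
    show "cmod (w x * f x) \<le> C * schwartz_seminorm ?N f * (1 / (1 + norm x) ^ ?N)" for x
    proof -
      have "cmod (f x) \<le> schwartz_seminorm ?N f * (1 / (1 + norm x) ^ ?N)"
        using schwartz_seminorm_upper[OF f, of "[]" ?N x]
        by (simp add: pos_le_divide_eq add_pos_nonneg mult.commute)
      then have "cmod (w x) * cmod (f x) \<le> C * (schwartz_seminorm ?N f * (1 / (1 + norm x) ^ ?N))"
        using w(2)[of x] C by (intro mult_mono) auto
      then show ?thesis by (simp add: norm_mult mult.assoc)
    qed
  qed
  also have "\<dots> = C * ?I * schwartz_seminorm ?N f"
    by (simp only: integral_mult_right_zero mult_ac)
  finally show "cmod (distr_of_fun w f) \<le> C * ?I * schwartz_seminorm ?N f" .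
qed

section \<open>Trigonometric polynomials and uniqueness of the Fourier transform\<close>

text \<open>Characters of period 2 * pi / s in every coordinate. The value s = 2^(-j) gives the
  factors by which wavelets of level j differ, while s tending to 0 is used for uniqueness.\<close>

definition chr :: "real \<Rightarrow> int^'d::finite \<Rightarrow> real^'d \<Rightarrow> complex" where
  "chr s k \<xi> = cis (s * (\<Sum>i\<in>UNIV. of_int (k $ i) * \<xi> $ i))"

lemma chr_add: "chr s (k + l) \<xi> = chr s k \<xi> * chr s l \<xi>"
  by (simp add: chr_def cis_mult distrib_left distrib_right sum.distrib)

lemma chr_0 [simp]: "chr s 0 \<xi> = 1"
  by (simp add: chr_def)

lemma norm_chr [simp]: "cmod (chr s k \<xi>) = 1"
  by (simp add: chr_def)

lemma chr_measurable [measurable]: "chr s k \<in> borel_measurable borel"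
  unfolding chr_def by measurable

inductive trig_poly :: "real \<Rightarrow> (real^'d::finite \<Rightarrow> complex) \<Rightarrow> bool" for s where
  chr: "trig_poly s (\<lambda>\<xi>. c * chr s k \<xi>)"
| add: "trig_poly s p \<Longrightarrow> trig_poly s q \<Longrightarrow> trig_poly s (\<lambda>\<xi>. p \<xi> + q \<xi>)"

lemma trig_poly_const: "trig_poly s (\<lambda>_. c)"
  using trig_poly.chr[of s c 0] by simp

lemma trig_poly_mult_chr:
  assumes "trig_poly s p" shows "trig_poly s (\<lambda>\<xi>. c * chr s k \<xi> * p \<xi>)"
  using assms
proof induction
  case (chr d l)
  show ?case using trig_poly.chr[of s "c * d" "k + l"] by (simp add: chr_add mult_ac)
next
  case (add p q)
  then show ?case using trig_poly.add by (simp add: distrib_left)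
qed

lemma trig_poly_mult:
  assumes "trig_poly s p" "trig_poly s q" shows "trig_poly s (\<lambda>\<xi>. p \<xi> * q \<xi>)"
  using assms(1)
proof induction
  case (chr c k)
  show ?case using trig_poly_mult_chr[OF assms(2)] .
next
  case (add p q)
  then show ?case using trig_poly.add by (simp add: distrib_right)
qed

lemma trig_poly_cmult: "trig_poly s p \<Longrightarrow> trig_poly s (\<lambda>\<xi>. c * p \<xi>)"
  using trig_poly_mult_chr[of s p c 0] by simp

lemma trig_poly_sum:
  assumes "finite A" "\<And>i. i \<in> A \<Longrightarrow> trig_poly s (p i)"
  shows "trig_poly s (\<lambda>\<xi>. \<Sum>i\<in>A. p i \<xi>)"
  using assms by (induction A rule: finite_induct) (auto intro: trig_poly_const trig_poly.add)

lemma trig_poly_measurable: "trig_poly s p \<Longrightarrow> p \<in> borel_measurable borel"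
  by (induction rule: trig_poly.induct) auto

lemma trig_poly_bounded:
  assumes "trig_poly s p" obtains C where "C \<ge> 0" "\<And>\<xi>. cmod (p \<xi>) \<le> C"
proof -
  from assms have "\<exists>C\<ge>0. \<forall>\<xi>. cmod (p \<xi>) \<le> C"
  proof induction
    case (chr c k)
    show ?case by (rule exI[of _ "cmod c"]) (simp add: norm_mult)
  next
    case (add p q)
    then obtain C D where "C \<ge> 0" "D \<ge> 0" "\<And>\<xi>. cmod (p \<xi>) \<le> C" "\<And>\<xi>. cmod (q \<xi>) \<le> D" by metis
    then show ?case
      by (intro exI[of _ "C + D"]) (auto intro: order_trans[OF norm_triangle_ineq add_mono])
  qed
  then show ?thesis using that by blast
qed

text \<open>Realises the torus of period 2 * pi / s as a bounded subset of a Euclidean space, where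
  Stone-Weierstrass for real polynomials applies.\<close>

definition torus_map :: "real \<Rightarrow> real^'d::finite \<Rightarrow> complex^'d" where
  "torus_map s \<xi> = (\<chi> i. cis (s * \<xi> $ i))"

lemma torus_map_continuous: "continuous_on A (torus_map s)"
  unfolding torus_map_def by (intro continuous_intros)

lemma norm_torus_map: "norm (torus_map s (\<xi> :: real^'d::finite)) \<le> real CARD('d)"
proof -
  have "norm (torus_map s \<xi>) \<le> (\<Sum>i\<in>UNIV. norm (torus_map s \<xi> $ i))" unfolding norm_vec_def
      by (rule L2_set_le_sum) auto
  then show ?thesis by (simp add: torus_map_def)
qed

lemma cis_coord_chr: "cis (s * \<xi> $ i) = chr s (axis i 1) \<xi>" "cis (- (s * \<xi> $ i)) = chr s (axis i (-1)) \<xi>"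
  by (simp_all add: chr_def axis_def if_distrib[of of_int] if_distrib[of "\<lambda>x. x * _"] cong: if_cong)

lemma trig_poly_cos: "trig_poly s (\<lambda>\<xi>. complex_of_real (cos (s * \<xi> $ i)))"
  and trig_poly_sin: "trig_poly s (\<lambda>\<xi>. complex_of_real (sin (s * \<xi> $ i)))"
proof -
  have c: "complex_of_real (cos x) = 1/2 * cis x + 1/2 * cis (- x)" for x
    by (simp add: complex_eq_iff)
  have s: "complex_of_real (sin x) = -\<i>/2 * cis x + \<i>/2 * cis (- x)" for x
    by (simp add: complex_eq_iff)
  show "trig_poly s (\<lambda>\<xi>. complex_of_real (cos (s * \<xi> $ i)))"
    unfolding c cis_coord_chr by (intro trig_poly.intros)
  show "trig_poly s (\<lambda>\<xi>. complex_of_real (sin (s * \<xi> $ i)))"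
    unfolding s cis_coord_chr by (intro trig_poly.intros)
qed

text \<open>A real-linear functional of the torus point is a combination of sines and cosines of the
  coordinates; sums and products stay within trigonometric polynomials.\<close>

lemma trig_poly_real_polynomial:
  assumes "real_polynomial_function (q :: complex^'d::finite \<Rightarrow> real)"
  shows "trig_poly s (\<lambda>\<xi>. complex_of_real (q (torus_map s \<xi>)))"
  using assms
proof induction
  case (linear f)
  interpret bounded_linear f by fact
  have "f (torus_map s \<xi>) = (\<Sum>i\<in>UNIV. cos (s * \<xi> $ i) * f (axis i 1) + sin (s * \<xi> $ i) * f (axis i \<i>))" for \<xi>
  proof -
    have "torus_map s \<xi> = (\<Sum>i\<in>UNIV. cos (s * \<xi> $ i) *\<^sub>R axis i 1 + sin (s * \<xi> $ i) *\<^sub>R axis i \<i>)"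
      by (simp add: vec_eq_iff torus_map_def axis_def if_distrib[of "\<lambda>x. _ *\<^sub>R x"] sum.distrib complex_eq_iff
          cong: if_cong)
    then show ?thesis by (simp add: sum add scaleR)
  qed
  moreover have "trig_poly s (\<lambda>\<xi>. \<Sum>i\<in>UNIV. complex_of_real (f (axis i 1)) * complex_of_real (cos (s * \<xi> $ i))
      + complex_of_real (f (axis i \<i>)) * complex_of_real (sin (s * \<xi> $ i)))"
    by (intro trig_poly_sum trig_poly.add trig_poly_cmult trig_poly_cos trig_poly_sin) auto
  ultimately show ?case by (simp add: mult.commute)
next
  case (const c)
  show ?case by (rule trig_poly_const)
next
  case (add f g)
  then show ?case using trig_poly.add by simp
next
  case (mult f g)
  then show ?case using trig_poly_mult by simp
qed

text \<open>The continuous functions \<open>max 0 (1 - n \<cdot> infdist z T)\<close> decrease to the indicator of the compact set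
  \<open>T\<close>; by Stone--Weierstrass on the torus they are uniform limits of trigonometric polynomials.\<close>

lemma trig_poly_approx_indicator:
  fixes K :: "(real^'d::finite) set"
  assumes K: "compact K" "K \<noteq> {}"
  obtains p where "\<And>n::nat. trig_poly s (p n)" "\<And>n \<xi>. cmod (p n \<xi>) \<le> 2"
    "\<And>\<xi>. (\<lambda>n. p n \<xi>) \<longlonglongrightarrow> indicator {\<xi>. torus_map s \<xi> \<in> torus_map s ` K} \<xi>"
proof -
  let ?T = "torus_map s ` K"
  let ?S = "cball 0 (real CARD('d)) :: (complex^'d) set"
  have T: "closed ?T" "?T \<noteq> {}"
    using K compact_continuous_image[OF torus_map_continuous] by (auto intro: compact_imp_closed)
  define f where "f n z = max 0 (1 - real n * infdist z ?T)" for n z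
  \<comment> \<open>The approximation is uniform on a ball containing the whole torus, with error
    below 1 / (n + 1), so the polynomials inherit the pointwise limit of \<open>f n\<close>.\<close>
  have "\<exists>q. real_polynomial_function q \<and> (\<forall>z\<in>?S. \<bar>f n z - q z\<bar> < 1 / real (Suc n))" for n
  proof -
    have "continuous_on ?S (f n)" unfolding f_def by (intro continuous_intros)
    from Stone_Weierstrass_real_polynomial_function[OF compact_cball this, of "1 / real (Suc n)"]
    show ?thesis by (metis of_nat_0_less_iff zero_less_Suc zero_less_divide_1_iff)
  qed
  then obtain q where q: "\<And>n. real_polynomial_function (q n)"
    "\<And>n z. z \<in> ?S \<Longrightarrow> \<bar>f n z - q n z\<bar> < 1 / real (Suc n)" by metis
  define p where "p n \<xi> = complex_of_real (q n (torus_map s \<xi>))" for n \<xi>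
  have S: "torus_map s \<xi> \<in> ?S" for \<xi> using norm_torus_map by simp
  show ?thesis
  proof (rule that[of p])
    show "trig_poly s (p n)" for n
      unfolding p_def by (intro trig_poly_real_polynomial q)
    \<comment> \<open>The value 2 is the bound 1 for \<open>f n\<close> plus an error of at most 1;
      being uniform in n, it later feeds dominated convergence.\<close>
    show "cmod (p n \<xi>) \<le> 2" for n \<xi>
    proof -
      have "\<bar>f n (torus_map s \<xi>)\<bar> \<le> 1"
        by (auto simp: f_def max_def infdist_nonneg)
      moreover have "1 / real (Suc n) \<le> 1" by simp
      ultimately have "\<bar>q n (torus_map s \<xi>)\<bar> \<le> 2" using q(2)[OF S[of \<xi>], of n] by linarith
      then show ?thesis by (simp add: p_def)
    qed
    show "(\<lambda>n. p n \<xi>) \<longlonglongrightarrow> indicator {\<xi>. torus_map s \<xi> \<in> ?T} \<xi>" for \<xi>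
    proof -
      define z where "z = torus_map s \<xi>"
      have "(\<lambda>n. f n z) \<longlonglongrightarrow> indicator ?T z"
      proof (cases "z \<in> ?T")
        case True
        then show ?thesis by (simp add: f_def)
      next
        case False
        then have d: "infdist z ?T > 0"
          using T by (metis in_closed_iff_infdist_zero infdist_nonneg less_eq_real_def)
        obtain N :: nat where N: "1 / infdist z ?T < N" using reals_Archimedean2 by blast
        have "f n z = 0" if "n \<ge> N" for n
        proof -
          have "1 < real N * infdist z ?T" using N d by (simp add: field_simps)
          also have "\<dots> \<le> real n * infdist z ?T" using that d by (intro mult_right_mono) auto
          finally show ?thesis by (simp add: f_def)
        qed
        then have "\<forall>\<^sub>F n in sequentially. f n z = 0" using eventually_sequentially by blast
        then show ?thesis using False by (simp add: tendsto_eventually)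
      qed
      moreover have "(\<lambda>n. f n z - q n z) \<longlonglongrightarrow> 0"
      proof (rule Lim_null_comparison[OF _ LIMSEQ_inverse_real_of_nat])
        show "\<forall>\<^sub>F n in sequentially. norm (f n z - q n z) \<le> inverse (real (Suc n))"
          using q(2)[OF S] by (auto simp: z_def inverse_eq_divide intro!: always_eventually less_imp_le)
      qed
      ultimately have "(\<lambda>n. f n z - (f n z - q n z)) \<longlonglongrightarrow> indicator ?T z - 0"
        by (rule tendsto_diff)
      then have "(\<lambda>n. complex_of_real (q n z)) \<longlonglongrightarrow> complex_of_real (indicator ?T z)"
        by (intro tendsto_of_real) simp
      then show ?thesis by (cases "z \<in> ?T") (simp_all add: p_def z_def)
    qed
  qed
qed

section \<open>Periodisation and uniqueness for integrable functions\<close>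

lemma torus_map_eq_imp:
  assumes "torus_map s \<xi> = torus_map s \<eta>"
  obtains n :: int where "s * \<xi> $ i - s * \<eta> $ i = 2 * pi * n"
proof -
  have "cis (s * \<xi> $ i) = cis (s * \<eta> $ i)"
    using assms by (simp add: torus_map_def vec_eq_iff)
  then have "sin (s * \<xi> $ i) = sin (s * \<eta> $ i) \<and> cos (s * \<xi> $ i) = cos (s * \<eta> $ i)"
    by (auto simp: complex_eq_iff)
  then obtain n :: int where "s * \<xi> $ i = s * \<eta> $ i + 2 * pi * n"
    unfolding sin_cos_eq_iff by auto
  then show ?thesis using that by simp
qed

lemma vimage_torus_measurable:
  assumes "compact K" shows "{\<xi>. torus_map s \<xi> \<in> torus_map s ` K} \<in> sets borel"
proof -
  have "closed (torus_map s ` K)"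
    using assms compact_continuous_image[OF torus_map_continuous] by (auto intro: compact_imp_closed)
  then have "closed (torus_map s -` (torus_map s ` K))"
    by (intro closed_vimage) (auto simp: torus_map_continuous)
  then show ?thesis by (simp add: vimage_def)
qed

text \<open>Two points with the same torus image differ in each coordinate by a multiple of 2 * pi /
  s. Once this period exceeds |\<xi>| + R, no point of \<open>K\<close> other than \<xi> itself can
  share its image.\<close>

lemma torus_vimage_tendsto:
  assumes K: "compact K" and s: "s \<longlonglongrightarrow> 0" "\<And>n. s n > 0"
  shows "\<forall>\<^sub>F n in sequentially. torus_map (s n) \<xi> \<in> torus_map (s n) ` K \<longleftrightarrow> \<xi> \<in> K"
proof -
  obtain R where R: "R > 0" "\<And>\<eta>. \<eta> \<in> K \<Longrightarrow> norm \<eta> \<le> R"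
    using compact_imp_bounded[OF K] bounded_pos by blast
  have "\<forall>\<^sub>F n in sequentially. s n < 2 * pi / (norm \<xi> + R)"
    using R(1) s(1) by (intro order_tendstoD(2)[OF s(1)]) (simp add: add_nonneg_pos)
  then show ?thesis
  proof eventually_elim
    case (elim n)
    have "\<xi> \<in> K" if "torus_map (s n) \<xi> \<in> torus_map (s n) ` K"
    proof -
      from that obtain \<eta> where \<eta>: "\<eta> \<in> K" "torus_map (s n) \<xi> = torus_map (s n) \<eta>" by auto
      have "\<xi> $ i = \<eta> $ i" for i
      proof -
        obtain m :: int where m: "s n * \<xi> $ i - s n * \<eta> $ i = 2 * pi * m" using torus_map_eq_imp[OF \<eta>(2)] .
        have "\<bar>\<xi> $ i - \<eta> $ i\<bar> \<le> norm \<xi> + R"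
          using component_le_norm_cart[of \<xi> i] component_le_norm_cart[of \<eta> i] R(2)[OF \<eta>(1)] by linarith
        then have "s n * \<bar>\<xi> $ i - \<eta> $ i\<bar> \<le> s n * (norm \<xi> + R)"
          using s(2)[of n] by (intro mult_left_mono) auto
        also have "\<dots> < 2 * pi" using elim R(1) by (simp add: add_nonneg_pos pos_less_divide_eq)
        also have "s n * \<bar>\<xi> $ i - \<eta> $ i\<bar> = \<bar>2 * pi * m\<bar>"
          unfolding m[symmetric] using s(2)[of n] by (simp add: abs_mult flip: right_diff_distrib)
        finally have "\<bar>m\<bar> < 1" by (simp add: abs_mult flip: of_int_abs)
        then show ?thesis using m s(2)[of n] by (simp flip: right_diff_distrib)
      qed
      then show ?thesis using \<eta>(1) by (metis vec_eq_iff)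
    qed
    then show ?case by auto
  qed
qed

text \<open>By periodisation: as the period grows, the indicator of the periodised compact set \<open>K\<close> tends to that of \<open>K\<close>.\<close>

theorem fourier_unique_L1:
  fixes h :: "real^'d::finite \<Rightarrow> complex"
  assumes h: "integrable lborel h" and 0: "\<And>x. (LINT \<xi>|lborel. h \<xi> * cis (x \<bullet> \<xi>)) = 0"
  shows "AE \<xi> in lborel. h \<xi> = 0"
proof -
  have hm[measurable]: "h \<in> borel_measurable borel" using h by auto
  have trig: "(LINT \<xi>|lborel. h \<xi> * p \<xi>) = 0" if "trig_poly s p" for s p
    using that
  proof induction
    case (chr c k)
    \<comment> \<open>A character is the exponential with frequency vector s * k, where the
      hypothesis applies.\<close>
    have "chr s k \<xi> = cis ((\<chi> i. s * of_int (k $ i)) \<bullet> \<xi>)" for \<xi>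
      by (simp add: chr_def inner_vec_def sum_distrib_left mult_ac)
    then show ?case using 0 by (simp add: mult.left_commute)
  next
    case (add p q)
    have "integrable lborel (\<lambda>\<xi>. h \<xi> * r \<xi>)" if r: "trig_poly s r" for r
    proof -
      obtain C where "\<And>\<xi>. cmod (r \<xi>) \<le> C" using trig_poly_bounded[OF r] by metis
      then show ?thesis 
        using integrable_bounded_mult[OF trig_poly_measurable[OF r] _ h] by (subst mult.commute) blast
    qed
    with add show ?case by (simp add: distrib_left)
  qed
  have compact: "(LINT \<xi>|lborel. h \<xi> * indicator K \<xi>) = 0" if K: "compact K" for K
  proof (cases "K = {}")
    case False
    define J where "J s = {\<xi>. torus_map s \<xi> \<in> torus_map s ` K}" for s
    have [measurable]: "J s \<in> sets borel" for s
      unfolding J_def by (rule vimage_torus_measurable[OF K])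
    have Km[measurable]: "K \<in> sets borel" using K by (simp add: borel_compact)
    have J: "(LINT \<xi>|lborel. h \<xi> * indicator (J s) \<xi>) = 0" for s
    proof -
      obtain p where p: "\<And>n::nat. trig_poly s (p n)" "\<And>n \<xi>. cmod (p n \<xi>) \<le> 2"
        "\<And>\<xi>. (\<lambda>n. p n \<xi>) \<longlonglongrightarrow> indicator (J s) \<xi>"
        unfolding J_def using trig_poly_approx_indicator[OF K False] by metis
      have [measurable]: "p n \<in> borel_measurable borel" for n using trig_poly_measurable[OF p(1)] .
      have "(\<lambda>n. LINT \<xi>|lborel. h \<xi> * p n \<xi>) \<longlonglongrightarrow> (LINT \<xi>|lborel. h \<xi> * indicator (J s) \<xi>)"
      proof (rule integral_dominated_convergence[where w = "\<lambda>\<xi>. cmod (h \<xi>) * 2"])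
        show "AE \<xi> in lborel. (\<lambda>n. h \<xi> * p n \<xi>) \<longlonglongrightarrow> h \<xi> * indicator (J s) \<xi>"
          by (intro AE_I2 tendsto_mult tendsto_const p)
        show "AE \<xi> in lborel. cmod (h \<xi> * p n \<xi>) \<le> cmod (h \<xi>) * 2" for n
          by (intro AE_I2) (auto simp: norm_mult intro!: mult_left_mono p)
      qed (use h in auto)
      then show ?thesis by (simp add: trig[OF p(1)] LIMSEQ_const_iff)
    qed
    define s where "s n = 1 / real (Suc n)" for n
    have s: "s n > 0" for n by (auto simp: s_def)
    have s0: "s \<longlonglongrightarrow> 0" unfolding s_def by (rule LIMSEQ_inverse_real_of_nat[unfolded inverse_eq_divide])
    have "(\<lambda>n. LINT \<xi>|lborel. h \<xi> * indicator (J (s n)) \<xi>) \<longlonglongrightarrow> (LINT \<xi>|lborel. h \<xi> * indicator K \<xi>)"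
    proof (rule integral_dominated_convergence[where w = "\<lambda>\<xi>. cmod (h \<xi>)"])
      show "AE \<xi> in lborel. (\<lambda>n. h \<xi> * indicator (J (s n)) \<xi>) \<longlonglongrightarrow> h \<xi> * indicator K \<xi>"
      proof (intro AE_I2 tendsto_mult tendsto_const)
        fix \<xi>
        have "\<forall>\<^sub>F n in sequentially. indicator (J (s n)) \<xi> = (indicator K \<xi> :: complex)"
          using torus_vimage_tendsto[OF K s0 s, of \<xi>] by eventually_elim (simp add: J_def indicator_def)
        then show "(\<lambda>n. indicator (J (s n)) \<xi> :: complex) \<longlonglongrightarrow> indicator K \<xi>" by (rule tendsto_eventually)
      qed
      show "AE \<xi> in lborel. cmod (h \<xi> * indicator (J (s n)) \<xi>) \<le> cmod (h \<xi>)" for n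
        by (intro AE_I2) (auto simp: indicator_def)
    qed (use h in auto)
    then show ?thesis by (simp add: J LIMSEQ_const_iff)
  qed simp
  have closed: "(LINT \<xi>|lborel. h \<xi> * indicator C \<xi>) = 0" if C: "closed C" for C
  proof -
    have [measurable]: "C \<in> sets borel" using C by simp
    have [measurable]: "cball (0::real^'d) r \<in> sets borel" for r by simp
    have "(\<lambda>n. LINT \<xi>|lborel. h \<xi> * indicator (C \<inter> cball 0 (real n)) \<xi>) \<longlonglongrightarrow> (LINT \<xi>|lborel. h \<xi> * indicator C \<xi>)"
    proof (rule integral_dominated_convergence[where w = "\<lambda>\<xi>. cmod (h \<xi>)"])
      show "AE \<xi> in lborel. (\<lambda>n. h \<xi> * indicator (C \<inter> cball 0 (real n)) \<xi>) \<longlonglongrightarrow> h \<xi> * indicator C \<xi>"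
      proof (intro AE_I2 tendsto_mult tendsto_const)
        fix \<xi> :: "real^'d"
        obtain N :: nat where "norm \<xi> \<le> N" using real_arch_simple by blast
        then have "\<forall>\<^sub>F n in sequentially. indicator (C \<inter> cball 0 (real n)) \<xi> = (indicator C \<xi> :: complex)"
          unfolding eventually_sequentially by (intro exI[of _ N]) (auto simp: indicator_def)
        then show "(\<lambda>n. indicator (C \<inter> cball 0 (real n)) \<xi> :: complex) \<longlonglongrightarrow> indicator C \<xi>"
          by (rule tendsto_eventually)
      qed
      show "AE \<xi> in lborel. cmod (h \<xi> * indicator (C \<inter> cball 0 (real n)) \<xi>) \<le> cmod (h \<xi>)" for n
        by (intro AE_I2) (auto simp: indicator_def)
    qed (use h in auto)
    moreover have "compact (C \<inter> cball 0 (real n))" for n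
      using C by (simp add: closed_Int_compact)
    ultimately show ?thesis by (simp add: compact LIMSEQ_const_iff)
  qed
  \<comment> \<open>Closed sets are an intersection-stable generator of the Borel sets, and
    vanishing of the integral passes to complements and to countable disjoint unions.\<close>
  have all: "set_lebesgue_integral lborel A h = 0" if "A \<in> sets borel" for A
  proof -
    have eq: "set_lebesgue_integral lborel A h = (LINT \<xi>|lborel. h \<xi> * indicator A \<xi>)" for A
      unfolding set_lebesgue_integral_def
      by (intro Bochner_Integration.integral_cong) (auto simp: indicator_def)
    have si: "set_integrable lborel A h" if "A \<in> sets borel" for A
      using h that unfolding set_integrable_def by (intro integrable_mult_indicator) auto
    have "A \<in> sigma_sets UNIV (Collect closed)"
      using that by (simp add: borel_eq_closed)
    have "Int_stable (Collect closed :: (real^'d) set set)" by (auto simp: Int_stable_def)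
    moreover have "(Collect closed :: (real^'d) set set) \<subseteq> Pow UNIV" by simp
    ultimately show ?thesis using \<open>A \<in> sigma_sets UNIV (Collect closed)\<close>
    proof (induction rule: sigma_sets_induct_disjoint)
      case (basic A)
      then show ?case by (simp add: eq closed)
    next
      case empty
      show ?case by (simp add: set_lebesgue_integral_def)
    next
      case (compl A)
      then have A: "A \<in> sets borel" by (simp add: borel_eq_closed)
      have "set_lebesgue_integral lborel (A \<union> (UNIV - A)) h =
          set_lebesgue_integral lborel A h + set_lebesgue_integral lborel (UNIV - A) h"
        using A by (intro set_integral_Un si) auto
      moreover have "set_lebesgue_integral lborel UNIV h = 0"
        unfolding eq using closed[of UNIV] by simp
      ultimately show ?case using compl.IH by (simp add: Un_absorb1)
    next
      case (union F)
      then have F: "F i \<in> sets borel" for i by (auto simp: borel_eq_closed)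
      have "set_lebesgue_integral lborel (\<Union>i. F i) h = (\<Sum>i. set_lebesgue_integral lborel (F i) h)"
        using union F by (intro lebesgue_integral_countable_add si) (auto simp: disjoint_family_on_def)
      then show ?case using union by simp
    qed
  qed
  show ?thesis
    by (rule sigma_finite_measure.density_zero[OF sigma_finite_lborel h]) (auto intro: all)
qed

section \<open>Sobolev distributions\<close>

text \<open>A class closed under directional derivatives and of polynomial growth; it collects the
  factors that differentiation puts in front of a Gaussian.\<close>

inductive poly_fun :: "('a::euclidean_space \<Rightarrow> complex) \<Rightarrow> bool" where
  const: "poly_fun (\<lambda>_. c)"
| inner: "poly_fun (\<lambda>x. complex_of_real (x \<bullet> v))"
| add: "poly_fun p \<Longrightarrow> poly_fun q \<Longrightarrow> poly_fun (\<lambda>x. p x + q x)"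
| mult: "poly_fun p \<Longrightarrow> poly_fun q \<Longrightarrow> poly_fun (\<lambda>x. p x * q x)"

lemma poly_fun_derivative:
  assumes "poly_fun p"
  obtains D where "\<And>x. (p has_derivative D x) (at x)" "\<And>v. poly_fun (\<lambda>x. D x v)"
proof -
  from assms have "\<exists>D. (\<forall>x. (p has_derivative D x) (at x)) \<and> (\<forall>v. poly_fun (\<lambda>x. D x v))"
  proof induction
    case (const c)
    show ?case by (rule exI[of _ "\<lambda>x v. 0"]) (auto intro: poly_fun.const)
  next
    case (inner w)
    show ?case
      by (rule exI[of _ "\<lambda>x v. complex_of_real (v \<bullet> w)"]) (auto intro!: derivative_eq_intros poly_fun.const)
  next
    case (add p q)
    then obtain D E where "\<forall>x. (p has_derivative D x) (at x)" "\<forall>v. poly_fun (\<lambda>x. D x v)"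
      "\<forall>x. (q has_derivative E x) (at x)" "\<forall>v. poly_fun (\<lambda>x. E x v)" by auto
    then show ?case
      by (intro exI[of _ "\<lambda>x v. D x v + E x v"]) (auto intro!: derivative_eq_intros poly_fun.add)
  next
    case (mult p q)
    then obtain D E where "\<forall>x. (p has_derivative D x) (at x)" "\<forall>v. poly_fun (\<lambda>x. D x v)"
      "\<forall>x. (q has_derivative E x) (at x)" "\<forall>v. poly_fun (\<lambda>x. E x v)" by auto
    with mult show ?case
      by (intro exI[of _ "\<lambda>x v. p x * E x v + D x v * q x"])
        (auto intro!: has_derivative_mult poly_fun.add poly_fun.mult)
  qed
  then show ?thesis using that by blast
qed

lemma poly_fun_growth:
  assumes "poly_fun p"
  obtains C N where "C \<ge> 0" "\<And>x. cmod (p x) \<le> C * (1 + norm x) ^ N"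
proof -
  from assms have "\<exists>C N. C \<ge> 0 \<and> (\<forall>x. cmod (p x) \<le> C * (1 + norm x) ^ N)"
  proof induction
    case (const c)
    show ?case by (rule exI[of _ "cmod c"], rule exI[of _ 0]) simp
  next
    case (inner v)
    have "\<bar>x \<bullet> v\<bar> \<le> norm v * (1 + norm x) ^ 1" for x
      using Cauchy_Schwarz_ineq2[of x v] by (simp add: algebra_simps add_increasing)
    then show ?case by (intro exI[of _ "norm v"] exI[of _ 1]) simp
  next
    case (add p q)
    then obtain C N D M where CN: "C \<ge> 0" "\<And>x. cmod (p x) \<le> C * (1 + norm x) ^ N"
      and DM: "D \<ge> 0" "\<And>x. cmod (q x) \<le> D * (1 + norm x) ^ M" by auto
    have "cmod (p x + q x) \<le> (C + D) * (1 + norm x) ^ (N + M)" for x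
    proof -
      have "cmod (p x + q x) \<le> C * (1 + norm x) ^ N + D * (1 + norm x) ^ M"
        using norm_triangle_ineq[of "p x" "q x"] CN(2)[of x] DM(2)[of x] by linarith
      also have "\<dots> \<le> C * (1 + norm x) ^ (N + M) + D * (1 + norm x) ^ (N + M)"
        using CN(1) DM(1) by (intro add_mono mult_left_mono power_increasing) auto
      finally show ?thesis by (simp add: algebra_simps)
    qed
    then show ?case using CN(1) DM(1) by (intro exI[of _ "C + D"] exI[of _ "N + M"]) simp
  next
    case (mult p q)
    then obtain C N D M where CN: "C \<ge> 0" "\<And>x. cmod (p x) \<le> C * (1 + norm x) ^ N"
      and DM: "D \<ge> 0" "\<And>x. cmod (q x) \<le> D * (1 + norm x) ^ M" by auto
    have "cmod (p x * q x) \<le> (C * D) * (1 + norm x) ^ (N + M)" for x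
    proof -
      have "cmod (p x) * cmod (q x) \<le> (C * (1 + norm x) ^ N) * (D * (1 + norm x) ^ M)"
        using CN DM by (intro mult_mono) auto
      then show ?thesis by (simp add: norm_mult power_add mult_ac)
    qed
    then show ?case using CN(1) DM(1) by (intro exI[of _ "C * D"] exI[of _ "N + M"]) simp
  qed
  then show ?thesis using that by blast
qed

text \<open>Test functions for uniqueness: pairing with all of them evaluates the Fourier transform
  of a function damped by a Gaussian.\<close>

definition gauss_cis :: "'a::euclidean_space \<Rightarrow> 'a \<Rightarrow> complex" where
  "gauss_cis y x = complex_of_real (exp (- (x \<bullet> x))) * cis (y \<bullet> x)"

lemma poly_gauss_cis_derivative:
  assumes "poly_fun p"
  obtains q where "\<And>x. ((\<lambda>x. p x * gauss_cis y x) has_derivative (\<lambda>v. q v x * gauss_cis y x)) (at x)"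
    "\<And>v. poly_fun (q v)"
proof -
  obtain D where D: "\<And>x. (p has_derivative D x) (at x)" "\<And>v. poly_fun (\<lambda>x. D x v)"
    using poly_fun_derivative[OF assms] by metis
  \<comment> \<open>The bracket is the logarithmic derivative of \<open>gauss_cis y\<close> in
    direction \<open>v\<close>.\<close>
  define q where "q v x = D x v + p x * ((-2) * complex_of_real (x \<bullet> v) + \<i> * complex_of_real (y \<bullet> v))" for v x
  show ?thesis
  proof (rule that[of q])
    show "poly_fun (q v)" for v
      unfolding q_def by (intro poly_fun.intros assms D)
    show "((\<lambda>x. p x * gauss_cis y x) has_derivative (\<lambda>v. q v x * gauss_cis y x)) (at x)" for x
      unfolding gauss_cis_def q_def
      by (rule derivative_eq_intros D refl ext | simp)+
        (simp add: scaleR_conv_of_real algebra_simps inner_commute)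
  qed
qed

lemma dpart_gauss_cis:
  obtains p where "poly_fun p" "dpart bs (gauss_cis y) = (\<lambda>x. p x * gauss_cis y x)"
proof -
  have "\<exists>p. poly_fun p \<and> dpart bs (gauss_cis y) = (\<lambda>x. p x * gauss_cis y x)"
  proof (induction bs)
    case Nil
    show ?case by (rule exI[of _ "\<lambda>_. 1"]) (auto intro: poly_fun.const)
  next
    case (Cons b bs)
    then obtain p where p: "poly_fun p" "dpart bs (gauss_cis y) = (\<lambda>x. p x * gauss_cis y x)" by blast
    obtain q where q: "\<And>x. ((\<lambda>x. p x * gauss_cis y x) has_derivative (\<lambda>v. q v x * gauss_cis y x)) (at x)"
      "\<And>v. poly_fun (q v)" using poly_gauss_cis_derivative[OF p(1)] by metis
    have "dpart (b # bs) (gauss_cis y) = (\<lambda>x. q b x * gauss_cis y x)"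
      using frechet_derivative_at[OF q(1)] by (simp add: p(2) fun_eq_iff)
    then show ?case using q(2) by blast
  qed
  then show ?thesis using that by blast
qed

lemma power_le_fact_exp: "0 \<le> x \<Longrightarrow> x ^ n \<le> fact n * exp (x::real)"
proof -
  assume x: "0 \<le> x"
  have "(\<Sum>k\<in>{n}. x ^ k /\<^sub>R fact k) \<le> (\<Sum>k. x ^ k /\<^sub>R fact k)"
    by (rule sum_le_suminf[OF summable_exp_generic]) (use x in auto)
  then show ?thesis by (simp add: exp_def field_simps)
qed

theorem schwartz_gauss_cis: "schwartz (gauss_cis (y::'a::euclidean_space))"
  unfolding schwartz_def
proof (intro ballI conjI allI)
  fix bs :: "'a list" and x
  obtain p where p: "poly_fun p" "dpart bs (gauss_cis y) = (\<lambda>x. p x * gauss_cis y x)"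
    using dpart_gauss_cis .
  show "dpart bs (gauss_cis y) differentiable at x"
    using poly_gauss_cis_derivative[OF p(1)] unfolding p(2) differentiable_def by metis
  fix N :: nat
  obtain C M where C: "C \<ge> 0" "\<And>x. cmod (p x) \<le> C * (1 + norm x) ^ M"
    using poly_fun_growth[OF p(1)] by metis
  show "bounded (range (\<lambda>x. (1 + norm x) ^ N *\<^sub>R dpart bs (gauss_cis y) x))"
    unfolding bounded_iff
  proof (intro exI ballI)
    fix z assume "z \<in> range (\<lambda>x. (1 + norm x) ^ N *\<^sub>R dpart bs (gauss_cis y) x)"
    then obtain x where z: "z = (1 + norm x) ^ N *\<^sub>R dpart bs (gauss_cis y) x" by auto
    \<comment> \<open>Gives |x| <= 1 + |x|^2. The polynomial factor is absorbed by exp (1 + |x|),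
      and the total exponent 1 + |x| - |x|^2 is then at most 2.\<close>
    have "0 \<le> (norm x - 1)\<^sup>2" by simp
    then have sq: "norm x \<le> 1 + x \<bullet> x"
      by (simp add: power2_diff power2_norm_eq_inner) (smt (verit) norm_ge_zero)
    have "norm z = (1 + norm x) ^ N * (cmod (p x) * exp (- (x \<bullet> x)))"
      by (simp add: z p(2) gauss_cis_def norm_mult)
    also have "\<dots> \<le> (1 + norm x) ^ N * (C * (1 + norm x) ^ M * exp (- (x \<bullet> x)))"
      by (intro mult_left_mono mult_right_mono C) auto
    also have "\<dots> = C * ((1 + norm x) ^ (N + M) * exp (- (x \<bullet> x)))"
      by (simp add: power_add mult_ac)
    also have "\<dots> \<le> C * (fact (N + M) * exp (1 + norm x) * exp (- (x \<bullet> x)))"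
      by (intro mult_left_mono mult_right_mono power_le_fact_exp C) auto
    also have "\<dots> = C * fact (N + M) * exp (1 + norm x - x \<bullet> x)"
      by (simp add: exp_diff exp_minus divide_inverse mult_ac)
    also have "\<dots> \<le> C * fact (N + M) * exp 2"
      using sq C(1) by (intro mult_left_mono) auto
    finally show "norm z \<le> C * fact (N + M) * exp 2" .
  qed
qed

text \<open>The difference of the representatives times a Gaussian is integrable, since the Gaussian
  is an admissible test function, and all its exponential integrals vanish by testing with
  \<open>gauss_cis x\<close>. As the Gaussian has no zeros, the L1 case applies.\<close>

theorem has_fourier_unique:
  fixes T :: "(real^'d::finite) distr"
  assumes f: "has_fourier T f" and g: "has_fourier T g"
  shows "AE \<xi> in lborel. f \<xi> = g \<xi>"
proof -
  have i: "integrable lborel (\<lambda>\<xi>. f \<xi> * gauss_cis y \<xi>)" "integrable lborel (\<lambda>\<xi>. g \<xi> * gauss_cis y \<xi>)"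
    "(LINT \<xi>|lborel. f \<xi> * gauss_cis y \<xi>) = (LINT \<xi>|lborel. g \<xi> * gauss_cis y \<xi>)" for y
    using f g schwartz_gauss_cis[of y] unfolding has_fourier_def by metis+
  define h where "h \<xi> = f \<xi> * gauss_cis 0 \<xi> - g \<xi> * gauss_cis 0 \<xi>" for \<xi>
  have "AE \<xi> in lborel. h \<xi> = 0"
  proof (rule fourier_unique_L1)
    show "integrable lborel h" unfolding h_def using i by simp
    show "(LINT \<xi>|lborel. h \<xi> * cis (x \<bullet> \<xi>)) = 0" for x
    proof -
      have "h \<xi> * cis (x \<bullet> \<xi>) = f \<xi> * gauss_cis x \<xi> - g \<xi> * gauss_cis x \<xi>" for \<xi>
        by (simp add: h_def gauss_cis_def algebra_simps)
      then show ?thesis using i[of x] by simp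
    qed
  qed
  then show ?thesis
    by eventually_elim (simp add: h_def gauss_cis_def flip: left_diff_distrib)
qed

section \<open>Representatives of the transforms of Sobolev distributions\<close>

lemma has_fourier_ft: "has_fourier T g \<Longrightarrow> has_fourier T (ft T)"
  unfolding ft_def by (rule someI[of "has_fourier T"])

lemma ft_eq_AE:
  fixes T :: "(real^'d::finite) distr"
  shows "has_fourier T g \<Longrightarrow> AE \<xi> in lborel. ft T \<xi> = g \<xi>"
  using has_fourier_unique has_fourier_ft by blast

lemma sobolev_ft_measurable: "T \<in> sobolev s \<Longrightarrow> ft T \<in> borel_measurable borel"
proof -
  assume "T \<in> sobolev s"
  then obtain g where "has_fourier T g" by (auto simp: sobolev_def)
  from has_fourier_ft[OF this] show ?thesis by (simp add: has_fourier_def)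
qed

text \<open>Treats both signs of the exponent at once, because t and hence the Sobolev orders may
  have either sign.\<close>

lemma powr_bounds:
  fixes x R a :: real
  assumes "1 \<le> x" "x \<le> R"
  shows "min 1 (R powr a) \<le> x powr a" and "x powr a \<le> max 1 (R powr a)"
proof -
  have "min 1 (R powr a) \<le> x powr a \<and> x powr a \<le> max 1 (R powr a)"
  proof (cases "a \<ge> 0")
    case True
    then have "1 \<le> x powr a" "x powr a \<le> R powr a"
      using assms by (auto intro: ge_one_powr_ge_zero powr_mono2)
    then show ?thesis by linarith
  next
    case False
    then have "x powr a \<le> 1" "R powr a \<le> x powr a"
      using assms powr_mono2'[of a 1 x] powr_mono2'[of a x R] by auto
    then show ?thesis by linarith
  qed
  then show "min 1 (R powr a) \<le> x powr a" "x powr a \<le> max 1 (R powr a)" by auto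
qed

lemma integrable_indicator_bounded:
  assumes "B \<in> sets borel" "bounded (B :: 'a::euclidean_space set)"
  shows "integrable lborel (indicator B :: 'a \<Rightarrow> real)"
  using assms emeasure_bounded_finite by (intro integrable_real_indicator) auto

text \<open>On a bounded set the Sobolev weight stays above a positive constant, so the order no
  longer matters.\<close>

lemma sobolev_ft_square_integrable:
  fixes T :: "'a::euclidean_space distr"
  assumes T: "T \<in> sobolev s" and B: "B \<in> sets borel" "bounded B"
  shows "integrable lborel (\<lambda>\<xi>. indicator B \<xi> * (cmod (ft T \<xi>))\<^sup>2)"
proof -
  note [measurable] = sobolev_ft_measurable[OF T] B(1)
  obtain R where R: "R > 0" "\<And>\<xi>. \<xi> \<in> B \<Longrightarrow> norm \<xi> \<le> R" using B(2) bounded_pos by blast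
  define c where "c = min 1 ((1 + R\<^sup>2) powr (s / 2))"
  have c: "c > 0" using add_pos_nonneg[of 1 "R\<^sup>2"] by (simp add: c_def)
  have "integrable lborel (\<lambda>\<xi>. ((1 + (norm \<xi>)\<^sup>2) powr (s / 2) * cmod (ft T \<xi>))\<^sup>2)"
    using T by (simp add: sobolev_def)
  then have "integrable lborel (\<lambda>\<xi>. inverse (c\<^sup>2) * ((1 + (norm \<xi>)\<^sup>2) powr (s / 2) * cmod (ft T \<xi>))\<^sup>2)"
    by (rule integrable_mult_right)
  then show ?thesis
  proof (rule Bochner_Integration.integrable_bound)
    have "indicator B \<xi> * (cmod (ft T \<xi>))\<^sup>2 \<le>
        inverse (c\<^sup>2) * ((1 + (norm \<xi>)\<^sup>2) powr (s / 2) * cmod (ft T \<xi>))\<^sup>2" for \<xi>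
    proof (cases "\<xi> \<in> B")
      case True
      have "(norm \<xi>)\<^sup>2 \<le> R\<^sup>2" using R(2)[OF True] by (intro power_mono) auto
      then have "c \<le> (1 + (norm \<xi>)\<^sup>2) powr (s / 2)"
        unfolding c_def by (intro powr_bounds) auto
      then have "(c * cmod (ft T \<xi>))\<^sup>2 \<le> ((1 + (norm \<xi>)\<^sup>2) powr (s / 2) * cmod (ft T \<xi>))\<^sup>2"
        using c by (intro power_mono mult_right_mono) auto
      then show ?thesis using True c by (simp add: power_mult_distrib field_simps)
    qed simp
    then show "AE \<xi> in lborel. norm (indicator B \<xi> * (cmod (ft T \<xi>))\<^sup>2 :: real)
        \<le> norm (inverse (c\<^sup>2) * ((1 + (norm \<xi>)\<^sup>2) powr (s / 2) * cmod (ft T \<xi>))\<^sup>2)"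
      by (intro AE_I2) simp
  qed measurable
qed

text \<open>With a bounded transform of bounded support, the distribution lies in the Sobolev space
  of every order; wavelets are the intended case.\<close>

lemma sobolevI:
  fixes T :: "(real^'d::finite) distr"
  assumes T: "tempered T" "has_fourier T g" and B: "bounded B" "\<And>\<xi>. \<xi> \<notin> B \<Longrightarrow> g \<xi> = 0"
    and C: "\<And>\<xi>. cmod (g \<xi>) \<le> C"
  shows "T \<in> sobolev s"
proof -
  have gm[measurable]: "g \<in> borel_measurable borel" "ft T \<in> borel_measurable borel"
    using T(2) has_fourier_ft[OF T(2)] by (auto simp: has_fourier_def)
  obtain R where R: "R > 0" "\<And>\<xi>. \<xi> \<in> B \<Longrightarrow> norm \<xi> \<le> R" using B(1) bounded_pos by blast
  define c where "c = max 1 ((1 + R\<^sup>2) powr (s / 2))"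
  have C0: "C \<ge> 0" using C[of 0] norm_ge_zero order_trans by blast
  have "integrable lborel (\<lambda>\<xi>. ((1 + (norm \<xi>)\<^sup>2) powr (s / 2) * cmod (ft T \<xi>))\<^sup>2)"
  proof (rule Bochner_Integration.integrable_bound)
    show "integrable lborel (\<lambda>\<xi>. (c * C)\<^sup>2 * indicator (cball (0::real^'d) R) \<xi> :: real)"
      by (intro integrable_mult_right integrable_indicator_bounded) auto
    have le: "((1 + (norm \<xi>)\<^sup>2) powr (s / 2) * cmod (g \<xi>))\<^sup>2 \<le> (c * C)\<^sup>2 * indicator (cball 0 R) \<xi>" for \<xi>
    proof (cases "\<xi> \<in> B")
      case True
      have "(norm \<xi>)\<^sup>2 \<le> R\<^sup>2" using R(2)[OF True] by (intro power_mono) auto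
      then have "(1 + (norm \<xi>)\<^sup>2) powr (s / 2) \<le> c"
        unfolding c_def by (intro powr_bounds) auto
      then have "((1 + (norm \<xi>)\<^sup>2) powr (s / 2) * cmod (g \<xi>))\<^sup>2 \<le> (c * C)\<^sup>2"
        using C C0 by (intro power_mono mult_mono) (auto simp: c_def)
      then show ?thesis using R(2)[OF True] by simp
    qed (simp add: B(2))
    show "AE \<xi> in lborel. norm (((1 + (norm \<xi>)\<^sup>2) powr (s / 2) * cmod (ft T \<xi>))\<^sup>2)
        \<le> norm ((c * C)\<^sup>2 * indicator (cball (0::real^'d) R) \<xi> :: real)"
      using ft_eq_AE[OF T(2)]
    proof eventually_elim
      case (elim \<xi>)
      show ?case unfolding elim using le[of \<xi>] by simp
    qed
  qed measurable
  then show ?thesis using T by (auto simp: sobolev_def)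
qed

text \<open>\<open>vec_wavelet\<close> has zero components, and their chosen transform is known to
  vanish only almost everywhere.\<close>

lemma zero_distr_sobolev: "(\<lambda>_. 0 :: complex) \<in> (sobolev s :: (real^'d::finite) distr set)"
  and ft_zero_distr: "AE \<xi>::real^'d::finite in lborel. ft (\<lambda>_. 0) \<xi> = 0"
proof -
  have 0: "has_fourier (\<lambda>_::(real^'d::finite \<Rightarrow> complex). 0) (\<lambda>_. 0)" by (simp add: has_fourier_def)
  have "tempered (\<lambda>_::(real^'d::finite \<Rightarrow> complex). 0)"
    unfolding tempered_def by (auto intro!: exI[of _ 0])
  from sobolevI[OF this 0, of "{}" 0] show "(\<lambda>_::(real^'d::finite \<Rightarrow> complex). 0) \<in> sobolev s" by simp
  show "AE \<xi> in lborel. ft (\<lambda>_::(real^'d::finite \<Rightarrow> complex). 0) \<xi> = 0"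
    using ft_eq_AE[OF 0] .
qed

lemma inv_fourier_sobolev:
  fixes g :: "real^'d::finite \<Rightarrow> complex"
  assumes g: "g \<in> borel_measurable borel" and B: "bounded B" "\<And>\<xi>. \<xi> \<notin> B \<Longrightarrow> g \<xi> = 0"
    and C: "\<And>\<xi>. cmod (g \<xi>) \<le> C"
  shows "distr_of_fun (inv_fourier g) \<in> sobolev s"
    and "AE \<xi> in lborel. ft (distr_of_fun (inv_fourier g)) \<xi> = g \<xi>"
proof -
  note [measurable] = g
  obtain R where R: "R > 0" "\<And>\<xi>. \<xi> \<in> B \<Longrightarrow> norm \<xi> \<le> R" using B(1) bounded_pos by blast
  have gi: "integrable lborel g"
  proof (rule Bochner_Integration.integrable_bound)
    show "integrable lborel (\<lambda>\<xi>. C * indicator (cball (0::real^'d) R) \<xi> :: real)"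
      by (intro integrable_mult_right integrable_indicator_bounded) auto
    show "AE \<xi> in lborel. norm (g \<xi>) \<le> norm (C * indicator (cball (0::real^'d) R) \<xi> :: real)"
    proof (intro AE_I2)
      fix \<xi>
      show "norm (g \<xi>) \<le> norm (C * indicator (cball (0::real^'d) R) \<xi> :: real)"
        using C[of \<xi>] B(2)[of \<xi>] R(2)[of \<xi>] by (cases "\<xi> \<in> B") (auto simp: indicator_def)
    qed
  qed measurable
  have "tempered (distr_of_fun (inv_fourier g))"
    by (rule tempered_distr_of_fun[OF inv_fourier_measurable[OF g] norm_inv_fourier_le])
  then show "distr_of_fun (inv_fourier g) \<in> sobolev s"
    by (rule sobolevI[OF _ has_fourier_inv_fourier[OF gi] B C])
  show "AE \<xi> in lborel. ft (distr_of_fun (inv_fourier g)) \<xi> = g \<xi>"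
    by (rule ft_eq_AE[OF has_fourier_inv_fourier[OF gi]])
qed

section \<open>Parseval's identity for orthonormal families\<close>

definition sq_int :: "('a::euclidean_space \<Rightarrow> complex) \<Rightarrow> bool" where
  "sq_int f \<longleftrightarrow> f \<in> borel_measurable borel \<and> integrable lborel (\<lambda>x. (cmod (f x))\<^sup>2)"

definition ip :: "('a::euclidean_space \<Rightarrow> complex) \<Rightarrow> ('a \<Rightarrow> complex) \<Rightarrow> complex" where
  "ip f g = (LINT x|lborel. f x * cnj (g x))"

lemma sq_int_measurable [measurable_dest]: "sq_int f \<Longrightarrow> f \<in> borel_measurable borel"
  by (simp add: sq_int_def)

lemma borel_measurable_cnj [measurable (raw)]:
  "f \<in> borel_measurable M \<Longrightarrow> (\<lambda>x. cnj (f x)) \<in> borel_measurable M"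
  by (rule borel_measurable_continuous_on[where f = cnj]) (auto intro: continuous_intros)

lemma sq_int_mult_integrable:
  assumes "sq_int f" "sq_int g" shows "integrable lborel (\<lambda>x. f x * cnj (g x))"
proof (rule Bochner_Integration.integrable_bound)
  show "integrable lborel (\<lambda>x. (cmod (f x))\<^sup>2 + (cmod (g x))\<^sup>2)"
    using assms by (simp add: sq_int_def)
  show "(\<lambda>x. f x * cnj (g x)) \<in> borel_measurable lborel"
    using assms by measurable
  have "cmod (f x) * cmod (g x) \<le> (cmod (f x))\<^sup>2 + (cmod (g x))\<^sup>2" for x
  proof -
    have "2 * (cmod (f x) * cmod (g x)) \<le> (cmod (f x))\<^sup>2 + (cmod (g x))\<^sup>2"
      using sum_squares_bound[of "cmod (f x)" "cmod (g x)"] by (simp only: mult.assoc)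
    moreover have "0 \<le> cmod (f x) * cmod (g x)" by simp
    ultimately show ?thesis by linarith
  qed
  then show "AE x in lborel. norm (f x * cnj (g x)) \<le> norm ((cmod (f x))\<^sup>2 + (cmod (g x))\<^sup>2)"
    by (intro AE_I2) (simp add: norm_mult)
qed

lemma norm_add_sq_le: "(cmod (a + b))\<^sup>2 \<le> 2 * (cmod a)\<^sup>2 + 2 * (cmod b)\<^sup>2"
proof -
  have "(cmod (a + b))\<^sup>2 \<le> (cmod a + cmod b)\<^sup>2" by (intro power_mono norm_triangle_ineq) auto
  also have "\<dots> \<le> 2 * (cmod a)\<^sup>2 + 2 * (cmod b)\<^sup>2"
    using sum_squares_bound[of "cmod a" "cmod b"] by (simp add: power2_sum)
  finally show ?thesis .
qed

lemma sq_int_add: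
  assumes "sq_int f" "sq_int g" shows "sq_int (\<lambda>x. f x + g x)"
  unfolding sq_int_def
proof
  show m: "(\<lambda>x. f x + g x) \<in> borel_measurable borel" using assms by measurable
  show "integrable lborel (\<lambda>x. (cmod (f x + g x))\<^sup>2)"
  proof (rule Bochner_Integration.integrable_bound)
    show "integrable lborel (\<lambda>x. 2 * (cmod (f x))\<^sup>2 + 2 * (cmod (g x))\<^sup>2)"
      using assms by (simp add: sq_int_def)
    show "AE x in lborel. norm ((cmod (f x + g x))\<^sup>2) \<le> norm (2 * (cmod (f x))\<^sup>2 + 2 * (cmod (g x))\<^sup>2)"
      using norm_add_sq_le by (intro AE_I2) simp
  qed (use m in measurable)
qed

lemma integral_norm_add_sq_le:
  assumes pq: "sq_int p" "sq_int q"
  shows "(LINT x|lborel. (cmod (p x + q x))\<^sup>2) \<le>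
    2 * (LINT x|lborel. (cmod (p x))\<^sup>2) + 2 * (LINT x|lborel. (cmod (q x))\<^sup>2)"
proof -
  have "(LINT x|lborel. (cmod (p x + q x))\<^sup>2) \<le> (LINT x|lborel. 2 * (cmod (p x))\<^sup>2 + 2 * (cmod (q x))\<^sup>2)"
    using pq sq_int_add[OF pq] by (intro integral_mono norm_add_sq_le) (auto simp: sq_int_def)
  also have "\<dots> = 2 * (LINT x|lborel. (cmod (p x))\<^sup>2) + 2 * (LINT x|lborel. (cmod (q x))\<^sup>2)"
    using pq by (simp add: sq_int_def)
  finally show ?thesis .
qed

lemma sq_int_cmult: "sq_int f \<Longrightarrow> sq_int (\<lambda>x. c * f x)"
  unfolding sq_int_def by (auto simp: norm_mult power_mult_distrib)

lemma sq_int_diff: "sq_int f \<Longrightarrow> sq_int g \<Longrightarrow> sq_int (\<lambda>x. f x - g x)"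
  using sq_int_add[OF _ sq_int_cmult[of g "-1"]] by simp

lemma sq_int_0: "sq_int (\<lambda>_. 0)"
  by (simp add: sq_int_def)

lemma sq_int_sum: "(\<And>i. i \<in> A \<Longrightarrow> sq_int (f i)) \<Longrightarrow> sq_int (\<lambda>x. \<Sum>i\<in>A. f i x)"
  by (induction A rule: infinite_finite_induct) (auto intro: sq_int_0 sq_int_add)

lemma sq_int_mult_bounded:
  assumes f: "sq_int f" and w: "w \<in> borel_measurable borel" "\<And>x. cmod (w x) \<le> C"
  shows "sq_int (\<lambda>x. f x * w x)"
  unfolding sq_int_def
proof
  note [measurable] = sq_int_measurable[OF f] w(1)
  show m: "(\<lambda>x. f x * w x) \<in> borel_measurable borel" by measurable
  show "integrable lborel (\<lambda>x. (cmod (f x * w x))\<^sup>2)"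
  proof (rule Bochner_Integration.integrable_bound)
    show "integrable lborel (\<lambda>x. (cmod (f x))\<^sup>2 * C\<^sup>2)"
      using f by (simp add: sq_int_def)
    show "AE x in lborel. norm ((cmod (f x * w x))\<^sup>2) \<le> norm ((cmod (f x))\<^sup>2 * C\<^sup>2)"
      using w(2) by (intro AE_I2) (auto simp: norm_mult power_mult_distrib intro!: mult_left_mono power_mono)
  qed measurable
qed

lemma sq_int_cnj: "sq_int f \<Longrightarrow> sq_int (\<lambda>x. cnj (f x))"
  by (auto simp: sq_int_def intro: borel_measurable_cnj)

lemma ip_add_left: "sq_int f \<Longrightarrow> sq_int g \<Longrightarrow> sq_int h \<Longrightarrow> ip (\<lambda>x. f x + g x) h = ip f h + ip g h"
  using sq_int_mult_integrable[of f h] sq_int_mult_integrable[of g h] by (simp add: ip_def distrib_right)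

lemma ip_cmult_left: "ip (\<lambda>x. c * f x) g = c * ip f g"
  by (simp add: ip_def mult.assoc)

lemma ip_cnj: "cnj (ip f g) = ip g f"
proof -
  have "cnj (ip f g) = (LINT x|lborel. cnj (f x * cnj (g x)))"
    unfolding ip_def by (rule Bochner_Integration.integral_cnj[symmetric])
  then show ?thesis by (simp add: ip_def mult.commute)
qed

lemma ip_diff_left: "sq_int f \<Longrightarrow> sq_int g \<Longrightarrow> sq_int h \<Longrightarrow> ip (\<lambda>x. f x - g x) h = ip f h - ip g h"
  using ip_add_left[of f "\<lambda>x. -1 * g x" h] sq_int_cmult[of g "-1"] ip_cmult_left[of "-1" g h] by simp

lemma ip_sum_left:
  assumes "\<And>i. i \<in> A \<Longrightarrow> sq_int (f i)" "sq_int h"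
  shows "ip (\<lambda>x. \<Sum>i\<in>A. f i x) h = (\<Sum>i\<in>A. ip (f i) h)"
  using assms
  by (induction A rule: infinite_finite_induct) (auto simp: ip_add_left sq_int_sum ip_def[of "\<lambda>_. 0"])

lemma ip_self: "ip f f = complex_of_real (LINT x|lborel. (cmod (f x))\<^sup>2)"
  by (simp add: ip_def complex_norm_square[symmetric] flip: integral_complex_of_real)

definition orthonormal :: "('k \<Rightarrow> 'a::euclidean_space \<Rightarrow> complex) \<Rightarrow> bool" where
  "orthonormal u \<longleftrightarrow> (\<forall>k. sq_int (u k)) \<and> (\<forall>k l. ip (u k) (u l) = (if k = l then 1 else 0))"

definition l2_span :: "('k \<Rightarrow> 'a::euclidean_space \<Rightarrow> complex) \<Rightarrow> ('a \<Rightarrow> complex) \<Rightarrow> bool" where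
  "l2_span u f \<longleftrightarrow> sq_int f \<and>
     (\<forall>e>0. \<exists>F c. finite F \<and> (LINT x|lborel. (cmod (f x - (\<Sum>k\<in>F. c k * u k x)))\<^sup>2) < e)"

text \<open>Pythagoras after completing the square: the error splits into the part fixed by
  \<open>F\<close> and the deviation of \<open>c\<close> from the true coefficients.\<close>

lemma orthonormal_distance:
  assumes u: "orthonormal u" and f: "sq_int f" and F: "finite F"
  shows "(LINT x|lborel. (cmod (f x - (\<Sum>k\<in>F. c k * u k x)))\<^sup>2) =
    (LINT x|lborel. (cmod (f x))\<^sup>2) - (\<Sum>k\<in>F. (cmod (ip f (u k)))\<^sup>2) + (\<Sum>k\<in>F. (cmod (ip f (u k) - c k))\<^sup>2)"
proof -
  define S where "S x = (\<Sum>k\<in>F. c k * u k x)" for x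
  have us: "sq_int (u k)" for k using u by (simp add: orthonormal_def)
  have S: "sq_int S" unfolding S_def by (intro sq_int_sum sq_int_cmult us)
  have Sg: "ip S g = (\<Sum>k\<in>F. c k * ip (u k) g)" if "sq_int g" for g
    unfolding S_def by (subst ip_sum_left) (auto intro: sq_int_cmult us that simp: ip_cmult_left)
  have Su: "ip S (u k) = c k" if "k \<in> F" for k
    using u that F by (simp add: Sg[OF us] orthonormal_def if_distrib[of "\<lambda>x. _ * x"] cong: if_cong)
  have SS: "ip S S = (\<Sum>k\<in>F. c k * cnj (c k))"
    unfolding Sg[OF S] by (intro sum.cong refl) (metis Su ip_cnj)
  have Sf: "ip S f = (\<Sum>k\<in>F. c k * cnj (ip f (u k)))"
    unfolding Sg[OF f] ip_cnj ..
  have fS: "ip f S = (\<Sum>k\<in>F. ip f (u k) * cnj (c k))"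
    unfolding ip_cnj[of S f, symmetric] Sf by (simp add: mult.commute)
  have "ip (\<lambda>x. f x - S x) (\<lambda>x. f x - S x) = ip f (\<lambda>x. f x - S x) - ip S (\<lambda>x. f x - S x)"
    by (intro ip_diff_left f S sq_int_diff)
  also have "ip f (\<lambda>x. f x - S x) = cnj (ip f f - ip S f)"
    unfolding ip_cnj[of "\<lambda>x. f x - S x" f, symmetric] by (subst ip_diff_left) (auto intro: f S)
  also have "ip S (\<lambda>x. f x - S x) = cnj (ip f S - ip S S)"
    unfolding ip_cnj[of "\<lambda>x. f x - S x" S, symmetric] by (subst ip_diff_left) (auto intro: f S)
  finally have "ip (\<lambda>x. f x - S x) (\<lambda>x. f x - S x) = ip f f - ip f S - ip S f + ip S S"
    by (simp add: ip_cnj)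
  also have "\<dots> = ip f f - (\<Sum>k\<in>F. ip f (u k) * cnj (ip f (u k))) +
      (\<Sum>k\<in>F. (ip f (u k) - c k) * cnj (ip f (u k) - c k))"
    unfolding SS Sf fS by (simp add: algebra_simps sum.distrib sum_subtractf sum_negf)
  finally have "complex_of_real (LINT x|lborel. (cmod (f x - S x))\<^sup>2) = complex_of_real
    ((LINT x|lborel. (cmod (f x))\<^sup>2) - (\<Sum>k\<in>F. (cmod (ip f (u k)))\<^sup>2) + (\<Sum>k\<in>F. (cmod (ip f (u k) - c k))\<^sup>2))"
    by (simp add: ip_self complex_norm_square[symmetric] del: of_real_power complex_cnj_diff)
  then show ?thesis unfolding S_def of_real_eq_iff .
qed

text \<open>Taking the true coefficients in \<open>orthonormal_distance\<close> gives Bessel's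
  inequality as upper bound; a good approximation on \<open>F\<close> gives the lower bound, which
  persists for every larger finite set.\<close>

theorem parseval_norm:
  assumes u: "orthonormal u" and f: "l2_span u f"
  shows "((\<lambda>k. (cmod (ip f (u k)))\<^sup>2) has_sum (LINT x|lborel. (cmod (f x))\<^sup>2)) UNIV"
  unfolding has_sum_def tendsto_iff eventually_finite_subsets_at_top
proof (intro allI impI)
  let ?N = "LINT x|lborel. (cmod (f x))\<^sup>2"
  let ?a = "\<lambda>k. (cmod (ip f (u k)))\<^sup>2"
  have fs: "sq_int f" using f by (simp add: l2_span_def)
  fix e :: real assume "e > 0"
  then obtain F c where F: "finite F" "(LINT x|lborel. (cmod (f x - (\<Sum>k\<in>F. c k * u k x)))\<^sup>2) < e"
    using f unfolding l2_span_def by blast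
  have "?N - (\<Sum>k\<in>F. ?a k) + (\<Sum>k\<in>F. (cmod (ip f (u k) - c k))\<^sup>2) < e"
    using F(2) unfolding orthonormal_distance[OF u fs F(1)] .
  moreover have "(\<Sum>k\<in>F. (cmod (ip f (u k) - c k))\<^sup>2) \<ge> 0" by (intro sum_nonneg) auto
  ultimately have lt: "?N - (\<Sum>k\<in>F. ?a k) < e" by linarith
  have "dist (sum ?a Y) ?N < e" if Y: "finite Y" "F \<subseteq> Y" for Y
  proof -
    have "0 \<le> (LINT x|lborel. (cmod (f x - (\<Sum>k\<in>Y. ip f (u k) * u k x)))\<^sup>2)"
      by (intro Bochner_Integration.integral_nonneg) auto
    then have "sum ?a Y \<le> ?N" unfolding orthonormal_distance[OF u fs Y(1)] by simp
    moreover have "sum ?a F \<le> sum ?a Y" by (intro sum_mono2 Y) auto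
    ultimately show ?thesis using lt by (simp add: dist_real_def)
  qed
  then show "\<exists>X. finite X \<and> X \<subseteq> UNIV \<and> (\<forall>Y. finite Y \<and> X \<subseteq> Y \<and> Y \<subseteq> UNIV \<longrightarrow> dist (sum ?a Y) ?N < e)"
    using F(1) by blast
qed

lemma l2_span_add:
  assumes u: "orthonormal u" and fg: "l2_span u f" "l2_span u g"
  shows "l2_span u (\<lambda>x. f x + g x)"
  unfolding l2_span_def
proof (intro conjI allI impI)
  have us: "sq_int (u k)" for k using u by (simp add: orthonormal_def)
  have fs: "sq_int f" "sq_int g" using fg by (auto simp: l2_span_def)
  then show "sq_int (\<lambda>x. f x + g x)" by (rule sq_int_add)
  fix e :: real assume "e > 0"
  then have "e / 4 > 0" by simp
  then obtain F c G d where F: "finite F" "(LINT x|lborel. (cmod (f x - (\<Sum>k\<in>F. c k * u k x)))\<^sup>2) < e / 4"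
    and G: "finite G" "(LINT x|lborel. (cmod (g x - (\<Sum>k\<in>G. d k * u k x)))\<^sup>2) < e / 4"
    using fg unfolding l2_span_def by blast
  define b where "b k = (if k \<in> F then c k else 0) + (if k \<in> G then d k else 0)" for k
  define p q where "p x = f x - (\<Sum>k\<in>F. c k * u k x)" and "q x = g x - (\<Sum>k\<in>G. d k * u k x)" for x
  have pq: "sq_int p" "sq_int q"
    unfolding p_def q_def by (intro sq_int_diff fs sq_int_sum sq_int_cmult us)+
  have eq: "f x + g x - (\<Sum>k\<in>F \<union> G. b k * u k x) = p x + q x" for x
  proof -
    have "(\<Sum>k\<in>F. c k * u k x) = (\<Sum>k\<in>F \<union> G. (if k \<in> F then c k else 0) * u k x)"
      using F(1) G(1) by (intro sum.mono_neutral_cong_left) auto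
    moreover have "(\<Sum>k\<in>G. d k * u k x) = (\<Sum>k\<in>F \<union> G. (if k \<in> G then d k else 0) * u k x)"
      using F(1) G(1) by (intro sum.mono_neutral_cong_left) auto
    ultimately show ?thesis by (simp add: p_def q_def b_def distrib_right sum.distrib)
  qed
  have "(LINT x|lborel. (cmod (p x + q x))\<^sup>2) \<le>
      2 * (LINT x|lborel. (cmod (p x))\<^sup>2) + 2 * (LINT x|lborel. (cmod (q x))\<^sup>2)"
    by (rule integral_norm_add_sq_le[OF pq])
  also have "\<dots> < e" using F(2) G(2) by (simp add: p_def q_def)
  finally show "\<exists>F c. finite F \<and> (LINT x|lborel. (cmod (f x + g x - (\<Sum>k\<in>F. c k * u k x)))\<^sup>2) < e"
    using F(1) G(1) by (intro exI[of _ "F \<union> G"] exI[of _ b]) (simp add: eq)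
qed

lemma l2_span_cmult:
  assumes f: "l2_span u f" shows "l2_span u (\<lambda>x. a * f x)"
  unfolding l2_span_def
proof (intro conjI allI impI)
  show "sq_int (\<lambda>x. a * f x)" using f by (auto simp: l2_span_def intro: sq_int_cmult)
  fix e :: real assume "e > 0"
  then have "e / (1 + (cmod a)\<^sup>2) > 0" by (simp add: add_pos_nonneg)
  then obtain F c where F: "finite F" "(LINT x|lborel. (cmod (f x - (\<Sum>k\<in>F. c k * u k x)))\<^sup>2) < e / (1 +
      (cmod a)\<^sup>2)"
    using f unfolding l2_span_def by blast
  have "a * f x - (\<Sum>k\<in>F. (a * c k) * u k x) = a * (f x - (\<Sum>k\<in>F. c k * u k x))" for x
    by (simp add: sum_distrib_left right_diff_distrib mult.assoc)
  then have "(LINT x|lborel. (cmod (a * f x - (\<Sum>k\<in>F. (a * c k) * u k x)))\<^sup>2) =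
    (cmod a)\<^sup>2 * (LINT x|lborel. (cmod (f x - (\<Sum>k\<in>F. c k * u k x)))\<^sup>2)"
    by (simp add: norm_mult power_mult_distrib)
  also have "\<dots> \<le> (cmod a)\<^sup>2 * (e / (1 + (cmod a)\<^sup>2))"
    using F(2) by (intro mult_left_mono) auto
  also have "\<dots> < e"
    using \<open>e > 0\<close> by (simp add: field_simps add_pos_nonneg)
  finally show "\<exists>F c. finite F \<and> (LINT x|lborel. (cmod (a * f x - (\<Sum>k\<in>F. c k * u k x)))\<^sup>2) < e"
    using F(1) by (intro exI[of _ F] exI[of _ "\<lambda>k. a * c k"]) simp
qed

text \<open>Polarisation: the norm version is applied to f + a g with a = 1, -1, i, -i.\<close>

theorem parseval:
  assumes u: "orthonormal u" and fg: "l2_span u f" "l2_span u g"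
  shows "((\<lambda>k. ip f (u k) * cnj (ip g (u k))) has_sum ip f g) UNIV"
proof -
  have us: "sq_int (u k)" for k using u by (simp add: orthonormal_def)
  have fs: "sq_int f" "sq_int g" using fg by (auto simp: l2_span_def)
  define h where "h a x = f x + a * g x" for a x
  have hs: "l2_span u (h a)" for a
    unfolding h_def by (intro l2_span_add[OF u] fg l2_span_cmult)
  have H: "((\<lambda>k. complex_of_real ((cmod (ip (h a) (u k)))\<^sup>2)) has_sum ip (h a) (h a)) UNIV" for a
    unfolding ip_self by (intro has_sum_of_real parseval_norm[OF u hs])
  have hu: "ip (h a) (u k) = ip f (u k) + a * ip g (u k)" for a k
    unfolding h_def using fs us by (simp add: ip_add_left sq_int_cmult ip_cmult_left)
  have hh: "ip (h a) (h a) = ip f f + a * ip g f + cnj a * ip f g + a * cnj a * ip g g" for a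
  proof -
    have hsq: "sq_int (h a)" using hs by (simp add: l2_span_def)
    have "ip (h a) (h a) = ip f (h a) + a * ip g (h a)"
      unfolding h_def[of a] using hsq[unfolded h_def] fs by (simp add: ip_add_left sq_int_cmult ip_cmult_left)
    moreover have "ip (h a) f = ip f f + a * ip g f" "ip (h a) g = ip f g + a * ip g g"
      unfolding h_def[of a] using fs by (simp_all add: ip_add_left sq_int_cmult ip_cmult_left)
    then have "ip f (h a) = ip f f + cnj a * ip f g" "ip g (h a) = ip g f + cnj a * ip g g"
      by (metis complex_cnj_add complex_cnj_mult ip_cnj)+
    ultimately show ?thesis by (simp add: algebra_simps)
  qed
  have pol: "z * cnj w = 1/4 * (complex_of_real ((cmod (z + 1 * w))\<^sup>2) + -1 * complex_of_real ((cmod (z +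
      (-1) * w))\<^sup>2)
     + (\<i> * complex_of_real ((cmod (z + \<i> * w))\<^sup>2) + - \<i> * complex_of_real ((cmod (z + (- \<i>) * w))\<^sup>2)))" for z w
    unfolding complex_norm_square by (simp add: algebra_simps)
  have "((\<lambda>k. ip f (u k) * cnj (ip g (u k))) has_sum
      1/4 * (ip (h 1) (h 1) + -1 * ip (h (-1)) (h (-1)) + (\<i> * ip (h \<i>) (h \<i>) + - \<i> *
          ip (h (- \<i>)) (h (- \<i>))))) UNIV"
    unfolding pol hu[symmetric] by (intro has_sum_cmult_right has_sum_add H)
  then show ?thesis unfolding hh by (simp add: algebra_simps)
qed

lemma l2_span_member:
  assumes u: "orthonormal u" shows "l2_span u (u k)"
  unfolding l2_span_def
proof (intro conjI allI impI)
  show "sq_int (u k)" using u by (simp add: orthonormal_def)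
  show "\<exists>F c. finite F \<and> (LINT x|lborel. (cmod (u k x - (\<Sum>k\<in>F. c k * u k x)))\<^sup>2) < e" if "e > 0" for e :: real
    using that by (intro exI[of _ "{k}"] exI[of _ "\<lambda>_. 1"]) simp
qed

lemma l2_span_0: "l2_span u (\<lambda>_. 0)"
  unfolding l2_span_def by (auto simp: sq_int_0 intro!: exI[of _ "{}"])

lemma l2_span_sum:
  assumes "orthonormal u" "\<And>i. i \<in> A \<Longrightarrow> l2_span u (f i)"
  shows "l2_span u (\<lambda>x. \<Sum>i\<in>A. f i x)"
  using assms(2)
  by (induction A rule: infinite_finite_induct) (auto intro: l2_span_0 l2_span_add[OF assms(1)])

text \<open>An approximation of an approximation; the quarters of \<open>e\<close> compensate the
  factors 2 in the square of a sum.\<close>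

lemma l2_span_closed:
  assumes u: "orthonormal u" and f: "sq_int f"
    and approx: "\<And>e. e > 0 \<Longrightarrow> \<exists>g. l2_span u g \<and> (LINT x|lborel. (cmod (f x - g x))\<^sup>2) < e"
  shows "l2_span u f"
  unfolding l2_span_def
proof (intro conjI allI impI f)
  have us: "sq_int (u k)" for k using u by (simp add: orthonormal_def)
  fix e :: real assume "e > 0"
  then have e4: "e / 4 > 0" by simp
  obtain g where g: "l2_span u g" "(LINT x|lborel. (cmod (f x - g x))\<^sup>2) < e / 4"
    using approx[OF e4] by blast
  obtain F c where F: "finite F" "(LINT x|lborel. (cmod (g x - (\<Sum>k\<in>F. c k * u k x)))\<^sup>2) < e / 4"
    using g(1) e4 unfolding l2_span_def by blast
  define p q where "p x = f x - g x" and "q x = g x - (\<Sum>k\<in>F. c k * u k x)" for x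
  have gs: "sq_int g" using g(1) by (simp add: l2_span_def)
  have pq: "sq_int p" "sq_int q"
    unfolding p_def q_def by (intro sq_int_diff f gs sq_int_sum sq_int_cmult us)+
  have "(LINT x|lborel. (cmod (p x + q x))\<^sup>2) \<le>
      2 * (LINT x|lborel. (cmod (p x))\<^sup>2) + 2 * (LINT x|lborel. (cmod (q x))\<^sup>2)"
    by (rule integral_norm_add_sq_le[OF pq])
  also have "\<dots> < e" using F(2) g(2) by (simp add: p_def q_def)
  finally show "\<exists>F c. finite F \<and> (LINT x|lborel. (cmod (f x - (\<Sum>k\<in>F. c k * u k x)))\<^sup>2) < e"
    using F(1) by (intro exI[of _ F] exI[of _ c]) (simp add: p_def q_def)
qed

lemma sq_int_AE_bound:
  assumes f: "f \<in> borel_measurable borel" and W: "integrable lborel (\<lambda>x. (W x)\<^sup>2 :: real)"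
    and le: "AE x in lborel. cmod (f x) \<le> W x"
  shows "sq_int f"
  unfolding sq_int_def
proof (intro conjI f)
  show "integrable lborel (\<lambda>x. (cmod (f x))\<^sup>2)"
    by (rule Bochner_Integration.integrable_bound[OF W]) (use f le in \<open>auto elim!: eventually_mono intro:
        power_mono\<close>)
qed

text \<open>With square-integrable \<open>W\<close>, the squared differences are dominated by 4 W^2,
  so almost-everywhere convergence becomes convergence in square mean.\<close>

lemma l2_span_dominated:
  fixes f :: "'a::euclidean_space \<Rightarrow> complex"
  assumes u: "orthonormal u" and g: "\<And>n. l2_span u (g n)" and f: "f \<in> borel_measurable borel"
    and lim: "AE x in lborel. (\<lambda>n. g n x) \<longlonglongrightarrow> f x"
    and W: "integrable lborel (\<lambda>x. (W x)\<^sup>2 :: real)" "\<And>n. AE x in lborel. cmod (g n x) \<le> W x"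
  shows "l2_span u f"
proof (rule l2_span_closed[OF u])
  have gm[measurable]: "g n \<in> borel_measurable borel" for n
    using g[of n] by (simp add: l2_span_def sq_int_def)
  note f[measurable]
  have W': "AE x in lborel. \<forall>n. cmod (g n x) \<le> W x" using W(2) by (simp add: AE_all_countable)
  have fW: "AE x in lborel. cmod (f x) \<le> W x"
    using lim W'
  proof eventually_elim
    case (elim x)
    then show ?case using LIMSEQ_le_const2[OF tendsto_norm[OF elim(1)]] by blast
  qed
  show fs: "sq_int f" by (rule sq_int_AE_bound[OF f W(1) fW])
  have "(\<lambda>n. LINT x|lborel. (cmod (f x - g n x))\<^sup>2) \<longlonglongrightarrow> (LINT x::'a|lborel. 0)"
  proof (rule integral_dominated_convergence[where w = "\<lambda>x. 4 * (W x)\<^sup>2"])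
    show "AE x in lborel. (\<lambda>n. (cmod (f x - g n x))\<^sup>2) \<longlonglongrightarrow> 0"
      using lim
    proof eventually_elim
      case (elim x)
      have "(\<lambda>n. (cmod (f x - g n x))\<^sup>2) \<longlonglongrightarrow> (cmod (f x - f x))\<^sup>2"
        by (intro tendsto_intros elim)
      then show ?case by simp
    qed
    show "AE x in lborel. norm ((cmod (f x - g n x))\<^sup>2) \<le> 4 * (W x)\<^sup>2" for n
      using fW W'
    proof eventually_elim
      case (elim x)
      have "cmod (f x - g n x) \<le> 2 * W x"
        using norm_triangle_ineq4[of "f x" "g n x"] elim(1) elim(2)[rule_format, of n] by linarith
      then have "(cmod (f x - g n x))\<^sup>2 \<le> (2 * W x)\<^sup>2" by (intro power_mono) auto
      then show ?case by (simp add: power_mult_distrib)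
    qed
  qed (use W(1) in auto)
  then have "\<forall>\<^sub>F n in sequentially. (LINT x|lborel. (cmod (f x - g n x))\<^sup>2) < e" if "e > 0" for e
    using that by (auto dest: order_tendstoD(2))
  then show "\<exists>h. l2_span u h \<and> (LINT x|lborel. (cmod (f x - h x))\<^sup>2) < e" if "e > 0" for e
    using that g eventually_happens'[OF sequentially_bot] by blast
qed

section \<open>The Shannon wavelets of one level\<close>

lemma integral_cis_Icc:
  assumes "p \<le> q" "t \<noteq> 0"
  shows "integrable lborel (\<lambda>x::real. indicator {p..q} x *\<^sub>R cis (t * x))"
    and "(LINT x|lborel. indicator {p..q} x *\<^sub>R cis (t * x)) =
        (cis (t * q) - cis (t * p)) / (\<i> * complex_of_real t)"
proof -
  have "has_bochner_integral lborel (\<lambda>x. indicator {p..q} x *\<^sub>R cis (t * x))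
      (cis (t * q) / (\<i> * complex_of_real t) - cis (t * p) / (\<i> * complex_of_real t))"
  proof (rule has_bochner_integral_FTC_Icc[OF assms(1)])
    show "((\<lambda>x. cis (t * x) / (\<i> * complex_of_real t)) has_vector_derivative cis (t * x)) (at x within {p..q})"
        for x
      unfolding has_vector_derivative_def using assms(2)
      by (auto intro!: derivative_eq_intros simp: scaleR_conv_of_real field_simps)
    show "continuous_on {p..q} (\<lambda>x. cis (t * x))" by (intro continuous_intros)
  qed
  then show "integrable lborel (\<lambda>x::real. indicator {p..q} x *\<^sub>R cis (t * x))"
    and "(LINT x|lborel. indicator {p..q} x *\<^sub>R cis (t * x)) =
        (cis (t * q) - cis (t * p)) / (\<i> * complex_of_real t)"
    by (auto simp: has_bochner_integral_iff diff_divide_distrib)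
qed

lemma pm_interval_iff: "0 \<le> a \<Longrightarrow> x \<in> pm_interval a b \<longleftrightarrow> a \<le> \<bar>x\<bar> \<and> \<bar>x\<bar> \<le> b"
  by (auto simp: pm_interval_def abs_if)

lemma pm_interval_measurable [measurable]: "pm_interval a b \<in> sets borel"
  by (simp add: pm_interval_def)

text \<open>For a = 0 the two halves share the point 0, so the identity can hold only almost
  everywhere.\<close>

lemma indicator_pm_interval_AE:
  assumes "0 \<le> a" "a \<le> b"
  shows "AE x in lborel. indicator (pm_interval a b) x = (indicator {-b..-a} x + indicator {a..b} x :: real)"
proof -
  have "AE x in lborel. x \<noteq> (0::real)" by (rule AE_lborel_singleton)
  then show ?thesis
    by eventually_elim (use assms in \<open>auto simp: pm_interval_def indicator_def\<close>)
qed

lemma cis_minus_int_pi: "cis (- (of_int n * pi)) = cis (of_int n * pi)"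
  by (simp add: complex_eq_iff sin_times_pi_eq_0)

text \<open>At the four endpoints the phase is an integer multiple of pi, so the exponential agrees
  at opposite endpoints and the boundary terms of the two halves cancel. For m = 0 the total length
  remains.\<close>

lemma integral_cis_pm_interval:
  fixes m :: int and e :: nat
  assumes c: "c > 0"
  shows "(LINT x|lborel. indicator (pm_interval (real e * c * pi) ((real e + 1) * c *
      pi)) x *\<^sub>R cis (of_int m / c * x)) =
    (if m = 0 then complex_of_real (2 * pi * c) else 0)"
proof -
  let ?a = "real e * c * pi" and ?b = "(real e + 1) * c * pi" and ?t = "of_int m / c"
  have ab: "0 \<le> ?a" "?a \<le> ?b" "- ?b \<le> - ?a" using c by (simp_all add: algebra_simps)
  have "(LINT x|lborel. indicator (pm_interval ?a ?b) x *\<^sub>R cis (?t * x)) =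
      (LINT x|lborel. indicator {-?b..-?a} x *\<^sub>R cis (?t * x) + indicator {?a..?b} x *\<^sub>R cis (?t * x))"
  proof (rule integral_cong_AE)
    show "AE x in lborel. indicator (pm_interval ?a ?b) x *\<^sub>R cis (?t * x) =
      indicator {-?b..-?a} x *\<^sub>R cis (?t * x) + indicator {?a..?b} x *\<^sub>R cis (?t * x)"
      using indicator_pm_interval_AE[OF ab(1,2)] by eventually_elim (simp add: scaleR_add_left)
  qed measurable
  also have "\<dots> = (if m = 0 then complex_of_real (2 * pi * c) else 0)"
  proof (cases "m = 0")
    case True
    have "(LINT x|lborel. indicator {-?b..-?a} x *\<^sub>R (1::complex) + indicator {?a..?b} x *\<^sub>R 1) =
      complex_of_real ((LINT x|lborel. indicator {-?b..-?a} x) + (LINT x|lborel. indicator {?a..?b} x))"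
      unfolding scaleR_conv_of_real mult_1_right
      by (subst Bochner_Integration.integral_add)
        (auto intro!: integrable_of_real integrable_indicator_bounded)
    also have "\<dots> = complex_of_real (2 * pi * c)"
      using ab by (simp add: algebra_simps)
    finally show ?thesis using True by simp
  next
    case False
    then have t: "?t \<noteq> 0" using c by simp
    have "?t * ?a = of_int (m * int e) * pi" "?t * ?b = of_int (m * (int e + 1)) * pi"
      using c by (simp_all add: field_simps)
    then have "cis (?t * - ?a) = cis (?t * ?a)" "cis (?t * - ?b) = cis (?t * ?b)"
      using cis_minus_int_pi by (metis mult_minus_right)+
    then show ?thesis
      by (subst Bochner_Integration.integral_add)
        (simp_all only: integral_cis_Icc[OF ab(2) t] integral_cis_Icc[OF ab(3) t] False
          add_divide_distrib[symmetric] if_False, simp)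
  qed
  finally show ?thesis .
qed

text \<open>The formula that dilation and translation predict for the transform of a one-variable
  wavelet; \<open>wavelet_factor\<close> confirms it.\<close>

definition hat1 :: "nat \<Rightarrow> int \<Rightarrow> int \<Rightarrow> real \<Rightarrow> complex" where
  "hat1 e j k \<eta> = complex_of_real (2 powr (- real_of_int j / 2)) *
     ((if e = 0 then shannon_phi_hat else shannon_psi_hat) (2 powi (-j) * \<eta>) * cis (- (2 powi (-j) * of_int k *
         \<eta>)))"

fun wav_hat :: "'d::finite windex \<Rightarrow> real^'d \<Rightarrow> complex" where
  "wav_hat (j, \<epsilon>, k) \<xi> = (\<Prod>i\<in>UNIV. hat1 (\<epsilon> $ i) j (k $ i) (\<xi> $ i))"

lemma shannon_hat_measurable [measurable]:
  "shannon_phi_hat \<in> borel_measurable borel" "shannon_psi_hat \<in> borel_measurable borel"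
  unfolding shannon_phi_hat_def shannon_psi_hat_def by measurable

declare wav_hat.simps [simp del]

lemma hat1_measurable [measurable]: "hat1 e j k \<in> borel_measurable borel"
  unfolding hat1_def by (cases "e = 0") simp_all

lemma wav_hat_measurable [measurable]: "wav_hat \<mu> \<in> borel_measurable borel"
proof -
  obtain j \<epsilon> k where "\<mu> = (j, \<epsilon>, k)" by (cases \<mu>)
  moreover have "(\<lambda>\<xi>. wav_hat (j, \<epsilon>, k) \<xi>) \<in> borel_measurable borel"
    unfolding wav_hat.simps by measurable
  ultimately show ?thesis by simp
qed

definition lvl_box :: "int \<Rightarrow> nat \<Rightarrow> real set" where
  "lvl_box j e = pm_interval (real e * 2 powi j * pi) ((real e + 1) * 2 powi j * pi)"

lemma lvl_box_measurable [measurable]: "lvl_box j e \<in> sets borel"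
  by (simp add: lvl_box_def)

lemma lvl_box_iff:
  "x \<in> lvl_box j e \<longleftrightarrow> real e * pi \<le> \<bar>2 powi (-j) * x\<bar> \<and> \<bar>2 powi (-j) * x\<bar> \<le> (real e + 1) * pi"
proof -
  have 2: "(2::real) powi j > 0" by simp
  have "x \<in> lvl_box j e \<longleftrightarrow> real e * 2 powi j * pi \<le> \<bar>x\<bar> \<and> \<bar>x\<bar> \<le> (real e + 1) * 2 powi j * pi"
    unfolding lvl_box_def by (intro pm_interval_iff) simp
  also have "\<dots> \<longleftrightarrow> real e * pi \<le> \<bar>x\<bar> / 2 powi j \<and> \<bar>x\<bar> / 2 powi j \<le> (real e + 1) * pi"
    using 2 by (simp add: pos_le_divide_eq pos_divide_le_eq mult_ac)
  finally show ?thesis by (simp add: abs_mult power_int_minus divide_inverse mult.commute)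
qed

lemma frequency_box_lvl_box: "frequency_box j \<epsilon> = {\<xi>. \<forall>i. \<xi> $ i \<in> lvl_box j (\<epsilon> $ i)}"
  by (simp add: frequency_box_def lvl_box_def)

lemma cmod_hat1:
  assumes "e \<in> {0, 1}"
  shows "cmod (hat1 e j k x) = 2 powr (- real_of_int j / 2) * indicator (lvl_box j e) x"
proof -
  define y where "y = 2 powi (-j) * x"
  have "cmod ((if e = 0 then shannon_phi_hat else shannon_psi_hat) y) = indicator {y. real e * pi \<le> \<bar>y\<bar> \<and> \<bar>y\<bar> \<le>
      (real e + 1) * pi} y"
    using assms by (auto simp: shannon_phi_hat_def shannon_psi_hat_def norm_mult indicator_def abs_le_iff)
  then show ?thesis
    by (simp add: hat1_def norm_mult y_def[symmetric] lvl_box_iff indicator_def)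
qed

lemma hat1_mult_cis: "hat1 e j k x = hat1 e j 0 x * cis (2 powi (-j) * (of_int (-k) * x))"
  by (simp add: hat1_def mult_ac)

text \<open>Translation by k in space is modulation in frequency, so a level consists of a single
  function times characters.\<close>

lemma wav_hat_chr: "wav_hat (j, \<epsilon>, k) \<xi> = wav_hat (j, \<epsilon>, 0) \<xi> * chr (2 powi (-j)) (-k) \<xi>"
proof -
  have "chr (2 powi (-j)) (-k) \<xi> = (\<Prod>i\<in>UNIV. cis (2 powi (-j) * (of_int (-(k $ i)) * \<xi> $ i)))"
    by (simp add: chr_def sum_distrib_left flip: cis_sum)
  then show ?thesis
    unfolding wav_hat.simps by (subst hat1_mult_cis) (simp add: prod.distrib)
qed

lemma indicator_frequency_box:
  "indicator (frequency_box j \<epsilon>) \<xi> = (\<Prod>i\<in>UNIV. indicator (lvl_box j (\<epsilon> $ i)) (\<xi> $ i) :: real)"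
  by (auto simp: frequency_box_lvl_box indicator_def prod.neutral_const simp flip: of_bool_def)

lemma wavelet_typesD: "\<epsilon> \<in> wavelet_types \<Longrightarrow> \<epsilon> $ i \<in> {0, 1}"
  by (simp add: wavelet_types_def)

text \<open>All phases have modulus 1. The constant nonzero modulus on the box is what later permits
  division by \<open>wav_hat\<close>.\<close>

lemma cmod_wav_hat:
  assumes "\<epsilon> \<in> wavelet_types"
  shows "cmod (wav_hat (j, \<epsilon>, k) (\<xi> :: real^'d::finite)) =
      (2 powr (- real_of_int j / 2)) ^ CARD('d) * indicator (frequency_box j \<epsilon>) \<xi>"
  using cmod_hat1[OF wavelet_typesD[OF assms]]
  by (simp add: wav_hat.simps prod_norm[symmetric] indicator_frequency_box prod.distrib)

lemma frequency_box_measurable [measurable]: "frequency_box j (\<epsilon> :: nat^'d::finite) \<in> sets borel"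
  unfolding frequency_box_lvl_box by measurable

lemma frequency_box_bounded: "bounded (frequency_box j (\<epsilon> :: nat^'d::finite))"
proof -
  have "norm \<xi> \<le> (\<Sum>i\<in>UNIV. (real (\<epsilon> $ i) + 1) * 2 powi j * pi)" if "\<xi> \<in> frequency_box j \<epsilon>" for \<xi>
  proof -
    have "\<bar>\<xi> $ i\<bar> \<le> (real (\<epsilon> $ i) + 1) * 2 powi j * pi" for i
    proof -
      have "0 \<le> real (\<epsilon> $ i) * 2 powi j * pi" by simp
      then show ?thesis
        using that by (simp add: frequency_box_def pm_interval_iff)
    qed
    then show ?thesis using norm_le_l1_cart[of \<xi>] sum_mono[of UNIV "\<lambda>i. \<bar>\<xi> $ i\<bar>"] by (meson order_trans)
  qed
  then show ?thesis by (auto simp: bounded_iff)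
qed

lemma wav_hat_eq_0: "\<epsilon> \<in> wavelet_types \<Longrightarrow> \<xi> \<notin> frequency_box j \<epsilon> \<Longrightarrow> wav_hat (j, \<epsilon>, k) \<xi> = 0"
  using cmod_wav_hat[of \<epsilon> j k \<xi>] by simp

lemma sq_int_bounded_support:
  assumes f: "f \<in> borel_measurable borel" and B: "B \<in> sets borel" "bounded B" "\<And>x. x \<notin> B \<Longrightarrow> f x = 0"
    and C: "\<And>x. cmod (f x) \<le> C"
  shows "sq_int f"
proof (rule sq_int_AE_bound[OF f])
  have "(\<lambda>x. (C * indicator B x)\<^sup>2) = (\<lambda>x. C\<^sup>2 * indicator B x)"
    by (auto simp: indicator_def fun_eq_iff)
  then show "integrable lborel (\<lambda>x. (C * indicator B x)\<^sup>2)"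
    using integrable_indicator_bounded[OF B(1,2)] by simp
  show "AE x in lborel. cmod (f x) \<le> C * indicator B x"
    using C B(3) by (intro AE_I2) (auto simp: indicator_def)
qed

lemma sq_int_wav_hat: "\<epsilon> \<in> wavelet_types \<Longrightarrow> sq_int (wav_hat (j, \<epsilon>, k))"
  by (rule sq_int_bounded_support[OF wav_hat_measurable frequency_box_measurable frequency_box_bounded
      wav_hat_eq_0,
        where C = "(2 powr (- real_of_int j / 2)) ^ CARD('a)"])
    (auto simp: cmod_wav_hat indicator_def)

lemma powr_minus_sq: "(2 powr (- real_of_int j / 2))\<^sup>2 = 2 powi (-j)"
  using powr_real_of_int'[of 2 "-j"] by (simp add: power2_eq_square powr_add[symmetric])

lemma hat1_mult_cnj:
  assumes "e \<in> {0, 1}"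
  shows "hat1 e j k x * cnj (hat1 e j l x) =
    complex_of_real (2 powi (-j)) * (indicator (lvl_box j e) x *\<^sub>R cis (of_int (l - k) / 2 powi j * x))"
proof -
  have "hat1 e j k x * cnj (hat1 e j l x) = (hat1 e j 0 x * cnj (hat1 e j 0 x)) *
      (cis (2 powi (-j) * (of_int (-k) * x)) * cnj (cis (2 powi (-j) * (of_int (-l) * x))))"
    by (subst (1 2) hat1_mult_cis) (simp add: mult_ac)
  also have "hat1 e j 0 x * cnj (hat1 e j 0 x) = complex_of_real (2 powi (-j) * indicator (lvl_box j e) x)"
    unfolding complex_norm_square[symmetric] cmod_hat1[OF assms] power_mult_distrib powr_minus_sq
    by (simp add: indicator_def)
  also have "cis (2 powi (-j) * (of_int (-k) * x)) * cnj (cis (2 powi (-j) * (of_int (-l) * x))) =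
      cis (of_int (l - k) / 2 powi j * x)"
    by (simp add: cis_cnj cis_mult power_int_minus divide_inverse algebra_simps)
  finally show ?thesis by (simp add: scaleR_conv_of_real)
qed

text \<open>The integral factorises over coordinates; in each one the weight 2^(-j) cancels against
  the length 2 * pi * 2^j of the interval pair.\<close>

lemma ip_wav_hat:
  fixes \<epsilon> :: "nat^'d::finite"
  assumes \<epsilon>: "\<epsilon> \<in> wavelet_types"
  shows "ip (wav_hat (j, \<epsilon>, k)) (wav_hat (j, \<epsilon>, l)) = (if k = l then complex_of_real ((2 * pi) ^ CARD('d)) else 0)"
proof -
  define F where "F i x = hat1 (\<epsilon> $ i) j (k $ i) x * cnj (hat1 (\<epsilon> $ i) j (l $ i) x)" for i x
  have e: "\<epsilon> $ i \<in> {0, 1}" for i using wavelet_typesD[OF \<epsilon>] .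
  have F: "integrable lborel (F i)" for i
  proof -
    have b: "bounded (lvl_box j (\<epsilon> $ i))"
      by (simp add: lvl_box_def pm_interval_def)
    have "integrable lborel (\<lambda>x. complex_of_real (indicator (lvl_box j (\<epsilon> $ i)) x))"
      using b by (intro integrable_of_real integrable_indicator_bounded) auto
    then show ?thesis
      unfolding F_def hat1_mult_cnj[OF e] scaleR_conv_of_real
      by (intro integrable_mult_right integrable_times_cis) auto
  qed
  have "ip (wav_hat (j, \<epsilon>, k)) (wav_hat (j, \<epsilon>, l)) = (LINT \<xi>|lborel. (\<Prod>i\<in>UNIV. F i (\<xi> $ i)))"
    by (simp add: ip_def F_def prod.distrib wav_hat.simps)
  also have "\<dots> = (\<Prod>i\<in>UNIV. LINT x|lborel. F i x)" by (rule lborel_prod_integral_vec(2)[OF F])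
  also have "\<dots> = (\<Prod>i\<in>UNIV. if k $ i = l $ i then complex_of_real (2 * pi) else 0)"
    unfolding F_def hat1_mult_cnj[OF e] lvl_box_def integral_mult_right_zero
    by (subst integral_cis_pm_interval) (auto simp: power_int_minus intro!: prod.cong)
  also have "\<dots> = (if k = l then complex_of_real ((2 * pi) ^ CARD('d)) else 0)"
    by (auto simp: vec_eq_iff)
  finally show ?thesis .
qed

section \<open>Orthonormality and completeness of the wavelets of one level on their box\<close>

definition wav_unit :: "int \<Rightarrow> nat^'d::finite \<Rightarrow> int^'d \<Rightarrow> real^'d \<Rightarrow> complex" where
  "wav_unit j \<epsilon> k \<xi> = complex_of_real (1 / sqrt ((2 * pi) ^ CARD('d))) * wav_hat (j, \<epsilon>, k) \<xi>"

lemma ip_cmult_right: "ip f (\<lambda>x. c * g x) = cnj c * ip f g"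
  by (metis complex_cnj_cnj complex_cnj_mult ip_cmult_left ip_cnj)

lemma orthonormal_wav_unit:
  fixes \<epsilon> :: "nat^'d::finite"
  assumes \<epsilon>: "\<epsilon> \<in> wavelet_types" shows "orthonormal (wav_unit j \<epsilon>)"
  unfolding orthonormal_def
proof (intro conjI allI)
  define \<kappa> where "\<kappa> = 1 / sqrt ((2 * pi) ^ CARD('d))"
  have u: "wav_unit j \<epsilon> k = (\<lambda>\<xi>. complex_of_real \<kappa> * wav_hat (j, \<epsilon>, k) \<xi>)" for k
    by (simp add: wav_unit_def \<kappa>_def fun_eq_iff)
  have \<kappa>: "\<kappa> * (\<kappa> * (2 * pi) ^ CARD('d)) = 1"
    by (simp add: \<kappa>_def real_div_sqrt)
  show "sq_int (wav_unit j \<epsilon> k)" for k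
    unfolding u by (intro sq_int_cmult sq_int_wav_hat \<epsilon>)
  show "ip (wav_unit j \<epsilon> k) (wav_unit j \<epsilon> l) = (if k = l then 1 else 0)" for k l
  proof -
    have "ip (wav_unit j \<epsilon> k) (wav_unit j \<epsilon> l) = (if k =
        l then complex_of_real (\<kappa> * (\<kappa> * (2 * pi) ^ CARD('d))) else 0)"
      unfolding u ip_cmult_left ip_cmult_right ip_wav_hat[OF \<epsilon>] by simp
    then show ?thesis unfolding \<kappa> by simp
  qed
qed

text \<open>The strict inequalities remove boundary points, where distinct points of the box can
  have the same torus image.\<close>

definition open_box :: "int \<Rightarrow> nat^'d::finite \<Rightarrow> (real^'d) set" where
  "open_box j \<epsilon> = {\<xi>. \<forall>i. real (\<epsilon> $ i) * pi < \<bar>2 powi (-j) * \<xi> $ i\<bar> \<and>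
      \<bar>2 powi (-j) * \<xi> $ i\<bar> < (real (\<epsilon> $ i) + 1) * pi}"

lemma open_box_subset: "open_box j \<epsilon> \<subseteq> frequency_box j \<epsilon>"
  by (auto simp: open_box_def frequency_box_lvl_box lvl_box_iff less_imp_le)

lemma open_box_measurable [measurable]: "open_box j (\<epsilon> :: nat^'d::finite) \<in> sets borel"
  unfolding open_box_def by measurable

lemma AE_coordinate_neq: "AE \<xi> in lborel. (\<xi> :: real^'d::finite) $ i \<noteq> c"
proof -
  have "negligible {\<xi> :: real^'d. \<xi> \<bullet> axis i 1 = c}"
    by (intro negligible_standard_hyperplane) (auto simp: Basis_vec_def)
  then have n: "{\<xi> :: real^'d. \<xi> $ i = c} \<in> null_sets lebesgue"
    by (simp add: negligible_iff_null_sets inner_axis)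
  moreover have "{\<xi> :: real^'d. \<xi> $ i = c} \<in> sets borel" by measurable
  ultimately have "{\<xi> :: real^'d. \<xi> $ i = c} \<in> null_sets lborel"
    by (simp add: null_sets_def emeasure_completion)
  from AE_not_in[OF this] show ?thesis by simp
qed

lemma open_box_AE: "AE \<xi> in lborel. \<xi> \<in> frequency_box j (\<epsilon> :: nat^'d::finite) \<longrightarrow> \<xi> \<in> open_box j \<epsilon>"
proof -
  define c where "c e = e * pi * 2 powi j" for e :: real
  have "AE \<xi>::real^'d in lborel. \<forall>i. \<xi> $ i \<noteq> c (real (\<epsilon> $ i)) \<and> \<xi> $ i \<noteq> - c (real (\<epsilon> $ i))
      \<and> \<xi> $ i \<noteq> c (real (\<epsilon> $ i) + 1) \<and> \<xi> $ i \<noteq> - c (real (\<epsilon> $ i) + 1)"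
    by (simp add: AE_all_countable AE_coordinate_neq)
  then show ?thesis
  proof eventually_elim
    case (elim \<xi>)
    have "\<bar>2 powi (-j) * \<xi> $ i\<bar> \<noteq> real (\<epsilon> $ i) * pi" "\<bar>2 powi (-j) * \<xi> $ i\<bar> \<noteq> (real (\<epsilon> $ i) + 1) * pi" for i
    proof -
      have *: "x = c e \<or> x = - c e" if "\<bar>2 powi (-j) * x\<bar> = e * pi" for x e
      proof -
        have "\<bar>x\<bar> = c e" using that by (simp add: c_def abs_mult power_int_minus field_simps)
        then show ?thesis by (auto simp: abs_if split: if_splits)
      qed
      show "\<bar>2 powi (-j) * \<xi> $ i\<bar> \<noteq> real (\<epsilon> $ i) * pi" "\<bar>2 powi (-j) * \<xi> $ i\<bar> \<noteq> (real (\<epsilon> $ i) + 1) * pi"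
        using elim * by blast+
    qed
    then show ?case
      unfolding frequency_box_lvl_box open_box_def lvl_box_iff mem_Collect_eq
          by (metis order.not_eq_order_implies_strict)
  qed
qed

text \<open>Rescaled coordinates x, y with equal image differ by 2 * pi * n. With equal signs the
  difference is below pi in modulus; with opposite signs it is |x| + |y|, which puts |n| strictly
  between the consecutive integers e and e + 1. Only n = 0 survives.\<close>

lemma torus_map_inj_on_open_box: "inj_on (torus_map (2 powi (-j))) (open_box j (\<epsilon> :: nat^'d::finite))"
proof (rule inj_onI)
  fix \<xi> \<eta> :: "real^'d" assume \<xi>: "\<xi> \<in> open_box j \<epsilon>" and \<eta>: "\<eta> \<in> open_box j \<epsilon>"
    and eq: "torus_map (2 powi (-j)) \<xi> = torus_map (2 powi (-j)) \<eta>"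
  have "\<xi> $ i = \<eta> $ i" for i
  proof -
    define x y where "x = 2 powi (-j) * \<xi> $ i" and "y = 2 powi (-j) * \<eta> $ i"
    define e where "e = int (\<epsilon> $ i)"
    obtain n :: int where n: "x - y = 2 * pi * n" using torus_map_eq_imp[OF eq] unfolding x_def y_def by metis
    have xb: "of_int e * pi < \<bar>x\<bar>" "\<bar>x\<bar> < (of_int e + 1) * pi"
        and yb: "of_int e * pi < \<bar>y\<bar>" "\<bar>y\<bar> < (of_int e + 1) * pi"
      using \<xi> \<eta> by (auto simp: open_box_def x_def y_def e_def)
    have "n = 0"
    proof (cases "x \<ge> 0 \<longleftrightarrow> y \<ge> 0")
      case True
      then have "\<bar>x - y\<bar> = \<bar>\<bar>x\<bar> - \<bar>y\<bar>\<bar>" by auto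
      also have "\<dots> < pi" using xb yb by (auto simp: algebra_simps)
      finally have "2 * (pi * \<bar>of_int n\<bar>) < pi * 1" unfolding n by (simp add: abs_mult)
      then have "2 * \<bar>of_int n\<bar> < (1::real)" by (simp add: mult.left_commute[of 2])
      then show "n = 0" by linarith
    next
      case False
      then have "\<bar>x - y\<bar> = \<bar>x\<bar> + \<bar>y\<bar>" by auto
      then have "2 * of_int e * pi < 2 * \<bar>of_int n\<bar> * pi" "2 * \<bar>of_int n\<bar> * pi < 2 * (of_int e + 1) * pi"
        using xb yb unfolding n by (auto simp: abs_mult algebra_simps)
      then have "of_int e < \<bar>of_int n :: real\<bar>" "\<bar>of_int n :: real\<bar> < of_int e + 1" by auto
      then have "e < \<bar>n\<bar> \<and> \<bar>n\<bar> < e + 1" by linarith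
      then show "n = 0" by linarith
    qed
    then show ?thesis using n by (simp add: x_def y_def)
  qed
  then show "\<xi> = \<eta>" by (simp add: vec_eq_iff)
qed

lemma compact_inner_approx:
  assumes A: "A \<in> sets borel" "bounded (A :: 'a::euclidean_space set)" and e: "e > 0"
  obtains K where "compact K" "K \<subseteq> A" "measure lborel (A - K) < e"
proof -
  have "A \<in> sets lebesgue" using A(1) by auto
  from sets_lebesgue_inner_closed[OF this e] obtain K where K: "closed K" "K \<subseteq> A" "A - K \<in> lmeasurable"
    "emeasure lebesgue (A - K) < ennreal e" by metis
  have "A - K \<in> sets borel" using A(1) borel_closed[OF K(1)] by (rule sets.Diff)
  then have "emeasure lborel (A - K) < ennreal e" using K(4) by (simp add: emeasure_completion)
  then have "measure lborel (A - K) < e"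
    by (metis emeasure_eq_ennreal_measure ennreal_less_iff measure_nonneg order.strict_trans
        top.not_eq_extremum ennreal_less_top)
  moreover have "compact K" using K A(2) bounded_subset compact_eq_bounded_closed by blast
  ultimately show ?thesis using that K(2) by blast
qed

context
  fixes j :: int and \<epsilon> :: "nat^'d::finite" and C0 :: real
  assumes \<epsilon>: "\<epsilon> \<in> wavelet_types"
    and C0_def: "C0 = (2 powr (- real_of_int j / 2)) ^ CARD('d)"
begin

private abbreviation "w0 \<equiv> wav_hat (j, \<epsilon>, 0)"

private lemma w0_bound: "cmod (w0 \<xi>) \<le> C0 * indicator (frequency_box j \<epsilon>) \<xi>"
  by (simp add: cmod_wav_hat[OF \<epsilon>] C0_def)

private lemma w0_bound': "cmod (w0 \<xi>) \<le> C0"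
  using w0_bound[of \<xi>] by (cases "\<xi> \<in> frequency_box j \<epsilon>") (auto simp: C0_def)

private lemmas on = orthonormal_wav_unit[OF \<epsilon>, of j]

private lemma span_trig:
  assumes "trig_poly (2 powi (-j)) p" shows "l2_span (wav_unit j \<epsilon>) (\<lambda>\<xi>. p \<xi> * w0 \<xi>)"
  using assms
proof induction
  case (chr c k)
  let ?q = "sqrt ((2 * pi) ^ CARD('d))"
  have "c * chr (2 powi (-j)) k \<xi> * w0 \<xi> = (c * complex_of_real ?q) * wav_unit j \<epsilon> (-k) \<xi>" for \<xi>
    using wav_hat_chr[of j \<epsilon> "-k" \<xi>] by (simp add: wav_unit_def)
  then show ?case using l2_span_cmult[OF l2_span_member[OF on]] by presburger
next
  case (add p q)
  then show ?case using l2_span_add[OF on] by (simp add: distrib_right)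
qed

text \<open>Trigonometric polynomials converge boundedly to the indicator of the periodised
  \<open>K\<close>, which on the open box is the indicator of \<open>K\<close> by injectivity;
  elsewhere \<open>w0\<close> vanishes or the points are negligible.\<close>

private lemma span_compact:
  assumes K: "compact K" "K \<subseteq> open_box j \<epsilon>" shows "l2_span (wav_unit j \<epsilon>) (\<lambda>\<xi>. indicator K \<xi> * w0 \<xi>)"
proof (cases "K = {}")
  case True then show ?thesis by (simp add: l2_span_0)
next
  case False
  let ?s = "2 powi (-j) :: real"
  obtain p where p: "\<And>n::nat. trig_poly ?s (p n)" "\<And>n \<xi>. cmod (p n \<xi>) \<le> 2"
    "\<And>\<xi>. (\<lambda>n. p n \<xi>) \<longlonglongrightarrow> indicator {\<xi>. torus_map ?s \<xi> \<in> torus_map ?s ` K} \<xi>"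
    using trig_poly_approx_indicator[OF K(1) False] by metis
  have [measurable]: "K \<in> sets borel" using K(1) by (simp add: borel_compact)
  show ?thesis
  proof (rule l2_span_dominated[OF on span_trig[OF p(1)], where W = "\<lambda>\<xi>. 2 * cmod (w0 \<xi>)"])
    show "AE \<xi> in lborel. (\<lambda>n. p n \<xi> * w0 \<xi>) \<longlonglongrightarrow> indicator K \<xi> * w0 \<xi>"
      using open_box_AE[of j \<epsilon>]
    proof eventually_elim
      case (elim \<xi>)
      show ?case
      proof (cases "\<xi> \<in> frequency_box j \<epsilon>")
        case True
        then have \<xi>: "\<xi> \<in> open_box j \<epsilon>" using elim by simp
        have "torus_map ?s \<xi> \<in> torus_map ?s ` K \<longleftrightarrow> \<xi> \<in> K"
          using inj_on_image_mem_iff[OF torus_map_inj_on_open_box \<xi> K(2)] .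
        then have "(\<lambda>n. p n \<xi>) \<longlonglongrightarrow> indicator K \<xi>" using p(3)[of \<xi>] by (simp add: indicator_def)
        then show ?thesis by (rule tendsto_mult[OF _ tendsto_const])
      qed (simp add: wav_hat_eq_0[OF \<epsilon>])
    qed
    show "integrable lborel (\<lambda>\<xi>. (2 * cmod (w0 \<xi>))\<^sup>2)"
      using sq_int_wav_hat[OF \<epsilon>] by (simp add: power_mult_distrib sq_int_def)
    show "AE \<xi> in lborel. cmod (p n \<xi> * w0 \<xi>) \<le> 2 * cmod (w0 \<xi>)" for n
      using p(2) by (intro AE_I2) (simp add: norm_mult mult_right_mono)
  qed measurable
qed

text \<open>Inner regularity reduces to compact sets. Only the part of \<open>A\<close> in the open
  box counts, and there the squared error is at most \<open>C0\<^sup>2\<close> times the measure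
  left over.\<close>

private lemma span_indicator:
  assumes [measurable]: "A \<in> sets borel" shows "l2_span (wav_unit j \<epsilon>) (\<lambda>\<xi>. indicator A \<xi> * w0 \<xi>)"
proof (rule l2_span_closed[OF on])
  show "sq_int (\<lambda>\<xi>. indicator A \<xi> * w0 \<xi>)"
    using sq_int_mult_bounded[OF sq_int_wav_hat[OF \<epsilon>], of "indicator A" 1 j 0]
    by (simp add: indicator_def mult.commute)
  fix e :: real assume e: "e > 0"
  let ?A = "A \<inter> open_box j \<epsilon>"
  have bA: "bounded ?A" using frequency_box_bounded[of j \<epsilon>] open_box_subset
      by (meson bounded_subset inf.coboundedI2)
  have C0: "C0 > 0" by (simp add: C0_def)
  then have "e / (C0\<^sup>2) > 0" using e by simp
  with bA obtain K where K: "compact K" "K \<subseteq> ?A" "measure lborel (?A - K) < e / C0\<^sup>2"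
    using compact_inner_approx[of ?A "e / C0\<^sup>2"] by auto
  have [measurable]: "K \<in> sets borel" using K(1) by (simp add: borel_compact)
  have "integrable lborel (indicator (?A - K) :: real^'d \<Rightarrow> real)"
    using bA by (intro integrable_indicator_bounded) (auto intro: bounded_subset)
  then have i: "integrable lborel (\<lambda>\<xi>. C0\<^sup>2 * indicator (?A - K) \<xi> :: real)" by simp
  have "(LINT \<xi>|lborel. (cmod (indicator A \<xi> * w0 \<xi> - indicator K \<xi> * w0 \<xi>))\<^sup>2) \<le>
      (LINT \<xi>|lborel. C0\<^sup>2 * indicator (?A - K) \<xi>)"
  proof (rule integral_mono_AE'[OF i])
    show "AE \<xi> in lborel. (cmod (indicator A \<xi> * w0 \<xi> - indicator K \<xi> * w0 \<xi>))\<^sup>2 \<le> C0\<^sup>2 * indicator (?A - K) \<xi>"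
      using open_box_AE[of j \<epsilon>]
    proof eventually_elim
      case (elim \<xi>)
      show ?case
      proof (cases "\<xi> \<in> frequency_box j \<epsilon>")
        case True
        have "(cmod (w0 \<xi>))\<^sup>2 \<le> C0\<^sup>2" using w0_bound' by (intro power_mono) auto
        then show ?thesis using elim True K(2) by (auto simp: indicator_def)
      qed (simp add: wav_hat_eq_0[OF \<epsilon>])
    qed
  qed auto
  also have "\<dots> = C0\<^sup>2 * measure lborel (?A - K)" by simp
  also have "\<dots> < e" using K(3) C0 by (simp add: pos_less_divide_eq mult.commute)
  finally show "\<exists>g. l2_span (wav_unit j \<epsilon>) g \<and> (LINT \<xi>|lborel. (cmod (indicator A \<xi> * w0 \<xi> - g \<xi>))\<^sup>2) < e"
    using span_compact[OF K(1)] K(2) by blast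
qed

text \<open>On the box \<open>w0\<close> has no zeros, so f = g * w0 with g measurable. Simple
  functions converge to g under the bound 2 |g|, and g * w0 is again f, which supplies the
  square-integrable majorant.\<close>

lemma wav_unit_complete_aux:
  assumes f: "sq_int f" "\<And>\<xi>. \<xi> \<notin> frequency_box j \<epsilon> \<Longrightarrow> f \<xi> = 0"
  shows "l2_span (wav_unit j \<epsilon>) f"
proof -
  have C0: "C0 > 0" by (simp add: C0_def)
  define g where "g \<xi> = f \<xi> / w0 \<xi>" for \<xi>
  have [measurable]: "f \<in> borel_measurable borel" using f(1) by (simp add: sq_int_def)
  have gm: "g \<in> borel_measurable borel" unfolding g_def by measurable
  have fg: "f \<xi> = g \<xi> * w0 \<xi>" for \<xi>
  proof (cases "\<xi> \<in> frequency_box j \<epsilon>")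
    case True
    then have "cmod (w0 \<xi>) = C0" by (simp add: cmod_wav_hat[OF \<epsilon>] C0_def)
    then have "w0 \<xi> \<noteq> 0" using C0 by auto
    then show ?thesis by (simp add: g_def)
  qed (simp add: f(2) wav_hat_eq_0[OF \<epsilon>])
  obtain S where S: "\<And>i. simple_function borel (S i)" "\<And>\<xi>. (\<lambda>i. S i \<xi>) \<longlonglongrightarrow> g \<xi>" "\<And>i \<xi>. cmod (S i \<xi>) \<le> 2 * cmod (g \<xi>)"
    using borel_measurable_implies_sequence_metric[OF gm, of 0] by (auto simp: dist_norm)
  have "l2_span (wav_unit j \<epsilon>) (\<lambda>\<xi>. g \<xi> * w0 \<xi>)"
  proof (rule l2_span_dominated[OF on, where g = "\<lambda>i \<xi>. S i \<xi> * w0 \<xi>" and W = "\<lambda>\<xi>. 2 * cmod (f \<xi>)"])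
    show "l2_span (wav_unit j \<epsilon>) (\<lambda>\<xi>. S i \<xi> * w0 \<xi>)" for i
    proof -
      have fin: "finite (range (S i))" using simple_functionD(1)[OF S(1)[of i]] by simp
      have eq: "S i \<xi> * w0 \<xi> = (\<Sum>y\<in>range (S i). y * (indicator (S i -` {y}) \<xi> * w0 \<xi>))" for \<xi>
      proof -
        have "(\<Sum>y\<in>range (S i). y * (indicator (S i -` {y}) \<xi> * w0 \<xi>)) =
          (\<Sum>y\<in>{S i \<xi>}. y * (indicator (S i -` {y}) \<xi> * w0 \<xi>))"
          using fin by (intro sum.mono_neutral_right) (auto simp: indicator_def)
        then show ?thesis by simp
      qed
      have "S i -` {y} \<in> sets borel" for y
        using simple_functionD(2)[OF S(1)[of i], of "{y}"] by simp
      then show ?thesis unfolding eq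
        by (intro l2_span_sum[OF on] l2_span_cmult span_indicator)
    qed
    show "AE \<xi> in lborel. (\<lambda>n. S n \<xi> * w0 \<xi>) \<longlonglongrightarrow> g \<xi> * w0 \<xi>"
      by (intro AE_I2 tendsto_mult S tendsto_const)
    show "integrable lborel (\<lambda>\<xi>. (2 * cmod (f \<xi>))\<^sup>2)"
      using f(1) by (simp add: power_mult_distrib sq_int_def)
    show "AE \<xi> in lborel. cmod (S n \<xi> * w0 \<xi>) \<le> 2 * cmod (f \<xi>)" for n
      unfolding fg using mult_right_mono[OF S(3)] by (intro AE_I2) (simp add: norm_mult mult.assoc)
  qed (use gm in measurable)
  then show ?thesis unfolding fg[symmetric] .
qed

end

lemmas wav_unit_complete = wav_unit_complete_aux[OF _ refl]

section \<open>Identification of the wavelets with their Fourier transforms\<close>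

lemma wavelet_dilation:
  fixes g :: "real \<Rightarrow> complex"
  shows "complex_of_real (2 powr (real_of_int j / 2)) * inv_fourier g (2 powi j * x - of_int k) =
    inv_fourier (\<lambda>\<eta>. complex_of_real (2 powr (- real_of_int j / 2)) * (g (2 powi (-j) * \<eta>) *
        cis (- (2 powi (-j) * of_int k * \<eta>)))) x"
proof -
  let ?c = "2 powi (-j) :: real"
  have c: "?c > 0" "2 powi j * ?c = 1" by (simp_all add: power_int_minus)
  have "2 powr (real_of_int j / 2) * ?c = 2 powr (real_of_int j / 2) * 2 powr (- real_of_int j)"
    using powr_real_of_int'[of 2 "-j"] by simp
  also have "\<dots> = 2 powr (- real_of_int j / 2)" by (simp flip: powr_add)
  finally have p: "2 powr (real_of_int j / 2) * ?c = 2 powr (- real_of_int j / 2)" .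
  let ?L = "LINT \<eta>|lborel. g (?c * \<eta>) * cis ((2 powi j * x - of_int k) * (?c * \<eta>))"
  have "(LINT \<xi>|lborel. g \<xi> * cis ((2 powi j * x - of_int k) * \<xi>)) = ?c *\<^sub>R ?L"
    using lborel_integral_real_affine[of ?c "\<lambda>\<xi>. g \<xi> * cis ((2 powi j * x - of_int k) * \<xi>)" 0] c(1) by simp
  moreover have "cis ((2 powi j * x - of_int k) * (?c * \<eta>)) = cis (- (?c * of_int k * \<eta>)) * cis (x * \<eta>)" for \<eta>
  proof -
    have "(2 powi j * x - of_int k) * (?c * \<eta>) = (2 powi j * ?c) * (x * \<eta>) - ?c * of_int k * \<eta>"
      by (simp add: algebra_simps)
    then show ?thesis unfolding c(2) by (simp add: cis_mult)
  qed
  ultimately have "complex_of_real (2 powr (real_of_int j / 2)) * (LINT \<xi>|lborel. g \<xi> * cis ((2 powi j *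
      x - of_int k) * \<xi>)) =
     complex_of_real (2 powr (real_of_int j / 2) * ?c) * (LINT \<eta>|lborel. g (?c * \<eta>) * cis (- (?c * of_int k *
         \<eta>)) * cis (x * \<eta>))"
    by (simp add: scaleR_conv_of_real mult.assoc)
  then have "complex_of_real (2 powr (real_of_int j / 2)) * (LINT \<xi>|lborel. g \<xi> * cis ((2 powi j *
      x - of_int k) * \<xi>)) =
     (LINT \<eta>|lborel. complex_of_real (2 powr (- real_of_int j / 2)) * (g (?c * \<eta>) * cis (- (?c * of_int k *
         \<eta>))) * cis (x * \<eta>))"
    unfolding p by (simp only: integral_mult_right_zero[symmetric] mult.assoc)
  then show ?thesis by (simp add: inv_fourier_def mult.left_commute)
qed

lemma wavelet_factor:
  "(if e = 0 then phi_jk j k x else psi_jk j k x) = inv_fourier (hat1 e j k) x"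
  unfolding phi_jk_def psi_jk_def shannon_phi_def shannon_psi_def wavelet_dilation hat1_def by simp

lemma hat1_integrable:
  assumes "e \<in> {0, 1}" shows "integrable lborel (hat1 e j k)"
proof (rule Bochner_Integration.integrable_bound)
  have "bounded (lvl_box j e)" by (simp add: lvl_box_def pm_interval_def)
  then show "integrable lborel (\<lambda>x. 2 powr (- real_of_int j / 2) * indicator (lvl_box j e) x :: real)"
    by (intro integrable_mult_right integrable_indicator_bounded) auto
  show "AE x in lborel. cmod (hat1 e j k x) \<le>
      norm (2 powr (- real_of_int j / 2) * indicator (lvl_box j e) x :: real)"
    by (simp add: cmod_hat1[OF assms])
qed measurable

text \<open>A product of one-variable inverse transforms is the d-variable one, each coordinate
  contributing one factor 1 / (2 * pi).\<close>

lemma wavelet_inv_fourier: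
  fixes \<epsilon> :: "nat^'d::finite"
  assumes \<epsilon>: "\<epsilon> \<in> wavelet_types"
  shows "wavelet (j, \<epsilon>, k) = inv_fourier (wav_hat (j, \<epsilon>, k))"
proof
  fix x :: "real^'d"
  have i: "integrable lborel (\<lambda>\<eta>. hat1 (\<epsilon> $ i) j (k $ i) \<eta> * cis (x $ i * \<eta>))" for i
    by (intro integrable_times_cis hat1_integrable wavelet_typesD[OF \<epsilon>]) measurable
  have "wavelet (j, \<epsilon>, k) x =
      (\<Prod>i\<in>UNIV. complex_of_real (1 / (2 * pi)) * (LINT \<eta>|lborel. hat1 (\<epsilon> $ i) j (k $ i) \<eta> * cis (x $ i * \<eta>)))"
    unfolding wavelet.simps wavelet_factor by (simp add: inv_fourier_def)
  also have "\<dots> =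
      complex_of_real (1 / (2 * pi) ^ CARD('d)) * (\<Prod>i\<in>UNIV. LINT \<eta>|lborel. hat1 (\<epsilon> $ i) j (k $ i) \<eta> *
          cis (x $ i * \<eta>))"
    by (simp only: prod.distrib prod_constant of_real_power[symmetric] power_one_over)
  also have "(\<Prod>i\<in>UNIV. LINT \<eta>|lborel. hat1 (\<epsilon> $ i) j (k $ i) \<eta> * cis (x $ i * \<eta>)) =
      (LINT \<xi>|lborel. (\<Prod>i\<in>UNIV. hat1 (\<epsilon> $ i) j (k $ i) (\<xi> $ i) * cis (x $ i * \<xi> $ i)))"
    by (rule lborel_prod_integral_vec(2)[OF i, symmetric])
  also have "\<dots> = (LINT \<xi>|lborel. wav_hat (j, \<epsilon>, k) \<xi> * cis (x \<bullet> \<xi>))"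
    by (simp add: wav_hat.simps prod.distrib inner_vec_def cis_sum)
  finally show "wavelet (j, \<epsilon>, k) x = inv_fourier (wav_hat (j, \<epsilon>, k)) x"
    by (simp add: inv_fourier_def)
qed

lemma wavelet_sobolev:
  fixes \<epsilon> :: "nat^'d::finite"
  assumes \<epsilon>: "\<epsilon> \<in> wavelet_types"
  shows "distr_of_fun (wavelet (j, \<epsilon>, k)) \<in> sobolev s"
    and ft_wavelet: "AE \<xi> in lborel. ft (distr_of_fun (wavelet (j, \<epsilon>, k))) \<xi> = wav_hat (j, \<epsilon>, k) \<xi>"
proof -
  have b: "cmod (wav_hat (j, \<epsilon>, k) \<xi>) \<le> (2 powr (- real_of_int j / 2)) ^ CARD('d)" for \<xi>
    by (simp add: cmod_wav_hat[OF \<epsilon>] indicator_def)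
  note * = inv_fourier_sobolev[OF wav_hat_measurable frequency_box_bounded wav_hat_eq_0[OF \<epsilon>] b]
  show "distr_of_fun (wavelet (j, \<epsilon>, k)) \<in> sobolev s"
    unfolding wavelet_inv_fourier[OF \<epsilon>] by (rule *(1))
  show "AE \<xi> in lborel. ft (distr_of_fun (wavelet (j, \<epsilon>, k))) \<xi> = wav_hat (j, \<epsilon>, k) \<xi>"
    unfolding wavelet_inv_fourier[OF \<epsilon>] by (rule *(2))
qed

lemma vec_wavelet_sobolev:
  assumes "\<epsilon> \<in> wavelet_types"
  shows "vec_wavelet (j, \<epsilon>, k) l l' \<in> sobolev s"
    and ft_vec_wavelet: "AE \<xi> in lborel. ft (vec_wavelet (j, \<epsilon>, k) l l') \<xi> = (if l' =
        l then wav_hat (j, \<epsilon>, k) \<xi> else 0)"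
  using wavelet_sobolev[OF assms] ft_wavelet[OF assms] zero_distr_sobolev ft_zero_distr
  by (auto simp: vec_wavelet_def)

section \<open>Essential disjointness of the frequency boxes\<close>

lemma powi_less_imp:
  assumes "j < j'" shows "2 * 2 powi j \<le> (2 powi j' :: real)"
proof -
  have "2 * 2 powi j = (2 powi (j + 1) :: real)" by (simp add: power_int_add)
  also have "\<dots> \<le> 2 powi j'" using assms by (intro power_int_increasing) auto
  finally show ?thesis .
qed

lemma frequency_box_abs:
  assumes "\<xi> \<in> frequency_box j \<epsilon>"
  shows "real (\<epsilon> $ i) * 2 powi j * pi \<le> \<bar>\<xi> $ i\<bar>" "\<bar>\<xi> $ i\<bar> \<le> (real (\<epsilon> $ i) + 1) * 2 powi j * pi"
  using assms by (auto simp: frequency_box_def pm_interval_iff)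

text \<open>Since \<epsilon>' is nonzero, some coordinate satisfies |\<xi>_i| >= 2^j' * pi, whereas
  the coarser box allows at most 2 * 2^j * pi <= 2^j' * pi. A common point is thus forced onto one
  of two hyperplanes.\<close>

lemma frequency_box_disjoint_less:
  fixes \<epsilon> \<epsilon>' :: "nat^'d::finite"
  assumes \<epsilon>: "\<epsilon> \<in> wavelet_types" "\<epsilon>' \<in> wavelet_types" and j: "j < j'"
  shows "AE \<xi> in lborel. \<not> (\<xi> \<in> frequency_box j \<epsilon> \<and> \<xi> \<in> frequency_box j' \<epsilon>')"
proof -
  obtain i where i: "\<epsilon>' $ i = 1" using \<epsilon>(2) by (fastforce simp: wavelet_types_def vec_eq_iff)
  have "AE \<xi>::real^'d in lborel. \<xi> $ i \<noteq> 2 powi j' * pi \<and> \<xi> $ i \<noteq> - (2 powi j' * pi)"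
    by (simp add: AE_coordinate_neq)
  then show ?thesis
  proof eventually_elim
    case (elim \<xi>)
    show ?case
    proof
      assume \<xi>: "\<xi> \<in> frequency_box j \<epsilon> \<and> \<xi> \<in> frequency_box j' \<epsilon>'"
      have "2 powi j' * pi \<le> \<bar>\<xi> $ i\<bar>" using frequency_box_abs(1)[of \<xi> j' \<epsilon>' i] \<xi> i by simp
      moreover have "\<bar>\<xi> $ i\<bar> \<le> (real (\<epsilon> $ i) + 1) * 2 powi j * pi" using frequency_box_abs(2) \<xi> by blast
      moreover have "(real (\<epsilon> $ i) + 1) * 2 powi j * pi \<le> 2 * 2 powi j * pi"
        using wavelet_typesD[OF \<epsilon>(1), of i] by auto
      moreover have "2 * 2 powi j * pi \<le> 2 powi j' * pi" using powi_less_imp[OF j] by simp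
      ultimately have "\<bar>\<xi> $ i\<bar> = 2 powi j' * pi" by linarith
      then show False using elim by (auto simp: abs_if split: if_splits)
    qed
  qed
qed

text \<open>On equal j, a coordinate in which the types differ is forced to the common endpoint
  |\<xi>_i| = 2^j * pi.\<close>

lemma frequency_box_disjoint:
  fixes \<epsilon> \<epsilon>' :: "nat^'d::finite"
  assumes \<epsilon>: "\<epsilon> \<in> wavelet_types" "\<epsilon>' \<in> wavelet_types" and ne: "(j, \<epsilon>) \<noteq> (j', \<epsilon>')"
  shows "AE \<xi> in lborel. \<not> (\<xi> \<in> frequency_box j \<epsilon> \<and> \<xi> \<in> frequency_box j' \<epsilon>')"
proof (cases j j' rule: linorder_cases)
  case less
  then show ?thesis using frequency_box_disjoint_less[OF \<epsilon>] by blast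
next
  case greater
  then show ?thesis using frequency_box_disjoint_less[OF \<epsilon>(2,1) greater] by (simp only: conj_commute)
next
  case equal
  then obtain i where i: "\<epsilon> $ i \<noteq> \<epsilon>' $ i" using ne by (auto simp: vec_eq_iff)
  have e: "\<epsilon> $ i \<in> {0, 1}" "\<epsilon>' $ i \<in> {0, 1}" using \<epsilon> wavelet_typesD by blast+
  have "AE \<xi>::real^'d in lborel. \<xi> $ i \<noteq> 2 powi j' * pi \<and> \<xi> $ i \<noteq> - (2 powi j' * pi)"
    by (simp add: AE_coordinate_neq)
  then show ?thesis
  proof eventually_elim
    case (elim \<xi>)
    show ?case
    proof
      assume \<xi>: "\<xi> \<in> frequency_box j \<epsilon> \<and> \<xi> \<in> frequency_box j' \<epsilon>'"
      have "\<bar>\<xi> $ i\<bar> = 2 powi j' * pi"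
        using frequency_box_abs[of \<xi> j \<epsilon> i] frequency_box_abs[of \<xi> j' \<epsilon>' i] \<xi> i e equal by auto
      then show False using elim by (auto simp: abs_if split: if_splits)
    qed
  qed
qed

text \<open>Wavelet coefficient read off on the Fourier side. The single factor remains after one
  square root of (2 * pi)^d from the pairing constant is spent on normalising the wavelet.\<close>

definition wcf :: "int \<Rightarrow> nat^'d::finite \<Rightarrow> int^'d \<Rightarrow> (real^'d \<Rightarrow> complex) \<Rightarrow> complex" where
  "wcf j \<epsilon> k f = complex_of_real (1 / sqrt ((2 * pi) ^ CARD('d))) * ip f (wav_unit j \<epsilon> k)"

lemma wav_hat_unit: "wav_hat (j, \<epsilon>, k) \<xi> =
    complex_of_real (sqrt ((2 * pi) ^ CARD('d))) * wav_unit j \<epsilon> k (\<xi> :: real^'d::finite)"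
  by (simp add: wav_unit_def)

lemma ip_wav_hat_wcf:
  "complex_of_real (1 / (2 * pi) ^ CARD('d)) * ip f (wav_hat (j, \<epsilon>, k)) = wcf j \<epsilon> (k :: int^'d::finite) f"
proof -
  let ?q = "sqrt ((2 * pi) ^ CARD('d))"
  have q: "1 / (2 * pi) ^ CARD('d) * ?q = 1 / ?q"
    by (simp add: field_simps)
  have "ip f (wav_hat (j, \<epsilon>, k)) = complex_of_real ?q * ip f (wav_unit j \<epsilon> k)"
    unfolding wav_hat_unit ip_cmult_right by simp
  then show ?thesis
    unfolding wcf_def q[symmetric] by (simp only: of_real_mult mult.assoc)
qed

lemma ip_cong_AE:
  assumes "f \<in> borel_measurable borel" "f' \<in> borel_measurable borel" "g \<in> borel_measurable borel"
      "g' \<in> borel_measurable borel"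
    "AE x in lborel. f x * cnj (g x) = f' x * cnj (g' x)"
  shows "ip f g = ip f' g'"
  unfolding ip_def
proof (rule integral_cong_AE)
  note [measurable] = assms(1-4)
  show "(\<lambda>x. f x * cnj (g x)) \<in> borel_measurable lborel" "(\<lambda>x. f' x * cnj (g' x)) \<in> borel_measurable lborel"
    by measurable
qed (use assms(5) in simp)

text \<open>Off the box the transformed wavelet vanishes, so any measurable stand-in
  \<open>f\<close> agreeing with \<open>ft T\<close> almost everywhere on the box yields the same
  coefficient.\<close>

lemma pairing_wavelet:
  fixes \<epsilon> :: "nat^'d::finite"
  assumes \<epsilon>: "\<epsilon> \<in> wavelet_types" and T: "T \<in> sobolev s" and f: "f \<in> borel_measurable borel"
    and eq: "AE \<xi> in lborel. \<xi> \<in> frequency_box j \<epsilon> \<longrightarrow> ft T \<xi> = f \<xi>"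
  shows "sobolev_pairing T (distr_of_fun (wavelet (j, \<epsilon>, k))) = wcf j \<epsilon> k f"
proof -
  have "ip (ft T) (ft (distr_of_fun (wavelet (j, \<epsilon>, k)))) = ip f (wav_hat (j, \<epsilon>, k))"
  proof (rule ip_cong_AE)
    show "ft T \<in> borel_measurable borel" by (rule sobolev_ft_measurable[OF T])
    show "ft (distr_of_fun (wavelet (j, \<epsilon>, k))) \<in> borel_measurable borel"
      by (rule sobolev_ft_measurable[OF wavelet_sobolev(1)[OF \<epsilon>, of j k 0]])
    show "AE x in lborel. ft T x * cnj (ft (distr_of_fun (wavelet (j, \<epsilon>, k))) x) = f x * cnj (wav_hat (j, \<epsilon>, k) x)"
      using eq ft_wavelet[OF \<epsilon>, of j k]
    proof eventually_elim
      case (elim \<xi>)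
      then show ?case by (cases "\<xi> \<in> frequency_box j \<epsilon>") (simp_all add: wav_hat_eq_0[OF \<epsilon>])
    qed
  qed (use f in measurable)
  then show ?thesis
    unfolding sobolev_pairing_def ip_wav_hat_wcf[symmetric] by (simp add: ip_def)
qed

lemma wcf_parseval:
  fixes \<epsilon> :: "nat^'d::finite"
  assumes \<epsilon>: "\<epsilon> \<in> wavelet_types"
    and f: "sq_int f" "\<And>\<xi>. \<xi> \<notin> frequency_box j \<epsilon> \<Longrightarrow> f \<xi> = 0"
  shows "((\<lambda>k. (cmod (wcf j \<epsilon> k f))\<^sup>2) has_sum (1 / (2 * pi) ^ CARD('d) * (LINT \<xi>|lborel. (cmod (f \<xi>))\<^sup>2))) UNIV"
proof -
  have "(cmod (wcf j \<epsilon> k f))\<^sup>2 = 1 / (2 * pi) ^ CARD('d) * (cmod (ip f (wav_unit j \<epsilon> k)))\<^sup>2" for k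
    by (simp add: wcf_def norm_mult norm_divide power_mult_distrib power_divide)
  then show ?thesis
    using has_sum_cmult_right[OF parseval_norm[OF orthonormal_wav_unit[OF \<epsilon>] wav_unit_complete[OF \<epsilon> f]]]
        by presburger
qed

section \<open>The operator in the wavelet basis\<close>

lemma has_sum_finite_sum:
  fixes f :: "'i \<Rightarrow> 'a \<Rightarrow> 'b::{topological_comm_monoid_add}"
  assumes "\<And>i. i \<in> I \<Longrightarrow> (f i has_sum s i) A"
  shows "((\<lambda>x. \<Sum>i\<in>I. f i x) has_sum (\<Sum>i\<in>I. s i)) A"
  using assms by (induction I rule: infinite_finite_induct) (auto intro: has_sum_add has_sum_0)

lemma has_sum_Times_finite:
  fixes f :: "'a \<times> 'i \<Rightarrow> 'b::{topological_comm_monoid_add}"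
  assumes "finite I" "\<And>i. i \<in> I \<Longrightarrow> ((\<lambda>x. f (x, i)) has_sum s i) A"
  shows "(f has_sum (\<Sum>i\<in>I. s i)) (A \<times> I)"
  using assms
proof (induction I)
  case (insert i I)
  have "((\<lambda>x. f (x, i)) has_sum s i) A" using insert.prems by simp
  then have "(f has_sum s i) ((\<lambda>x. (x, i)) ` A)"
    by (subst has_sum_reindex) (auto simp: inj_on_def o_def)
  moreover have "(f has_sum (\<Sum>i\<in>I. s i)) (A \<times> I)" using insert by simp
  moreover have "((\<lambda>x. (x, i)) ` A) \<inter> (A \<times> I) = {}" using insert.hyps by auto
  ultimately have "(f has_sum (s i + (\<Sum>i\<in>I. s i))) (((\<lambda>x. (x, i)) ` A) \<union> A \<times> I)"
    by (rule has_sum_Un_disjoint)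
  moreover have "((\<lambda>x. (x, i)) ` A) \<union> A \<times> I = A \<times> insert i I" by auto
  ultimately show ?case using insert.hyps by simp
qed simp

text \<open>The operator norm \<open>onorm\<close> treats the complex matrix as a real-linear
  map.\<close>

lemma bounded_linear_cmatrix: "bounded_linear ((*v) (N :: complex^'m::finite^'n::finite))"
proof (rule linear_conv_bounded_linear[THEN iffD1])
  show "linear ((*v) N)"
    by (rule linearI)
      (auto simp: matrix_vector_right_distrib vec_eq_iff matrix_vector_mult_def scaleR_sum_right distrib_left
          sum.distrib intro!: sum.cong)
qed

lemma norm_cvec_sq: "(norm (x :: complex^'n::finite))\<^sup>2 = (\<Sum>i\<in>UNIV. (cmod (x $ i))\<^sup>2)"
  unfolding norm_vec_def L2_set_def by (simp add: sum_nonneg)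

lemma sobolev_box_sq_int:
  assumes "T \<in> sobolev s" shows "sq_int (\<lambda>\<xi>. indicator (frequency_box j (\<epsilon> :: nat^'d::finite)) \<xi> * ft T \<xi>)"
  unfolding sq_int_def
proof
  note [measurable] = sobolev_ft_measurable[OF assms]
  show "(\<lambda>\<xi>. indicator (frequency_box j \<epsilon>) \<xi> * ft T \<xi>) \<in> borel_measurable borel" by measurable
  have "(cmod (indicator (frequency_box j \<epsilon>) \<xi> * ft T \<xi>))\<^sup>2 =
      indicator (frequency_box j \<epsilon>) \<xi> * (cmod (ft T \<xi>))\<^sup>2" for \<xi>
    by (simp add: indicator_def)
  then show "integrable lborel (\<lambda>\<xi>. (cmod (indicator (frequency_box j \<epsilon>) \<xi> * ft T \<xi>))\<^sup>2)"
    using sobolev_ft_square_integrable[OF assms frequency_box_measurable frequency_box_bounded] by simp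
qed

lemma wcf_add: "sq_int f \<Longrightarrow> sq_int g \<Longrightarrow> \<epsilon> \<in> wavelet_types \<Longrightarrow> wcf j \<epsilon> k (\<lambda>\<xi>. f \<xi> + g \<xi>) = wcf j \<epsilon> k f + wcf j \<epsilon> k g"
  using orthonormal_wav_unit[of \<epsilon> j] by (simp add: wcf_def ip_add_left orthonormal_def distrib_left)

lemma wcf_diff: "sq_int f \<Longrightarrow> sq_int g \<Longrightarrow> \<epsilon> \<in> wavelet_types \<Longrightarrow> wcf j \<epsilon> k (\<lambda>\<xi>. f \<xi> - g \<xi>) = wcf j \<epsilon> k f - wcf j \<epsilon> k g"
  using orthonormal_wav_unit[of \<epsilon> j] by (simp add: wcf_def ip_diff_left orthonormal_def diff_divide_distrib)

lemma wcf_cmult: "wcf j \<epsilon> k (\<lambda>\<xi>. c * f \<xi>) = c * wcf j \<epsilon> k f"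
  by (simp add: wcf_def ip_cmult_left)

lemma wcf_sum:
  assumes "\<And>i. i \<in> I \<Longrightarrow> sq_int (f i)" "\<epsilon> \<in> wavelet_types"
  shows "wcf j \<epsilon> k (\<lambda>\<xi>. \<Sum>i\<in>I. f i \<xi>) = (\<Sum>i\<in>I. wcf j \<epsilon> k (f i))"
  using orthonormal_wav_unit[of \<epsilon> j] assms
  by (simp add: wcf_def ip_sum_left orthonormal_def sum_distrib_left)

lemma cmod_wav_unit:
  assumes "\<epsilon> \<in> wavelet_types"
  obtains C where "\<And>\<xi>. cmod (wav_unit j \<epsilon> k \<xi>) \<le> C"
proof
  let ?C = "cmod (complex_of_real (1 / sqrt ((2 * pi) ^ CARD('a)))) * (2 powr (- real_of_int j / 2)) ^ CARD('a)"
  show "cmod (wav_unit j \<epsilon> k \<xi>) \<le> ?C" for \<xi>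
    unfolding wav_unit_def norm_mult cmod_wav_hat[OF assms]
    by (intro mult_left_mono) (auto simp: indicator_def)
qed

locale symbol_operator =
  fixes t :: real
    and A :: "('m::finite \<Rightarrow> (real^'d::finite) distr) \<Rightarrow> ('n::finite \<Rightarrow> (real^'d) distr)"
    and M :: "real^'d \<Rightarrow> complex^'m^'n"
  assumes cont: "continuous_operator t A" and symb: "has_symbol t A M"
begin

lemma A_sobolev: "(\<And>l. u l \<in> sobolev (t / 2)) \<Longrightarrow> A u i \<in> sobolev (- t / 2)"
  using cont by (simp add: continuous_operator_def)

lemma ft_A_vec_wavelet:
  assumes \<epsilon>: "\<epsilon> \<in> wavelet_types"
  shows "AE \<xi> in lborel. ft (A (vec_wavelet (j, \<epsilon>, k) l) i) \<xi> = M \<xi> $ i $ l * wav_hat (j, \<epsilon>, k) \<xi>"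
proof -
  have "AE \<xi> in lborel. ft (A (vec_wavelet (j, \<epsilon>, k) l) i) \<xi> =
      (M \<xi> *v (\<chi> l'. ft (vec_wavelet (j, \<epsilon>, k) l l') \<xi>)) $ i"
    by (rule symb[unfolded has_symbol_def, rule_format]) (rule vec_wavelet_sobolev(1)[OF \<epsilon>])
  moreover have "AE \<xi> in lborel. \<forall>l'. ft (vec_wavelet (j, \<epsilon>, k) l l') \<xi> = (if l' =
      l then wav_hat (j, \<epsilon>, k) \<xi> else 0)"
    unfolding AE_all_countable by (intro allI ft_vec_wavelet[OF \<epsilon>])
  ultimately show ?thesis
  proof eventually_elim
    case (elim \<xi>)
    then show ?case by (simp add: matrix_vector_mult_def if_distrib[of "\<lambda>x. _ * x"] cong: if_cong)
  qed
qed

text \<open>A measurable version of \<open>M\<close> on the box: \<open>M\<close> itself is only known almost everywhere and need not be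
  Borel measurable.\<close>

definition box_symbol :: "int \<Rightarrow> nat^'d \<Rightarrow> 'n \<Rightarrow> 'm \<Rightarrow> real^'d \<Rightarrow> complex" where
  "box_symbol j \<epsilon> i l \<xi> = ft (A (vec_wavelet (j, \<epsilon>, 0) l) i) \<xi> / wav_hat (j, \<epsilon>, 0) \<xi>"

lemma box_symbol_eq_0: "\<epsilon> \<in> wavelet_types \<Longrightarrow> \<xi> \<notin> frequency_box j \<epsilon> \<Longrightarrow> box_symbol j \<epsilon> i l \<xi> = 0"
  by (simp add: box_symbol_def wav_hat_eq_0)

lemma wav_hat_neq_0: "\<epsilon> \<in> wavelet_types \<Longrightarrow> \<xi> \<in> frequency_box j \<epsilon> \<Longrightarrow> wav_hat (j, \<epsilon>, k) (\<xi> :: real^'d) \<noteq> 0"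
  using cmod_wav_hat[of \<epsilon> j k \<xi>] by auto

lemma box_symbol_AE:
  assumes \<epsilon>: "\<epsilon> \<in> wavelet_types"
  shows "AE \<xi> in lborel. \<xi> \<in> frequency_box j \<epsilon> \<longrightarrow> box_symbol j \<epsilon> i l \<xi> = M \<xi> $ i $ l"
  using ft_A_vec_wavelet[OF \<epsilon>, of j 0 l i]
  by eventually_elim (simp add: box_symbol_def wav_hat_neq_0[OF \<epsilon>])

text \<open>\<open>A\<close> sends a wavelet into a Sobolev space, whose transforms are square
  integrable on bounded sets; dividing by a function of constant modulus on the box keeps
  this.\<close>

lemma sq_int_box_symbol:
  assumes \<epsilon>: "\<epsilon> \<in> wavelet_types" shows "sq_int (box_symbol j \<epsilon> i l)"
proof -
  let ?T = "A (vec_wavelet (j, \<epsilon>, 0) l) i"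
  have T: "?T \<in> sobolev (- t / 2)" by (intro A_sobolev vec_wavelet_sobolev \<epsilon>)
  have C: "cmod (1 / wav_hat (j, \<epsilon>, 0) \<xi>) \<le> 1 / (2 powr (- real_of_int j / 2)) ^ CARD('d)" for \<xi> :: "real^'d"
    by (simp add: norm_divide cmod_wav_hat[OF \<epsilon>] indicator_def)
  have "box_symbol j \<epsilon> i l = (\<lambda>\<xi>. (indicator (frequency_box j \<epsilon>) \<xi> * ft ?T \<xi>) * (1 / wav_hat (j, \<epsilon>, 0) \<xi>))"
  proof
    fix \<xi>
    show "box_symbol j \<epsilon> i l \<xi> = (indicator (frequency_box j \<epsilon>) \<xi> * ft ?T \<xi>) * (1 / wav_hat (j, \<epsilon>, 0) \<xi>)"
      by (cases "\<xi> \<in> frequency_box j \<epsilon>") (simp_all add: box_symbol_def wav_hat_eq_0[OF \<epsilon>])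
  qed
  moreover have "(\<lambda>\<xi>. 1 / wav_hat (j, \<epsilon>, 0) (\<xi> :: real^'d)) \<in> borel_measurable borel" by measurable
  ultimately show ?thesis
    using sq_int_mult_bounded[OF sobolev_box_sq_int[OF T] _ C] by presburger
qed

text \<open>\<open>box_symbol\<close> is built from the wavelet with k = 0 but serves every k',
  because on the box both computations give \<open>M\<close> almost everywhere.\<close>

lemma wmatrix_same_level:
  assumes \<epsilon>: "\<epsilon> \<in> wavelet_types"
  shows "wmatrix A ((j, \<epsilon>, k), i) ((j, \<epsilon>, k'), l) = wcf j \<epsilon> k (\<lambda>\<xi>. box_symbol j \<epsilon> i l \<xi> * wav_hat (j, \<epsilon>, k') \<xi>)"
  unfolding wmatrix_def wcoeff_def prod.case vec_lambda_beta
proof (rule pairing_wavelet[OF \<epsilon>])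
  show "A (vec_wavelet (j, \<epsilon>, k') l) i \<in> sobolev (- t / 2)" by (intro A_sobolev vec_wavelet_sobolev \<epsilon>)
  have [measurable]: "box_symbol j \<epsilon> i l \<in> borel_measurable borel"
    using sq_int_box_symbol[OF \<epsilon>] by (rule sq_int_measurable)
  show "(\<lambda>\<xi>. box_symbol j \<epsilon> i l \<xi> * wav_hat (j, \<epsilon>, k') \<xi>) \<in> borel_measurable borel" by measurable
  show "AE \<xi> in lborel. \<xi> \<in> frequency_box j \<epsilon> \<longrightarrow>
      ft (A (vec_wavelet (j, \<epsilon>, k') l) i) \<xi> = box_symbol j \<epsilon> i l \<xi> * wav_hat (j, \<epsilon>, k') \<xi>"
    using ft_A_vec_wavelet[OF \<epsilon>, of j k' l i] box_symbol_AE[OF \<epsilon>, of j i l]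
    by eventually_elim simp
qed

lemma wmatrix_different_level:
  assumes \<epsilon>: "\<epsilon> \<in> wavelet_types" "\<epsilon>' \<in> wavelet_types" and ne: "(j, \<epsilon>) \<noteq> (j', \<epsilon>')"
  shows "wmatrix A ((j, \<epsilon>, k), i) ((j', \<epsilon>', k'), l) = 0"
proof -
  have "wmatrix A ((j, \<epsilon>, k), i) ((j', \<epsilon>', k'), l) = wcf j \<epsilon> k (\<lambda>\<xi>. 0)"
    unfolding wmatrix_def wcoeff_def prod.case vec_lambda_beta
  proof (rule pairing_wavelet[OF \<epsilon>(1)])
    show "A (vec_wavelet (j', \<epsilon>', k') l) i \<in> sobolev (- t / 2)" by (intro A_sobolev vec_wavelet_sobolev \<epsilon>)
    show "AE \<xi> in lborel. \<xi> \<in> frequency_box j \<epsilon> \<longrightarrow> ft (A (vec_wavelet (j', \<epsilon>', k') l) i) \<xi> = 0"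
      using ft_A_vec_wavelet[OF \<epsilon>(2), of j' k' l i] frequency_box_disjoint[OF \<epsilon> ne]
      by eventually_elim (auto simp: wav_hat_eq_0[OF \<epsilon>(2)])
  qed simp
  also have "\<dots> = 0" by (simp add: wcf_def ip_def)
  finally show ?thesis .
qed

text \<open>Matrix times coefficients is Parseval's identity in the wavelets of the level. The
  product of symbol and \<open>G\<close> is controlled only when tested against a wavelet, so that
  integrability is recorded separately.\<close>

lemma wmatrix_apply_column:
  assumes \<epsilon>: "\<epsilon> \<in> wavelet_types" and G: "sq_int G" "\<And>\<xi>. \<xi> \<notin> frequency_box j \<epsilon> \<Longrightarrow> G \<xi> = 0"
  shows "integrable lborel (\<lambda>\<xi>. box_symbol j \<epsilon> i l \<xi> * G \<xi> * cnj (wav_unit j \<epsilon> k \<xi>))"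
    and "((\<lambda>k'. wmatrix A ((j, \<epsilon>, k), i) ((j, \<epsilon>, k'), l) * wcf j \<epsilon> k' G) has_sum
      wcf j \<epsilon> k (\<lambda>\<xi>. box_symbol j \<epsilon> i l \<xi> * G \<xi>)) UNIV"
proof -
  let ?q = "complex_of_real (sqrt ((2 * pi) ^ CARD('d)))"
  have q: "?q \<noteq> 0" "complex_of_real (1 / sqrt ((2 * pi) ^ CARD('d))) = 1 / ?q" by auto
  note on = orthonormal_wav_unit[OF \<epsilon>, of j]
  have us: "sq_int (wav_unit j \<epsilon> k')" for k' using on by (simp add: orthonormal_def)
  \<comment> \<open>The symbol is moved onto the bounded unit wavelet; now both \<open>G\<close> and
    \<open>H\<close> are square integrable and supported in the box.\<close>
  define H where "H \<xi> = cnj (box_symbol j \<epsilon> i l \<xi>) * wav_unit j \<epsilon> k \<xi>" for \<xi>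
  obtain C where C: "\<And>\<xi>. cmod (wav_unit j \<epsilon> k \<xi>) \<le> C" using cmod_wav_unit[OF \<epsilon>] by metis
  have H: "sq_int H"
    unfolding H_def
        by (intro sq_int_mult_bounded[OF sq_int_cnj[OF sq_int_box_symbol[OF \<epsilon>]] sq_int_measurable[OF us] C])
  have H0: "H \<xi> = 0" if "\<xi> \<notin> frequency_box j \<epsilon>" for \<xi>
    using that by (simp add: H_def box_symbol_eq_0[OF \<epsilon>])
  have eq: "box_symbol j \<epsilon> i l \<xi> * G \<xi> * cnj (wav_unit j \<epsilon> k \<xi>) = G \<xi> * cnj (H \<xi>)" for \<xi>
    by (simp add: H_def)
  show "integrable lborel (\<lambda>\<xi>. box_symbol j \<epsilon> i l \<xi> * G \<xi> * cnj (wav_unit j \<epsilon> k \<xi>))"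
    unfolding eq by (rule sq_int_mult_integrable[OF G(1) H])
  have "((\<lambda>k'. 1 / ?q * (ip G (wav_unit j \<epsilon> k') * cnj (ip H (wav_unit j \<epsilon> k')))) has_sum 1 / ?q * ip G H) UNIV"
    by (intro has_sum_cmult_right parseval[OF on] wav_unit_complete[OF \<epsilon>] G H H0)
  also have "(\<lambda>k'. 1 / ?q * (ip G (wav_unit j \<epsilon> k') * cnj (ip H (wav_unit j \<epsilon> k')))) =
      (\<lambda>k'. wmatrix A ((j, \<epsilon>, k), i) ((j, \<epsilon>, k'), l) * wcf j \<epsilon> k' G)"
  proof
    fix k'
    have "cnj (ip H (wav_unit j \<epsilon> k')) = ip (\<lambda>\<xi>. box_symbol j \<epsilon> i l \<xi> * wav_unit j \<epsilon> k' \<xi>) (wav_unit j \<epsilon> k)"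
      unfolding ip_cnj by (simp add: ip_def H_def mult_ac)
    also have "\<dots> = wmatrix A ((j, \<epsilon>, k), i) ((j, \<epsilon>, k'), l)"
      unfolding wmatrix_same_level[OF \<epsilon>] wav_hat_unit wcf_def
      using ip_cmult_left[of ?q "\<lambda>\<xi>. box_symbol j \<epsilon> i l \<xi> * wav_unit j \<epsilon> k' \<xi>" "wav_unit j \<epsilon> k"] q
      by (simp only: mult.left_commute[of _ ?q]) simp
    finally show "1 / ?q * (ip G (wav_unit j \<epsilon> k') * cnj (ip H (wav_unit j \<epsilon> k'))) =
        wmatrix A ((j, \<epsilon>, k), i) ((j, \<epsilon>, k'), l) * wcf j \<epsilon> k' G"
      by (simp add: wcf_def)
  qed
  also have "1 / ?q * ip G H = wcf j \<epsilon> k (\<lambda>\<xi>. box_symbol j \<epsilon> i l \<xi> * G \<xi>)"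
    unfolding wcf_def q(2) ip_def eq ..
  finally show "((\<lambda>k'. wmatrix A ((j, \<epsilon>, k), i) ((j, \<epsilon>, k'), l) * wcf j \<epsilon> k' G) has_sum
      wcf j \<epsilon> k (\<lambda>\<xi>. box_symbol j \<epsilon> i l \<xi> * G \<xi>)) UNIV" .
qed

text \<open>Entries between different levels vanish, so the values of \<open>c\<close> on other
  levels are irrelevant and the full sum reduces to finitely many column sums.\<close>

lemma wmatrix_apply_level:
  assumes \<epsilon>: "\<epsilon> \<in> wavelet_types" and G: "\<And>l. sq_int (G l)" "\<And>l \<xi>. \<xi> \<notin> frequency_box j \<epsilon> \<Longrightarrow> G l \<xi> = 0"
    and c: "\<And>k l. c (j, \<epsilon>, k) $ l = wcf j \<epsilon> k (G l)"
  shows "wmatrix_apply A c (j, \<epsilon>, k) $ i = wcf j \<epsilon> k (\<lambda>\<xi>. \<Sum>l\<in>UNIV. box_symbol j \<epsilon> i l \<xi> * G l \<xi>)"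
proof -
  define f where "f = (\<lambda>(\<nu>, l). wmatrix A ((j, \<epsilon>, k), i) (\<nu>, l) * c \<nu> $ l)"
  let ?h = "\<lambda>(k' :: int^'d, l :: 'm). ((j, \<epsilon>, k'), l)"
  let ?s = "\<lambda>l. wcf j \<epsilon> k (\<lambda>\<xi>. box_symbol j \<epsilon> i l \<xi> * G l \<xi>)"
  have "((f \<circ> ?h) has_sum (\<Sum>l\<in>UNIV. ?s l)) (UNIV \<times> UNIV)"
    using wmatrix_apply_column(2)[OF \<epsilon> G]
    by (intro has_sum_Times_finite) (simp_all add: f_def c)
  then have "(f has_sum (\<Sum>l\<in>UNIV. ?s l)) (?h ` (UNIV \<times> UNIV))"
    by (subst has_sum_reindex) (auto simp: inj_on_def)
  also have "(f has_sum (\<Sum>l\<in>UNIV. ?s l)) (?h ` (UNIV \<times> UNIV)) \<longleftrightarrow> (f has_sum (\<Sum>l\<in>UNIV. ?s l)) (windices \<times> UNIV)"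
  proof (rule has_sum_cong_neutral)
    fix x assume "x \<in> windices \<times> UNIV - ?h ` (UNIV \<times> UNIV)"
    then obtain j' \<epsilon>' k' l where x: "x = ((j', \<epsilon>', k'), l)" "\<epsilon>' \<in> wavelet_types" "(j, \<epsilon>) \<noteq> (j', \<epsilon>')"
      by (cases x) (force simp: windices_def image_iff)
    then show "f x = 0" by (simp add: f_def wmatrix_different_level[OF \<epsilon>])
  qed (use \<epsilon> in \<open>auto simp: windices_def\<close>)
  finally have "wmatrix_apply A c (j, \<epsilon>, k) $ i = (\<Sum>l\<in>UNIV. ?s l)"
    unfolding wmatrix_apply_def f_def by (simp add: infsumI)
  \<comment> \<open>The sum is pulled through the integral by integrability against the wavelet;
    \<open>wcf_sum\<close> would ask for square-integrable summands.\<close>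
  also have "\<dots> = wcf j \<epsilon> k (\<lambda>\<xi>. \<Sum>l\<in>UNIV. box_symbol j \<epsilon> i l \<xi> * G l \<xi>)"
    unfolding wcf_def ip_def sum_distrib_right
    by (subst Bochner_Integration.integral_sum)
      (auto intro: wmatrix_apply_column(1)[OF \<epsilon> G] simp: sum_distrib_left)
  finally show ?thesis .
qed

end

section \<open>Convergence of the iteration\<close>

lemma ennreal_has_sum:
  assumes f: "(f has_sum s) A" and nn: "\<And>x. x \<in> A \<Longrightarrow> 0 \<le> (f x :: real)"
  shows "(\<Sum>\<^sub>\<infinity>x\<in>A. ennreal (f x)) = ennreal s"
proof -
  have "ennreal (infsum f A) = (SUP F\<in>{F. finite F \<and> F \<subseteq> A}. ennreal (sum f F))"
    using f nn by (intro infsum_nonneg_is_SUPREMUM_ennreal) (auto simp: has_sum_imp_summable)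
  also have "\<dots> = (SUP F\<in>{F. finite F \<and> F \<subseteq> A}. (\<Sum>x\<in>F. ennreal (f x)))"
    using nn by (intro SUP_cong refl) (auto intro!: sum_ennreal[symmetric])
  also have "\<dots> = (\<Sum>\<^sub>\<infinity>x\<in>A. ennreal (f x))"
    by (rule nonneg_infsum_complete[symmetric]) simp
  finally show ?thesis using infsumI[OF f] by simp
qed

text \<open>A finite index set meets only finitely many levels, so every finite partial sum is
  dominated by a finite sum of complete level sums.\<close>

lemma infsum_levels_le:
  fixes f g :: "'a \<times> 'b \<Rightarrow> ennreal"
  assumes le: "\<And>x. x \<in> X \<Longrightarrow> (\<Sum>\<^sub>\<infinity>y. f (x, y)) \<le> c * (\<Sum>\<^sub>\<infinity>y. g (x, y))"
  shows "infsum f (X \<times> UNIV) \<le> c * infsum g (X \<times> UNIV)"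
proof (rule infsum_le_finite_sums)
  have slice: "infsum h ({x} \<times> UNIV) = (\<Sum>\<^sub>\<infinity>y. h (x, y))" for h :: "'a \<times> 'b \<Rightarrow> ennreal" and x
  proof -
    have "{x} \<times> UNIV = range (Pair x :: 'b \<Rightarrow> _)" by auto
    then show ?thesis using infsum_reindex[of "Pair x" UNIV h] by (simp add: inj_on_def o_def)
  qed
  have fin: "infsum h (L \<times> UNIV) = (\<Sum>x\<in>L. \<Sum>\<^sub>\<infinity>y. h (x, y))" if "finite L" for L and h :: "'a \<times> 'b \<Rightarrow> ennreal"
    using that
  proof induction
    case (insert x L)
    have "infsum h (({x} \<times> UNIV) \<union> (L \<times> UNIV)) = infsum h ({x} \<times> UNIV) + infsum h (L \<times> UNIV)"
      using insert.hyps by (intro infsum_Un_disjoint nonneg_summable_on_complete) auto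
    moreover have "insert x L \<times> UNIV = ({x} \<times> (UNIV :: 'b set)) \<union> (L \<times> UNIV)" by auto
    ultimately show ?case using insert by (simp add: slice)
  qed simp
  fix F :: "('a \<times> 'b) set" assume F: "finite F" "F \<subseteq> X \<times> UNIV"
  let ?L = "fst ` F"
  have L: "finite ?L" "?L \<subseteq> X" using F by auto
  have FL: "F \<subseteq> ?L \<times> UNIV" by force
  have "sum f F = infsum f F" using F(1) by simp
  also have "\<dots> \<le> infsum f (?L \<times> UNIV)"
    by (intro infsum_mono_neutral nonneg_summable_on_complete) (use FL in auto)
  also have "\<dots> = (\<Sum>x\<in>?L. \<Sum>\<^sub>\<infinity>y. f (x, y))" by (rule fin[OF L(1)])
  also have "\<dots> \<le> (\<Sum>x\<in>?L. c * (\<Sum>\<^sub>\<infinity>y. g (x, y)))" using le L(2) by (intro sum_mono) auto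
  also have "\<dots> = c * infsum g (?L \<times> UNIV)" by (simp add: fin[OF L(1)] sum_distrib_left)
  also have "\<dots> \<le> c * infsum g (X \<times> UNIV)"
    using L(2) by (intro mult_left_mono infsum_mono_neutral nonneg_summable_on_complete) auto
  finally show "sum f F \<le> c * infsum g (X \<times> UNIV)" .
qed (rule nonneg_summable_on_complete, simp)

lemma wnorm_le:
  fixes c c' :: "'d::finite windex \<Rightarrow> complex^'n::finite"
  assumes r: "r > 0"
    and level: "\<And>j \<epsilon>. \<epsilon> \<in> wavelet_types \<Longrightarrow> \<exists>a b. a \<le> r\<^sup>2 * b
      \<and> ((\<lambda>k. (norm (c (j, \<epsilon>, k)))\<^sup>2) has_sum a) UNIV \<and> ((\<lambda>k. (norm (c' (j, \<epsilon>, k)))\<^sup>2) has_sum b) UNIV"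
  shows "wnorm s c \<le> ennreal r * wnorm s c'"
proof -
  define f where "f d = (\<lambda>((j, \<epsilon>), k). ennreal (2 powr (2 * s * real_of_int j) * (norm (d (j, \<epsilon>,
      k) :: complex^'n))\<^sup>2))"
    for d :: "'d windex \<Rightarrow> complex^'n"
  have f: "wnorm_sq s d = infsum (f d) ((UNIV \<times> wavelet_types) \<times> UNIV)" for d
  proof -
    have "bij_betw (\<lambda>((j, \<epsilon>), k). (j, \<epsilon>, k)) ((UNIV \<times> wavelet_types) \<times> UNIV) (windices :: 'd windex set)"
      by (rule bij_betwI[where g = "\<lambda>(j, \<epsilon>, k). ((j, \<epsilon>), k)"]) (auto simp: windices_def)
    then show ?thesis
      unfolding wnorm_sq_def norm_cvec_sq[symmetric]
      by (subst infsum_reindex_bij_betw[symmetric]) (auto simp: f_def intro!: infsum_cong)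
  qed
  have sq: "wnorm_sq s c \<le> ennreal (r\<^sup>2) * wnorm_sq s c'"
    unfolding f
  proof (rule infsum_levels_le, clarify)
    fix j and \<epsilon> :: "nat^'d" assume "\<epsilon> \<in> wavelet_types"
    from level[OF this] obtain a b where ab: "a \<le> r\<^sup>2 * b"
      "((\<lambda>k. (norm (c (j, \<epsilon>, k)))\<^sup>2) has_sum a) UNIV" "((\<lambda>k. (norm (c' (j, \<epsilon>, k)))\<^sup>2) has_sum b) UNIV" by blast
    let ?w = "2 powr (2 * s * real_of_int j)"
    have "(\<Sum>\<^sub>\<infinity>k. f c ((j, \<epsilon>), k)) = ennreal (?w * a)" "(\<Sum>\<^sub>\<infinity>k. f c' ((j, \<epsilon>), k)) = ennreal (?w * b)"
      unfolding f_def prod.case by (intro ennreal_has_sum has_sum_cmult_right ab; simp)+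
    moreover have "ennreal (?w * a) \<le> ennreal (r\<^sup>2) * ennreal (?w * b)"
    proof -
      have "?w * a \<le> r\<^sup>2 * (?w * b)" using mult_left_mono[OF ab(1), of ?w] by (simp add: mult_ac)
      moreover have "b \<ge> 0" using ab(3) by (rule has_sum_nonneg) simp
      ultimately show ?thesis by (simp add: ennreal_mult[symmetric] ennreal_leI)
    qed
    ultimately show "(\<Sum>\<^sub>\<infinity>k. f c ((j, \<epsilon>), k)) \<le> ennreal (r\<^sup>2) * (\<Sum>\<^sub>\<infinity>k. f c' ((j, \<epsilon>), k))" by simp
  qed
  show ?thesis
  proof (cases "wnorm_sq s c' = \<infinity>")
    \<comment> \<open>\<open>r > 0\<close> makes the right-hand side infinite.\<close>
    case True
    then show ?thesis using r by (simp add: wnorm_def ennreal_mult_top)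
  next
    case False
    then obtain y where y: "y \<ge> 0" "wnorm_sq s c' = ennreal y" by (metis ennreal_cases infinity_ennreal_def)
    have le: "wnorm_sq s c \<le> ennreal (r\<^sup>2 * y)" using sq y by (simp add: ennreal_mult)
    then obtain x where x: "x \<ge> 0" "wnorm_sq s c = ennreal x"
      by (metis ennreal_cases ennreal_less_top infinity_ennreal_def leD)
    have "x \<le> r\<^sup>2 * y" using le x y by (simp add: ennreal_le_iff)
    then have "sqrt x \<le> r * sqrt y" using r
        by (metis less_imp_le real_sqrt_abs abs_of_pos real_sqrt_le_iff real_sqrt_mult)
    then show ?thesis using x y r by (simp add: wnorm_def ennreal_mult[symmetric] ennreal_leI)
  qed
qed

section \<open>The residuals of one level on the Fourier side\<close>

locale richardson_level = symbol_operator t A M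
  for t :: real
    and A :: "('m::finite \<Rightarrow> (real^'d::finite) distr) \<Rightarrow> ('n::finite \<Rightarrow> (real^'d) distr)"
    and M :: "real^'d \<Rightarrow> complex^'m^'n" +
  fixes M\<omega> :: "int \<Rightarrow> nat^'d \<Rightarrow> real^'m^'n" and v :: "'n \<Rightarrow> (real^'d) distr"
    and j :: int and \<epsilon> :: "nat^'d" and \<rho> :: real
  assumes \<epsilon>: "\<epsilon> \<in> wavelet_types" and \<rho>: "\<rho> > 0"
    and contr: "\<And>\<xi>. \<xi> \<in> frequency_box j \<epsilon> \<Longrightarrow> onorm ((*v) (mat 1 - M \<xi> ** pinv (cmat (M\<omega> j \<epsilon>)))) \<le> \<rho>"
    and v: "\<And>i. v i \<in> sobolev (- t / 2)"
begin

abbreviation P :: "complex^'n^'m" where "P \<equiv> pinv (cmat (M\<omega> j \<epsilon>))"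

definition mm :: "real^'d \<Rightarrow> complex^'m^'n" where
  "mm \<xi> = (\<chi> i l. box_symbol j \<epsilon> i l \<xi>)"

text \<open>Cutting \<open>ft (v i)\<close> to the box at the start confines all later residuals to
  it, and \<open>mm\<close> in place of \<open>M\<close> keeps them measurable.\<close>

primrec res :: "nat \<Rightarrow> real^'d \<Rightarrow> complex^'n" where
  "res 0 = (\<lambda>\<xi>. \<chi> i. indicator (frequency_box j \<epsilon>) \<xi> * ft (v i) \<xi>)"
| "res (Suc p) = (\<lambda>\<xi>. res p \<xi> - mm \<xi> *v (P *v res p \<xi>))"

text \<open>Each step adds P times the residual, so P applied to \<open>acc p\<close> represents the
  p-th iterate.\<close>

definition acc :: "nat \<Rightarrow> real^'d \<Rightarrow> complex^'n" where
  "acc p \<xi> = (\<Sum>q<p. res q \<xi>)"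

lemma acc_Suc: "acc (Suc p) \<xi> = acc p \<xi> + res p \<xi>"
  by (simp add: acc_def)

lemma res_acc: "res p \<xi> = res 0 \<xi> - mm \<xi> *v (P *v acc p \<xi>)"
proof (induction p)
  case (Suc p)
  have "mm \<xi> *v (P *v acc (Suc p) \<xi>) = mm \<xi> *v (P *v acc p \<xi>) + mm \<xi> *v (P *v res p \<xi>)"
    by (simp add: acc_Suc matrix_vector_right_distrib)
  with Suc show ?case by (simp add: algebra_simps)
qed (simp add: acc_def)

lemma res_outside: "\<xi> \<notin> frequency_box j \<epsilon> \<Longrightarrow> res p \<xi> = 0"
proof (induction p)
  case 0
  then show ?case by (simp add: vec_eq_iff)
qed simp

text \<open>On the box \<open>mm\<close> is almost everywhere \<open>M\<close>, so one step is
  multiplication by 1 - M P; off the box both sides vanish.\<close>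

lemma res_contraction: "AE \<xi> in lborel. norm (res (Suc p) \<xi>) \<le> \<rho> * norm (res p \<xi>)"
proof -
  have "AE \<xi> in lborel. \<forall>i l. \<xi> \<in> frequency_box j \<epsilon> \<longrightarrow> box_symbol j \<epsilon> i l \<xi> = M \<xi> $ i $ l"
    unfolding AE_all_countable using box_symbol_AE[OF \<epsilon>] by blast
  then show ?thesis
  proof eventually_elim
    case (elim \<xi>)
    show ?case
    proof (cases "\<xi> \<in> frequency_box j \<epsilon>")
      case True
      then have "mm \<xi> = M \<xi>" using elim by (simp add: mm_def vec_eq_iff)
      then have "res (Suc p) \<xi> = (mat 1 - M \<xi> ** P) *v res p \<xi>"
        by (simp add: matrix_vector_mult_diff_rdistrib matrix_vector_mul_assoc)
      then have "norm (res (Suc p) \<xi>) \<le> onorm ((*v) (mat 1 - M \<xi> ** P)) * norm (res p \<xi>)"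
        using onorm[OF bounded_linear_cmatrix] by metis
      also have "\<dots> \<le> \<rho> * norm (res p \<xi>)" by (intro mult_right_mono contr True) simp
      finally show ?thesis .
    qed (simp add: res_outside del: res.simps)
  qed
qed

text \<open>The term \<open>mm\<close> times P times the residual has no bound of its own; the
  contraction supplies the square-integrable majorant for the combination.\<close>

lemma res_sq_int: "sq_int (\<lambda>\<xi>. res p \<xi> $ i)"
proof (induction p arbitrary: i)
  case 0
  show ?case using sobolev_box_sq_int[OF v] by simp
next
  case (Suc p)
  have [measurable]: "(\<lambda>\<xi>. res p \<xi> $ i) \<in> borel_measurable borel" "box_symbol j \<epsilon> i l \<in> borel_measurable borel"
      for i l
    using Suc sq_int_box_symbol[OF \<epsilon>] by (auto intro: sq_int_measurable)
  show ?case
  proof (rule sq_int_AE_bound)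
    show "(\<lambda>\<xi>. res (Suc p) \<xi> $ i) \<in> borel_measurable borel"
      by (simp add: mm_def matrix_vector_mult_def)
    show "integrable lborel (\<lambda>\<xi>. (\<rho> * norm (res p \<xi>))\<^sup>2)"
      using Suc by (simp add: power_mult_distrib norm_cvec_sq sq_int_def)
    show "AE \<xi> in lborel. cmod (res (Suc p) \<xi> $ i) \<le> \<rho> * norm (res p \<xi>)"
      using res_contraction[of p]
      by eventually_elim (rule order_trans[OF Finite_Cartesian_Product.norm_nth_le])
  qed
qed

lemma acc_sq_int: "sq_int (\<lambda>\<xi>. acc p \<xi> $ i)"
  unfolding acc_def sum_component by (intro sq_int_sum res_sq_int)

text \<open>The assumption is the induction hypothesis of \<open>richardson_acc\<close>. Isolating
  this step serves the induction and, once that is complete, holds for every p.\<close>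

lemma residual_step:
  assumes "\<And>k. richardson A M\<omega> v p (j, \<epsilon>, k) = P *v (\<chi> i. wcf j \<epsilon> k (\<lambda>\<xi>. acc p \<xi> $ i))"
  shows "(wcoeff v (j, \<epsilon>, k) - wmatrix_apply A (richardson A M\<omega> v p) (j, \<epsilon>, k)) $ i = wcf j \<epsilon> k (\<lambda>\<xi>. res p \<xi> $ i)"
proof -
  define G where "G l \<xi> = (P *v acc p \<xi>) $ l" for l \<xi>
  have G: "G l = (\<lambda>\<xi>. \<Sum>i\<in>UNIV. P $ l $ i * acc p \<xi> $ i)" for l
    by (simp add: G_def matrix_vector_mult_def fun_eq_iff)
  have "wmatrix_apply A (richardson A M\<omega> v p) (j, \<epsilon>, k) $ i =
      wcf j \<epsilon> k (\<lambda>\<xi>. \<Sum>l\<in>UNIV. box_symbol j \<epsilon> i l \<xi> * G l \<xi>)"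
  proof (rule wmatrix_apply_level[OF \<epsilon>])
    show "sq_int (G l)" for l unfolding G by (intro sq_int_sum sq_int_cmult acc_sq_int)
    show "G l \<xi> = 0" if "\<xi> \<notin> frequency_box j \<epsilon>" for l \<xi>
      unfolding G_def acc_def by (simp add: res_outside[OF that])
    show "richardson A M\<omega> v p (j, \<epsilon>, k) $ l = wcf j \<epsilon> k (G l)" for k l
      unfolding assms G by (simp add: matrix_vector_mult_def wcf_sum[OF sq_int_cmult[OF acc_sq_int] \<epsilon>] wcf_cmult)
  qed
  \<comment> \<open>By \<open>res_acc\<close> the sum over l is a difference of two residuals, hence
    square integrable although single summands need not be; only then does \<open>wcf_diff\<close>
    apply.\<close>
  also have "(\<lambda>\<xi>. \<Sum>l\<in>UNIV. box_symbol j \<epsilon> i l \<xi> * G l \<xi>) = (\<lambda>\<xi>. res 0 \<xi> $ i - res p \<xi> $ i)"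
  proof
    fix \<xi>
    have "(\<Sum>l\<in>UNIV. box_symbol j \<epsilon> i l \<xi> * G l \<xi>) = (mm \<xi> *v (P *v acc p \<xi>)) $ i"
      by (simp add: mm_def matrix_vector_mult_def[of "\<chi> i l. _ i l"] G_def)
    also have "mm \<xi> *v (P *v acc p \<xi>) = res 0 \<xi> - res p \<xi>"
      using res_acc[of p \<xi>] by (simp del: res.simps)
    finally show "(\<Sum>l\<in>UNIV. box_symbol j \<epsilon> i l \<xi> * G l \<xi>) = res 0 \<xi> $ i - res p \<xi> $ i" by (simp del: res.simps)
  qed
  also have "wcf j \<epsilon> k \<dots> = wcf j \<epsilon> k (\<lambda>\<xi>. res 0 \<xi> $ i) - wcf j \<epsilon> k (\<lambda>\<xi>. res p \<xi> $ i)"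
    by (intro wcf_diff res_sq_int \<epsilon>)
  finally have 1: "wmatrix_apply A (richardson A M\<omega> v p) (j, \<epsilon>, k) $ i =
      wcf j \<epsilon> k (\<lambda>\<xi>. res 0 \<xi> $ i) - wcf j \<epsilon> k (\<lambda>\<xi>. res p \<xi> $ i)" .
  have "wcoeff v (j, \<epsilon>, k) $ i = wcf j \<epsilon> k (\<lambda>\<xi>. res 0 \<xi> $ i)"
    unfolding wcoeff_def vec_lambda_beta
    by (rule pairing_wavelet[OF \<epsilon> v]) (auto intro: sq_int_measurable[OF res_sq_int[of 0, simplified]])
  with 1 show ?thesis by simp
qed

lemma richardson_acc:
  "richardson A M\<omega> v p (j, \<epsilon>, k) = P *v (\<chi> i. wcf j \<epsilon> k (\<lambda>\<xi>. acc p \<xi> $ i))"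
proof (induction p arbitrary: k)
  case 0
  have "wcf j \<epsilon> k (\<lambda>\<xi>. 0) = 0" by (simp add: wcf_def ip_def)
  then show ?case by (simp add: acc_def vec_eq_iff matrix_vector_mult_def)
next
  case (Suc p)
  have "wcoeff v (j, \<epsilon>, k) - wmatrix_apply A (richardson A M\<omega> v p) (j, \<epsilon>, k) = (\<chi> i. wcf j \<epsilon> k (\<lambda>\<xi>. res p \<xi> $ i))"
    using residual_step[OF Suc] by (simp add: vec_eq_iff del: minus_vec_def vector_minus_component)
  then have "richardson A M\<omega> v (Suc p) (j, \<epsilon>, k) =
      P *v ((\<chi> i. wcf j \<epsilon> k (\<lambda>\<xi>. acc p \<xi> $ i)) + (\<chi> i. wcf j \<epsilon> k (\<lambda>\<xi>. res p \<xi> $ i)))"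
    by (simp add: Suc matrix_vector_right_distrib)
  also have "(\<chi> i. wcf j \<epsilon> k (\<lambda>\<xi>. acc p \<xi> $ i)) + (\<chi> i. wcf j \<epsilon> k (\<lambda>\<xi>. res p \<xi> $ i)) =
      (\<chi> i. wcf j \<epsilon> k (\<lambda>\<xi>. acc (Suc p) \<xi> $ i))"
    by (simp add: vec_eq_iff acc_Suc wcf_add[OF acc_sq_int res_sq_int \<epsilon>])
  finally show ?case .
qed

text \<open>Parseval for each of the finitely many components, then summation over the
  components.\<close>

lemma residual_has_sum:
  "((\<lambda>k. (norm (wcoeff v (j, \<epsilon>, k) - wmatrix_apply A (richardson A M\<omega> v p) (j, \<epsilon>, k)))\<^sup>2) has_sum
     1 / (2 * pi) ^ CARD('d) * (LINT \<xi>|lborel. (norm (res p \<xi>))\<^sup>2)) UNIV"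
proof -
  have "(LINT \<xi>|lborel. (norm (res p \<xi>))\<^sup>2) = (\<Sum>i\<in>UNIV. LINT \<xi>|lborel. (cmod (res p \<xi> $ i))\<^sup>2)"
    unfolding norm_cvec_sq using res_sq_int[of p]
        by (intro Bochner_Integration.integral_sum) (simp add: sq_int_def)
  moreover have "((\<lambda>k. \<Sum>i\<in>UNIV. (cmod (wcf j \<epsilon> k (\<lambda>\<xi>. res p \<xi> $ i)))\<^sup>2) has_sum
      (\<Sum>i\<in>UNIV. 1 / (2 * pi) ^ CARD('d) * (LINT \<xi>|lborel. (cmod (res p \<xi> $ i))\<^sup>2))) UNIV"
    by (intro has_sum_finite_sum wcf_parseval \<epsilon> res_sq_int) (simp add: res_outside)
  ultimately show ?thesis
    unfolding norm_cvec_sq residual_step[OF richardson_acc] by (simp add: sum_distrib_left)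
qed

lemma residual_contraction:
  "(LINT \<xi>|lborel. (norm (res (Suc p) \<xi>))\<^sup>2) \<le> \<rho>\<^sup>2 * (LINT \<xi>|lborel. (norm (res p \<xi>))\<^sup>2)"
proof -
  have i: "integrable lborel (\<lambda>\<xi>. (norm (res p \<xi>))\<^sup>2)" for p
    unfolding norm_cvec_sq using res_sq_int[of p] by (simp add: sq_int_def)
  have "(LINT \<xi>|lborel. (norm (res (Suc p) \<xi>))\<^sup>2) \<le> (LINT \<xi>|lborel. \<rho>\<^sup>2 * (norm (res p \<xi>))\<^sup>2)"
  proof (rule integral_mono_AE)
    show "integrable lborel (\<lambda>\<xi>. (norm (res (Suc p) \<xi>))\<^sup>2)" by (rule i)
    show "integrable lborel (\<lambda>\<xi>. \<rho>\<^sup>2 * (norm (res p \<xi>))\<^sup>2)" using i[of p] by simp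
    show "AE \<xi> in lborel. (norm (res (Suc p) \<xi>))\<^sup>2 \<le> \<rho>\<^sup>2 * (norm (res p \<xi>))\<^sup>2"
      using res_contraction[of p]
      by eventually_elim (metis norm_ge_zero power_mono power_mult_distrib)
  qed
  then show ?thesis by simp
qed

end

theorem theorem5p1:
  fixes t :: real
    and A :: "('m::finite \<Rightarrow> (real^'d::finite) distr) \<Rightarrow> ('n::finite \<Rightarrow> (real^'d) distr)"
    and M :: "real^'d \<Rightarrow> complex^'m^'n"
    and M\<omega> :: "int \<Rightarrow> nat^'d \<Rightarrow> real^'m^'n"
  assumes "continuous_operator t A"
    and "has_symbol t A M"
    and "\<And>\<xi>. \<xi> \<noteq> 0 \<Longrightarrow> M \<xi> ** pinv (M \<xi>) = mat 1"
    and "\<exists>\<rho>::real. \<rho> < 1 \<and> (\<forall>j. \<forall>\<epsilon>\<in>wavelet_types. \<forall>\<xi>\<in>frequency_box j \<epsilon>.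
           onorm ((*v) (mat 1 - M \<xi> ** pinv (cmat (M\<omega> j \<epsilon>)))) \<le> \<rho>)"
  shows "\<exists>r::real. 0 \<le> r \<and> r < 1 \<and>
    (\<forall>v. (\<forall>i. v i \<in> sobolev (- t / 2)) \<longrightarrow> (\<forall>p\<ge>1.
       wnorm (- t / 2) (\<lambda>\<mu>. wcoeff v \<mu> - wmatrix_apply A (richardson A M\<omega> v p) \<mu>)
       \<le> ennreal r * wnorm (- t / 2) (\<lambda>\<mu>. wcoeff v \<mu> - wmatrix_apply A (richardson A M\<omega> v (p - 1)) \<mu>)))"
proof -
  obtain \<rho> :: real where \<rho>: "\<rho> < 1" "\<And>j \<epsilon> \<xi>. \<epsilon> \<in> wavelet_types \<Longrightarrow> \<xi> \<in> frequency_box j \<epsilon> \<Longrightarrow>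
      onorm ((*v) (mat 1 - M \<xi> ** pinv (cmat (M\<omega> j \<epsilon>)))) \<le> \<rho>"
    using assms(4) by blast
  \<comment> \<open>For \<open>r = 0\<close> the claim would fail when the norm on the right is infinite, as \<open>0 * \<infinity> = 0\<close>.\<close>
  define r where "r = max \<rho> (1 / 2)"
  have r: "r > 0" "r < 1" "\<rho> \<le> r" using \<rho>(1) by (auto simp: r_def)
  have step: "wnorm (- t / 2) (\<lambda>\<mu>. wcoeff v \<mu> - wmatrix_apply A (richardson A M\<omega> v (Suc p)) \<mu>)
       \<le> ennreal r * wnorm (- t / 2) (\<lambda>\<mu>. wcoeff v \<mu> - wmatrix_apply A (richardson A M\<omega> v p) \<mu>)"
    if v: "\<And>i. v i \<in> sobolev (- t / 2)" for v p
  proof (rule wnorm_le[OF r(1)])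
    fix j and \<epsilon> :: "nat^'d" assume \<epsilon>: "\<epsilon> \<in> wavelet_types"
    \<comment> \<open>The locale is used with the enlarged, positive constant \<open>r\<close>, the
      same for all levels and all \<open>v\<close>.\<close>
    interpret richardson_level t A M M\<omega> v j \<epsilon> r
      using assms(1,2) \<epsilon> r v by unfold_locales (auto intro: order_trans[OF \<rho>(2) r(3)])
    let ?N = "\<lambda>p. 1 / (2 * pi) ^ CARD('d) * (LINT \<xi>|lborel. (norm (res p \<xi>))\<^sup>2)"
    have "?N (Suc p) \<le> r\<^sup>2 * ?N p"
      using mult_left_mono[OF residual_contraction, of "1 / (2 * pi) ^ CARD('d)" p]
          by (simp add: mult.left_commute del: res.simps)
    then show "\<exists>a b. a \<le> r\<^sup>2 * b
      \<and> ((\<lambda>k. (norm (wcoeff v (j, \<epsilon>, k) - wmatrix_apply A (richardson A M\<omega> v (Suc p)) (j, \<epsilon>, k)))\<^sup>2)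
          has_sum a) UNIV
      \<and> ((\<lambda>k. (norm (wcoeff v (j, \<epsilon>, k) - wmatrix_apply A (richardson A M\<omega> v p) (j, \<epsilon>, k)))\<^sup>2) has_sum b) UNIV"
      using residual_has_sum by blast
  qed
  show ?thesis
  proof (intro exI[of _ r] conjI allI impI)
    fix v :: "'n \<Rightarrow> (real^'d) distr" and p :: nat
    assume v: "\<forall>i. v i \<in> sobolev (- t / 2)" and "1 \<le> p"
    then obtain q where "p = Suc q" by (cases p) auto
    then show "wnorm (- t / 2) (\<lambda>\<mu>. wcoeff v \<mu> - wmatrix_apply A (richardson A M\<omega> v p) \<mu>)
       \<le> ennreal r * wnorm (- t / 2) (\<lambda>\<mu>. wcoeff v \<mu> - wmatrix_apply A (richardson A M\<omega> v (p - 1)) \<mu>)"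
      using step[of v q] v by (simp only: diff_Suc_1)
  qed (use r in auto)
qed

end
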